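(* Let $H$ be a separable complex Hilbert space with norm $\|\cdot\|$ and let $A$ be a non-negative injective self-adjoint operator in $H$. Let $c(t)$ be a function on $[0,\infty)$ of bounded variation on $(0,\infty)$ satisfying $\inf_{t\ge 0}c(t)>0$, and put $c_\infty=\lim_{t\to\infty}c(t)$. Let $b(t)$ be an integrable function on $[0,\infty)$. Consider the equation $$u''(t)+c(t)^2A^{1/2}\mathcal A^{1/2}u(t)+b(t)u'(t)=0,\quad t\ge 0, \qquad (\mathrm{E})$$ and, for a constant $c_*>0$, the free wave equation $$v''(t)+c_*^2A^{1/2}\mathcal A^{1/2}v(t)=0,\quad t\ge 0. \qquad (\mathrm{F}_{c_*})$$ Then the following hold. (i) Suppose that $\lim_{t\to\infty}\int_0^t(c(s)-c_\infty)\,ds$ exists and is finite. Then for every weak solution $u$ of $(\mathrm{E})$ there exists a unique weak solution $v$ of $(\mathrm{F}_{c_*})$ with wave speed $c_*=c_\infty$ such that $$\lim_{t\to\infty}\left(\|\mathcal A^{1/2}(u(t)-v(t))\|+\|u'(t)-v'(t)\|\right)=0. \qquad (\mathrm{L})$$ (ii) Suppose that there exist a non-trivial weak solution $u$ of $(\mathrm{E})$, a positive constant $c_*$, and a weak solution $v$ of $(\mathrm{F}_{c_*})$ such that $(\mathrm{L})$ holds. Then $c_*=c_\infty$, and $\lim_{t\to\infty}\int_0^t(c(s)-c_\infty)\,ds$ exists and is finite.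
   Context: Spaces. For $\alpha\ge 0$, $\mathbb H_\alpha$ denotes $D(A^\alpha)$ equipped with the inner product $(f,g)_{\mathbb H_\alpha}=(A^\alpha f,A^\alpha g)_H+(f,g)_H$; thus $\mathbb H_0=H$. For $\alpha<0$, $\mathbb H_\alpha$ is the dual space of $\mathbb H_{-\alpha}$, i.e. the completion of $H$ with respect to the norm $\|f\|_{\mathbb H_\alpha}=\sup\{|(f,g)_H| : g\in\mathbb H_{-\alpha},\ \|g\|_{\mathbb H_{-\alpha}}=1\}$. For $\alpha>0$, $\mathcal H_\alpha$ denotes the completion of $D(A^\alpha)$ with respect to the norm $\|A^\alpha\cdot\|$, and $\mathcal A^\alpha$ denotes the extension of $A^\alpha$ to $\mathcal H_\alpha$; $\mathcal A^\alpha:\mathcal H_\alpha\to H$ is an isometric isomorphism. In the equations, $A^{1/2}$ acting on $\mathcal A^{1/2}u(t)\in H$ is understood as the continuous extension $A^{1/2}:H\to\mathbb H_{-1/2}$. For a Banach space $X$, $AC_{\mathrm{loc}}([0,\infty);X)$ is the set of continuous $X$-valued functions on $[0,\infty)$ that are absolutely continuous on $[0,T]$ for every $T>0$. Weak solutions. $u$ is a weak solution of $u''+c(t)^2A^{1/2}\mathcal A^{1/2}u+b(t)u'=0$ if $u\in C([0,\infty);\mathcal H_{1/2})$, $u(t)-u(0)\in C([0,\infty);\mathbb H_{1/2})\cap C^1([0,\infty);\mathbb H_0)$, $u'\in AC_{\mathrm{loc}}([0,\infty);\mathbb H_{-1/2})$, and the equation holds in $\mathbb H_{-1/2}$ for almost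 every $t\in(0,\infty)$. (Here $u'$ is the derivative of $u(t)-u(0)$.) A weak solution of the free wave equation is a weak solution in this sense with $c(t)\equiv c_*$ and $b(t)\equiv 0$. Non-trivial means not identically zero. *)

theory Defs
  imports "HOL-Analysis.Analysis"
begin

class complex_banach = banach +
  fixes scaleC :: "complex \<Rightarrow> 'a \<Rightarrow> 'a" (infixr \<open>*\<^sub>C\<close> 75)
  assumes scaleC_add_right: "a *\<^sub>C (x + y) = a *\<^sub>C x + a *\<^sub>C y"
    and scaleC_add_left: "(a + b) *\<^sub>C x = a *\<^sub>C x + b *\<^sub>C x"
    and scaleC_scaleC: "a *\<^sub>C b *\<^sub>C x = (a * b) *\<^sub>C x"
    and scaleR_scaleC: "r *\<^sub>R x = complex_of_real r *\<^sub>C x"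
    and norm_scaleC: "norm (a *\<^sub>C x) = cmod a * norm x"

class complex_hilbert = complex_banach +
  fixes cinner :: "'a \<Rightarrow> 'a \<Rightarrow> complex"
  assumes cinner_commute: "cinner x y = cnj (cinner y x)"
    and cinner_add_left: "cinner (x + y) z = cinner x z + cinner y z"
    and cinner_scaleC_left: "cinner (a *\<^sub>C x) y = a * cinner x y"
    and cinner_self: "cinner x x = complex_of_real ((norm x)\<^sup>2)"

text \<open>An operator in a Hilbert space is a partial function \<open>T\<close> with domain \<open>dom T\<close>. The composition
  \<open>S \<circ>\<^sub>m T\<close> then has the usual domain, the vectors \<open>x \<in> dom T\<close> with \<open>T x \<in> dom S\<close>.\<close>

definition op_app :: "('a \<rightharpoonup> 'b) \<Rightarrow> 'a \<Rightarrow> 'b" where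
  "op_app T x = the (T x)"

definition clinear_on :: "'a::complex_banach set \<Rightarrow> ('a \<Rightarrow> 'b::complex_banach) \<Rightarrow> bool" where
  "clinear_on S f \<longleftrightarrow>
     0 \<in> S \<and>
     (\<forall>x\<in>S. \<forall>y\<in>S. x + y \<in> S \<and> f (x + y) = f x + f y) \<and>
     (\<forall>a. \<forall>x\<in>S. a *\<^sub>C x \<in> S \<and> f (a *\<^sub>C x) = a *\<^sub>C f x)"

definition op_adjoint :: "('h::complex_hilbert \<rightharpoonup> 'h) \<Rightarrow> ('h \<rightharpoonup> 'h)" where
  "op_adjoint T y =
     (if \<exists>z. \<forall>x\<in>dom T. cinner (op_app T x) y = cinner x z
      then Some (THE z. \<forall>x\<in>dom T. cinner (op_app T x) y = cinner x z)
      else None)"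

definition self_adjoint :: "('h::complex_hilbert \<rightharpoonup> 'h) \<Rightarrow> bool" where
  "self_adjoint T \<longleftrightarrow>
     clinear_on (dom T) (op_app T) \<and> closure (dom T) = UNIV \<and> op_adjoint T = T"

text \<open>For self-adjoint \<open>T\<close> the number \<open>(T x, x)\<close> is real.\<close>

definition nonneg_op :: "('h::complex_hilbert \<rightharpoonup> 'h) \<Rightarrow> bool" where
  "nonneg_op T \<longleftrightarrow> (\<forall>x\<in>dom T. 0 \<le> Re (cinner (op_app T x) x))"

definition injective_op :: "('h \<rightharpoonup> 'h) \<Rightarrow> bool" where
  "injective_op T \<longleftrightarrow> inj_on (op_app T) (dom T)"

text \<open>The square root \<open>A\<^sup>1\<^sup>/\<^sup>2\<close> of a non-negative self-adjoint operator; there is exactly one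
  operator with these properties.\<close>

definition op_sqrt :: "('h::complex_hilbert \<rightharpoonup> 'h) \<Rightarrow> ('h \<rightharpoonup> 'h)" where
  "op_sqrt A = (SOME B. self_adjoint B \<and> nonneg_op B \<and> B \<circ>\<^sub>m B = A)"

text \<open>A completion of the normed space \<open>(S, p)\<close> is a Banach space with an isometric linear embedding
  of \<open>S\<close> with dense range. It is unique up to isometric isomorphism; the statements below are for
  an arbitrary completion.\<close>

definition is_completion ::
    "'a::complex_banach set \<Rightarrow> ('a \<Rightarrow> real) \<Rightarrow> ('a \<Rightarrow> 'b::complex_banach) \<Rightarrow> bool" where
  "is_completion S p e \<longleftrightarrow>
     clinear_on S e \<and> (\<forall>x\<in>S. norm (e x) = p x) \<and> closure (e ` S) = UNIV"

text \<open>The graph norm of \<open>A\<^sup>1\<^sup>/\<^sup>2\<close> on its domain and the dual norm on \<open>H\<close>. The element \<open>0\<close> is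
  inserted only so that the supremum is \<open>0\<close> when \<open>H = {0}\<close>, where the unit sphere is empty.\<close>

definition norm_half :: "('h::complex_hilbert \<rightharpoonup> 'h) \<Rightarrow> 'h \<Rightarrow> real" where
  "norm_half A f = sqrt ((norm (op_app (op_sqrt A) f))\<^sup>2 + (norm f)\<^sup>2)"

definition norm_neg_half :: "('h::complex_hilbert \<rightharpoonup> 'h) \<Rightarrow> 'h \<Rightarrow> real" where
  "norm_neg_half A f =
     Sup (insert 0 {cmod (cinner f g) | g. g \<in> dom (op_sqrt A) \<and> norm_half A g = 1})"

text \<open>\<open>homogeneous_space A \<iota>\<close>: the codomain of \<open>\<iota>\<close> is the completion of \<open>dom (op_sqrt A)\<close> for the
  norm \<open>\<parallel>A\<^sup>1\<^sup>/\<^sup>2 \<cdot>\<parallel>\<close>. \<open>dual_space A j\<close>: the codomain of \<open>j\<close> is the dual of \<open>dom (op_sqrt A)\<close> with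
  the graph norm, constructed as the completion of \<open>H\<close> in the dual norm.\<close>

definition homogeneous_space ::
    "('h::complex_hilbert \<rightharpoonup> 'h) \<Rightarrow> ('h \<Rightarrow> 'k::complex_banach) \<Rightarrow> bool" where
  "homogeneous_space A \<iota> \<longleftrightarrow>
     is_completion (dom (op_sqrt A)) (\<lambda>f. norm (op_app (op_sqrt A) f)) \<iota>"

definition dual_space ::
    "('h::complex_hilbert \<rightharpoonup> 'h) \<Rightarrow> ('h \<Rightarrow> 'm::complex_banach) \<Rightarrow> bool" where
  "dual_space A j \<longleftrightarrow> is_completion UNIV (norm_neg_half A) j"

text \<open>The two continuous extensions of \<open>A\<^sup>1\<^sup>/\<^sup>2\<close>: to the homogeneous space with values in \<open>H\<close>, and to
  \<open>H\<close> with values in the dual space.\<close>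

definition sqrt_homogeneous ::
    "('h::complex_hilbert \<rightharpoonup> 'h) \<Rightarrow> ('h \<Rightarrow> 'k::complex_banach) \<Rightarrow> 'k \<Rightarrow> 'h" where
  "sqrt_homogeneous A \<iota> =
     (THE F. continuous_on UNIV F \<and> (\<forall>f\<in>dom (op_sqrt A). F (\<iota> f) = op_app (op_sqrt A) f))"

definition sqrt_dual ::
    "('h::complex_hilbert \<rightharpoonup> 'h) \<Rightarrow> ('h \<Rightarrow> 'm::complex_banach) \<Rightarrow> 'h \<Rightarrow> 'm" where
  "sqrt_dual A j =
     (THE F. continuous_on UNIV F \<and> (\<forall>f\<in>dom (op_sqrt A). F f = j (op_app (op_sqrt A) f)))"

definition bounded_variation_on :: "(real \<Rightarrow> real) \<Rightarrow> real set \<Rightarrow> bool" where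
  "bounded_variation_on f S \<longleftrightarrow>
     (\<exists>M. \<forall>n (t::nat \<Rightarrow> real).
        (\<forall>i\<le>n. t i \<in> S) \<and> (\<forall>i<n. t i \<le> t (Suc i)) \<longrightarrow>
        (\<Sum>i<n. \<bar>f (t (Suc i)) - f (t i)\<bar>) \<le> M)"

definition absolutely_continuous_on :: "real set \<Rightarrow> (real \<Rightarrow> 'b::real_normed_vector) \<Rightarrow> bool" where
  "absolutely_continuous_on S f \<longleftrightarrow>
     (\<forall>\<epsilon>>0. \<exists>\<delta>>0. \<forall>n (x::nat \<Rightarrow> real) (y::nat \<Rightarrow> real).
        (\<forall>i<n. x i \<le> y i \<and> {x i..y i} \<subseteq> S) \<and>
        disjoint_family_on (\<lambda>i. {x i<..<y i}) {..<n} \<and>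
        (\<Sum>i<n. y i - x i) < \<delta> \<longrightarrow>
        (\<Sum>i<n. norm (f (y i) - f (x i))) < \<epsilon>)"

definition AC_loc :: "(real \<Rightarrow> 'b::real_normed_vector) \<Rightarrow> bool" where
  "AC_loc f \<longleftrightarrow> continuous_on {0..} f \<and> (\<forall>T>0. absolutely_continuous_on {0..T} f)"

text \<open>The function \<open>u(t) - u(0)\<close> as a function with values in \<open>D(A\<^sup>1\<^sup>/\<^sup>2) \<subseteq> H\<close>, and its derivative
  in \<open>H\<close> (one-sided at \<open>t = 0\<close>). Functions on \<open>[0,\<infinity>)\<close> are functions on \<open>real\<close> whose values at
  negative arguments are ignored.\<close>

definition increment ::
    "('h::complex_hilbert \<rightharpoonup> 'h) \<Rightarrow> ('h \<Rightarrow> 'k::complex_banach) \<Rightarrow> (real \<Rightarrow> 'k) \<Rightarrow> real \<Rightarrow> 'h" where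
  "increment A \<iota> u t = the_inv_into (dom (op_sqrt A)) \<iota> (u t - u 0)"

definition velocity ::
    "('h::complex_hilbert \<rightharpoonup> 'h) \<Rightarrow> ('h \<Rightarrow> 'k::complex_banach) \<Rightarrow> (real \<Rightarrow> 'k) \<Rightarrow> real \<Rightarrow> 'h" where
  "velocity A \<iota> u t = vector_derivative (increment A \<iota> u) (at t within {0..})"

definition weak_solution ::
    "('h::complex_hilbert \<rightharpoonup> 'h) \<Rightarrow> ('h \<Rightarrow> 'k::complex_banach) \<Rightarrow> ('h \<Rightarrow> 'm::complex_banach) \<Rightarrow>
     (real \<Rightarrow> real) \<Rightarrow> (real \<Rightarrow> complex) \<Rightarrow> (real \<Rightarrow> 'k) \<Rightarrow> bool" where
  "weak_solution A \<iota> j c b u \<longleftrightarrow>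
     continuous_on {0..} u \<and>
     (\<forall>t\<ge>0. u t - u 0 \<in> \<iota> ` dom (op_sqrt A)) \<and>
     (\<forall>t\<ge>0. ((\<lambda>s. norm_half A (increment A \<iota> u s - increment A \<iota> u t)) \<longlongrightarrow> 0)
              (at t within {0..})) \<and>
     (\<forall>t\<ge>0. (increment A \<iota> u has_vector_derivative velocity A \<iota> u t) (at t within {0..})) \<and>
     continuous_on {0..} (velocity A \<iota> u) \<and>
     AC_loc (\<lambda>t. j (velocity A \<iota> u t)) \<and>
     (AE t in lebesgue. t > 0 \<longrightarrow>
        (\<exists>a. ((\<lambda>s. j (velocity A \<iota> u s)) has_vector_derivative a) (at t) \<and>
             a + (c t)\<^sup>2 *\<^sub>R sqrt_dual A j (sqrt_homogeneous A \<iota> (u t))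
               + b t *\<^sub>C j (velocity A \<iota> u t) = 0))"

definition free_weak_solution ::
    "('h::complex_hilbert \<rightharpoonup> 'h) \<Rightarrow> ('h \<Rightarrow> 'k::complex_banach) \<Rightarrow> ('h \<Rightarrow> 'm::complex_banach) \<Rightarrow>
     real \<Rightarrow> (real \<Rightarrow> 'k) \<Rightarrow> bool" where
  "free_weak_solution A \<iota> j cs v \<longleftrightarrow> weak_solution A \<iota> j (\<lambda>t. cs) (\<lambda>t. 0) v"

definition asymptotic ::
    "('h::complex_hilbert \<rightharpoonup> 'h) \<Rightarrow> ('h \<Rightarrow> 'k::complex_banach) \<Rightarrow>
     (real \<Rightarrow> 'k) \<Rightarrow> (real \<Rightarrow> 'k) \<Rightarrow> bool" where
  "asymptotic A \<iota> u v \<longleftrightarrow>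
     ((\<lambda>t. norm (sqrt_homogeneous A \<iota> (u t - v t)) + norm (velocity A \<iota> u t - velocity A \<iota> v t))
        \<longlongrightarrow> 0) at_top"

end

theory Submission
  imports Defs "HOL-Computational_Algebra.Polynomial"
begin

text \<open>Let \<open>B = A\<^sup>1\<^sup>/\<^sup>2\<close> and let \<open>U s\<close> be the unitary group generated by \<open>i B\<close>, obtained as a limit of
  powers of Cayley transforms. In energy space a weak solution is a pair \<open>W = \<A> u\<close>, \<open>V = u'\<close> with
  \<open>W' = B V\<close> and \<open>V' = - c\<^sup>2 B W - b V\<close> in the weak sense. With \<open>\<tau> t = \<integral>\<^sub>0\<^sup>t c\<close> and
  \<open>\<phi>\<^sub>\<plusminus> = V \<plusminus> i c W\<close>, the functions \<open>\<psi>\<^sub>\<plusminus> = U (\<minusplus> \<tau>) \<phi>\<^sub>\<plusminus>\<close> change only through \<open>b dt\<close> and \<open>dc\<close>, a finite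
  measure. Hence they converge as \<open>t \<rightarrow> \<infinity>\<close>, and both limits vanish only for the zero solution. So
  \<open>\<phi>\<^sub>\<plusminus>\<close> is asymptotic to \<open>U (\<plusminus> \<tau>) z\<^sub>\<plusminus>\<close>, which is a free wave exactly if \<open>\<tau> t - c\<^sub>\<infinity> t\<close>
  converges: a wrong speed is excluded by averaging over time, and for the right speed a phase that
  does not converge would make some \<open>z\<^sub>\<plusminus> \<noteq> 0\<close> a fixed vector of \<open>U\<close>, against the injectivity of \<open>B\<close>.\<close>

section \<open>Complex Hilbert spaces\<close>

text \<open>The obstacle is low regularity: \<open>c\<close> may jump, so \<open>\<phi>\<close> need
  not be differentiable in time, and \<open>W\<close> and \<open>V\<close> are only known to lie in
  \<open>H\<close>, so \<open>B\<close> cannot be applied to them. Hence increments are tested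
  against vectors from the dense domain of \<open>B\<^sup>2\<close> and estimated over short
  intervals. Freezing \<open>c\<close> there costs the length of the interval times a small
  oscillation, the variation of \<open>c\<close> or the length again, and such errors disappear
  under refinement even across jumps. What survives is the increment of one bounded monotone
  function \<open>m\<close>, which stands for the measure \<open>|b| dt + |dc|\<close>; this
  replaces Stieltjes calculus. Since \<open>U\<close> is isometric, the estimates run in both
  directions of time, and the backward one shows that a solution whose energy tends to zero is zero.
  The group and the square root are built from resolvents alone: Cayley transforms are isometries,
  so that local errors merely add up under dyadic refinement, and the root comes from a polynomial
  iteration applied to the bounded operators \<open>R\<close> and \<open>1 - R\<close>.\<close>

lemma scaleC_0_left [simp]: "(0::complex) *\<^sub>C (x::'a::complex_banach) = 0"
  using scaleC_add_left[of 0 0 x] by simp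

lemma scaleC_0_right [simp]: "a *\<^sub>C (0::'a::complex_banach) = 0"
  using scaleC_add_right[of a 0 "0::'a"] by simp

lemma scaleC_1 [simp]: "(1::complex) *\<^sub>C (x::'a::complex_banach) = x"
  using scaleR_scaleC[of 1 x] by simp

lemma scaleC_minus_left [simp]: "(- a) *\<^sub>C (x::'a::complex_banach) = - (a *\<^sub>C x)"
  by (metis add_eq_0_iff2 add.right_inverse scaleC_0_left scaleC_add_left)

lemma scaleC_minus_right [simp]: "a *\<^sub>C (- x::'a::complex_banach) = - (a *\<^sub>C x)"
  by (metis add_eq_0_iff2 add.right_inverse scaleC_0_right scaleC_add_right)

lemma scaleC_diff_left: "(a - b) *\<^sub>C (x::'a::complex_banach) = a *\<^sub>C x - b *\<^sub>C x"
  using scaleC_add_left[of a "-b" x] by simp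

lemma scaleC_diff_right: "a *\<^sub>C (x - y::'a::complex_banach) = a *\<^sub>C x - a *\<^sub>C y"
  using scaleC_add_right[of a x "-y"] by simp

lemma scaleC_scaleR_left: "a *\<^sub>C (r *\<^sub>R (x::'a::complex_banach)) = r *\<^sub>R (a *\<^sub>C x)"
  by (simp add: scaleR_scaleC scaleC_scaleC mult.commute)

lemma bounded_bilinear_scaleC: "bounded_bilinear (\<lambda>a (x::'a::complex_banach). a *\<^sub>C x)"
proof
  show "(a + a') *\<^sub>C b = a *\<^sub>C b + a' *\<^sub>C b" for a a' and b :: 'a by (rule scaleC_add_left)
  show "a *\<^sub>C (b + b') = a *\<^sub>C b + a *\<^sub>C b'" for a and b b' :: 'a by (rule scaleC_add_right)
  show "(r *\<^sub>R a) *\<^sub>C b = r *\<^sub>R a *\<^sub>C b" for r a and b :: 'a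
    by (simp add: scaleR_scaleC scaleC_scaleC scaleR_conv_of_real)
  show "a *\<^sub>C r *\<^sub>R b = r *\<^sub>R a *\<^sub>C b" for r a and b :: 'a by (rule scaleC_scaleR_left)
  show "\<exists>K. \<forall>a b. norm (a *\<^sub>C (b::'a)) \<le> norm a * norm b * K"
    by (rule exI[of _ 1]) (simp add: norm_scaleC)
qed

lemmas tendsto_scaleC = bounded_bilinear.tendsto[OF bounded_bilinear_scaleC]
lemmas continuous_on_scaleC [continuous_intros] = bounded_bilinear.continuous_on[OF bounded_bilinear_scaleC]
lemmas bounded_linear_scaleC = bounded_bilinear.bounded_linear_right[OF bounded_bilinear_scaleC]

lemma cinner_add_right: "cinner (x::'a::complex_hilbert) (y + z) = cinner x y + cinner x z"
  by (metis cinner_add_left cinner_commute complex_cnj_add)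

lemma cinner_scaleC_right: "cinner (x::'a::complex_hilbert) (a *\<^sub>C y) = cnj a * cinner x y"
  by (metis cinner_scaleC_left cinner_commute complex_cnj_mult)

lemma cinner_0_left [simp]: "cinner 0 (x::'a::complex_hilbert) = 0"
  using cinner_scaleC_left[of 0 0 x] by simp

lemma cinner_0_right [simp]: "cinner (x::'a::complex_hilbert) 0 = 0"
  using cinner_scaleC_right[of x 0 0] by simp

lemma cinner_minus_left [simp]: "cinner (- x) (y::'a::complex_hilbert) = - cinner x y"
  using cinner_scaleC_left[of "-1" x y] by simp

lemma cinner_minus_right [simp]: "cinner x (- y::'a::complex_hilbert) = - cinner x y"
  using cinner_scaleC_right[of x "-1" y] by simp

lemma cinner_diff_left: "cinner (x - y) (z::'a::complex_hilbert) = cinner x z - cinner y z"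
  using cinner_add_left[of x "-y" z] by simp

lemma cinner_diff_right: "cinner x (y - z::'a::complex_hilbert) = cinner x y - cinner x z"
  using cinner_add_right[of x y "-z"] by simp

lemma cinner_scaleR_left: "cinner (r *\<^sub>R x) (y::'a::complex_hilbert) = of_real r * cinner x y"
  by (simp add: scaleR_scaleC cinner_scaleC_left)

lemma cinner_scaleR_right: "cinner x (r *\<^sub>R y::'a::complex_hilbert) = of_real r * cinner x y"
  by (simp add: scaleR_scaleC cinner_scaleC_right)

lemmas cinner_algebra = cinner_add_left cinner_add_right cinner_diff_left cinner_diff_right
  cinner_scaleC_left cinner_scaleC_right cinner_scaleR_left cinner_scaleR_right

lemma norm_eq_cinner: "(norm (x::'a::complex_hilbert))\<^sup>2 = Re (cinner x x)"
  by (simp add: cinner_self)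

lemma cinner_eq_0_iff [simp]: "cinner x (x::'a::complex_hilbert) = 0 \<longleftrightarrow> x = 0"
  by (simp add: cinner_self)

text \<open>Pythagoras for the residual of the projection of \<open>x\<close> onto the line through
  \<open>y\<close>. Its non-negativity is the Cauchy-Schwarz inequality, and at a nearest point it
  forces orthogonality.\<close>

lemma norm_diff_projection:
  fixes x y :: "'a::complex_hilbert"
  assumes "y \<noteq> 0"
  shows "(norm (x - (cinner x y / of_real ((norm y)\<^sup>2)) *\<^sub>C y))\<^sup>2
           = (norm x)\<^sup>2 - (cmod (cinner x y))\<^sup>2 / (norm y)\<^sup>2"
proof -
  define l where "l = cinner x y / of_real ((norm y)\<^sup>2)"
  have n: "complex_of_real (norm y) \<noteq> 0" using assms by simp
  have "cinner (x - l *\<^sub>C y) (x - l *\<^sub>C y)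
      = cinner x x - cnj l * cinner x y - l * cnj (cinner x y) + l * cnj l * cinner y y"
    using cinner_commute[of y x] by (simp add: cinner_algebra algebra_simps)
  also have "\<dots> = of_real ((norm x)\<^sup>2 - (cmod (cinner x y))\<^sup>2 / (norm y)\<^sup>2)"
    using n by (simp add: l_def cinner_self field_simps power2_eq_square
        flip: complex_norm_square[unfolded power2_eq_square])
  finally show ?thesis unfolding norm_eq_cinner[of "x - _"] l_def[symmetric] by simp
qed

lemma Cauchy_Schwarz_cinner: "cmod (cinner x y) \<le> norm x * norm (y::'a::complex_hilbert)"
proof (cases "y = 0")
  case False
  have "0 \<le> (norm x)\<^sup>2 - (cmod (cinner x y))\<^sup>2 / (norm y)\<^sup>2"
    unfolding norm_diff_projection[OF False, symmetric] by simp
  then have "(cmod (cinner x y))\<^sup>2 \<le> (norm x * norm y)\<^sup>2"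
    using False by (simp add: field_simps power_mult_distrib)
  then show ?thesis by (rule power2_le_imp_le) simp
qed simp

lemma bounded_bilinear_cinner: "bounded_bilinear (cinner :: 'a::complex_hilbert \<Rightarrow> 'a \<Rightarrow> complex)"
proof
  show "\<exists>K. \<forall>a b::'a. norm (cinner a b) \<le> norm a * norm b * K"
    by (rule exI[of _ 1]) (simp add: Cauchy_Schwarz_cinner)
qed (simp_all add: cinner_algebra scaleR_conv_of_real)

lemmas tendsto_cinner = bounded_bilinear.tendsto[OF bounded_bilinear_cinner]
lemmas continuous_on_cinner [continuous_intros] = bounded_bilinear.continuous_on[OF bounded_bilinear_cinner]
lemmas bounded_linear_cinner_left = bounded_bilinear.bounded_linear_left[OF bounded_bilinear_cinner]

text \<open>By continuity the bound extends from \<open>S\<close> to its closure, in particular to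
  \<open>x\<close> itself. Norm estimates can thus be proved with test vectors that are regular
  enough for \<open>B\<close>.\<close>

lemma norm_le_of_cinner:
  fixes x :: "'a::complex_hilbert"
  assumes "\<And>g. g \<in> S \<Longrightarrow> cmod (cinner x g) \<le> C * norm g" and "closure S = UNIV" and "0 \<le> C"
  shows "norm x \<le> C"
proof -
  have "closed {g. cmod (cinner x g) \<le> C * norm g}"
    by (intro closed_Collect_le continuous_intros)
  then have "closure S \<subseteq> {g. cmod (cinner x g) \<le> C * norm g}"
    using assms(1) by (intro closure_minimal) auto
  then have "cmod (cinner x x) \<le> C * norm x" using assms(2) by auto
  then have "norm x * norm x \<le> C * norm x"
    by (simp add: cinner_self power2_eq_square norm_mult)
  then show ?thesis using assms(3) by (cases "x = 0") auto
qed

lemma eq_0_of_cinner: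
  fixes x :: "'a::complex_hilbert"
  assumes "\<And>g. g \<in> S \<Longrightarrow> cinner x g = 0" and "closure S = UNIV"
  shows "x = 0"
  using norm_le_of_cinner[of S x 0] assms by simp

lemma parallelogram_law:
  "(norm (x + y))\<^sup>2 + (norm (x - y::'a::complex_hilbert))\<^sup>2 = 2 * (norm x)\<^sup>2 + 2 * (norm y)\<^sup>2"
  by (simp add: norm_eq_cinner cinner_algebra)

lemma clinear_onD:
  assumes "clinear_on S f"
  shows "0 \<in> S" "x \<in> S \<Longrightarrow> y \<in> S \<Longrightarrow> x + y \<in> S" "x \<in> S \<Longrightarrow> a *\<^sub>C x \<in> S"
    "x \<in> S \<Longrightarrow> y \<in> S \<Longrightarrow> f (x + y) = f x + f y" "x \<in> S \<Longrightarrow> f (a *\<^sub>C x) = a *\<^sub>C f x"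
    "x \<in> S \<Longrightarrow> y \<in> S \<Longrightarrow> x - y \<in> S" "x \<in> S \<Longrightarrow> y \<in> S \<Longrightarrow> f (x - y) = f x - f y"
    "f 0 = 0" "x \<in> S \<Longrightarrow> r *\<^sub>R x \<in> S" "x \<in> S \<Longrightarrow> f (r *\<^sub>R x) = r *\<^sub>R f x"
    "x \<in> S \<Longrightarrow> - x \<in> S" "x \<in> S \<Longrightarrow> f (- x) = - f x"
proof -
  show 0: "0 \<in> S" and add: "\<And>x y. x \<in> S \<Longrightarrow> y \<in> S \<Longrightarrow> x + y \<in> S"
    and scl: "\<And>x a. x \<in> S \<Longrightarrow> a *\<^sub>C x \<in> S"
    and fadd: "\<And>x y. x \<in> S \<Longrightarrow> y \<in> S \<Longrightarrow> f (x + y) = f x + f y"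
    and fscl: "\<And>x a. x \<in> S \<Longrightarrow> f (a *\<^sub>C x) = a *\<^sub>C f x"
    using assms unfolding clinear_on_def by blast+
  have m: "- x = (-1) *\<^sub>C x" for x :: 'a by simp
  show mi: "x \<in> S \<Longrightarrow> - x \<in> S" for x using scl[of x "-1"] by simp
  show fmi: "x \<in> S \<Longrightarrow> f (- x) = - f x" for x using fscl[of x "-1"] by simp
  show "f 0 = 0" using fscl[OF 0, of 0] by simp
  show "x \<in> S \<Longrightarrow> r *\<^sub>R x \<in> S" using scl by (simp add: scaleR_scaleC)
  show "x \<in> S \<Longrightarrow> f (r *\<^sub>R x) = r *\<^sub>R f x" using fscl by (simp add: scaleR_scaleC)
  show "x \<in> S \<Longrightarrow> y \<in> S \<Longrightarrow> x - y \<in> S" using add[of x "-y"] mi by simp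
  show "x \<in> S \<Longrightarrow> y \<in> S \<Longrightarrow> f (x - y) = f x - f y" using fadd[of x "-y"] fmi mi by simp
qed

text \<open>\<open>z\<close> joins a point outside \<open>M\<close> to its nearest point in
  \<open>M\<close>, which exists by completeness. It will give surjectivity of resolvents and of the
  isometry \<open>\<A>\<close>.\<close>

lemma exists_orthogonal:
  fixes M :: "'a::complex_hilbert set"
  assumes lin: "clinear_on M (\<lambda>x. x)" and "closed M" and "M \<noteq> UNIV"
  shows "\<exists>z. z \<noteq> 0 \<and> (\<forall>x\<in>M. cinner x z = 0)"
proof -
  note [simp] = clinear_onD(1,2,3,6,9,11)[OF lin]
  obtain p where p: "p \<notin> M" using assms(3) by auto
  define d where "d = infdist p M"
  have ne: "M \<noteq> {}" using clinear_onD(1)[OF lin] by blast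
  have lb: "d \<le> norm (p - m)" if "m \<in> M" for m
    using infdist_le[OF that, of p] by (simp add: d_def dist_norm)
  have d0: "0 \<le> d" by (simp add: d_def infdist_nonneg)
  have "\<exists>x\<in>M. norm (p - x) < d + 1 / Suc n" for n
  proof -
    have "infdist p M < d + 1 / Suc n" by (simp add: d_def)
    moreover have "bdd_below ((\<lambda>y. norm (p - y)) ` M)" by (rule bdd_belowI[of _ 0]) auto
    ultimately show ?thesis using ne by (simp add: infdist_notempty dist_norm cINF_less_iff)
  qed
  then obtain x where x: "x n \<in> M" "norm (p - x n) < d + 1 / Suc n" for n by metis
  have par: "(norm (x m - x n))\<^sup>2 \<le> 2 * ((norm (p - x n))\<^sup>2 - d\<^sup>2) + 2 * ((norm (p - x m))\<^sup>2 - d\<^sup>2)" for m n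
  proof -
    have "(norm ((p - x n) + (p - x m)))\<^sup>2 + (norm ((p - x n) - (p - x m)))\<^sup>2
        = 2 * (norm (p - x n))\<^sup>2 + 2 * (norm (p - x m))\<^sup>2" by (rule parallelogram_law)
    moreover have "(p - x n) + (p - x m) = 2 *\<^sub>R (p - (1/2) *\<^sub>R (x n + x m))"
      by (simp add: algebra_simps flip: scaleR_2)
    then have "norm ((p - x n) + (p - x m)) = 2 * norm (p - (1/2) *\<^sub>R (x n + x m))" by (simp only: norm_scaleR abs_numeral real_norm_def)
    \<comment> \<open>The midpoint of two points of \<open>M\<close> lies in \<open>M\<close>, so
      its distance to \<open>p\<close> is at least \<open>d\<close>.\<close>
    moreover have "d\<^sup>2 \<le> (norm (p - (1/2) *\<^sub>R (x n + x m)))\<^sup>2"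
      using lb[of "(1/2) *\<^sub>R (x n + x m)"] x d0 by (intro power_mono) auto
    ultimately show ?thesis by (simp add: power_mult_distrib)
  qed
  have lim: "(\<lambda>n. (norm (p - x n))\<^sup>2 - d\<^sup>2) \<longlonglongrightarrow> 0"
  proof -
    have "(\<lambda>n. norm (p - x n)) \<longlonglongrightarrow> d"
    proof (rule tendsto_sandwich[of "\<lambda>_. d" _ _ "\<lambda>n. d + 1 / Suc n"])
      show "(\<lambda>n. d + 1 / Suc n) \<longlonglongrightarrow> d"
        using tendsto_add[OF tendsto_const LIMSEQ_inverse_real_of_nat, of d] by (simp add: inverse_eq_divide)
    qed (use x lb in \<open>auto intro!: always_eventually less_imp_le\<close>)
    from tendsto_diff[OF tendsto_power[OF this, of 2] tendsto_const[of "d\<^sup>2"]] show ?thesis by simp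
  qed
  have "Cauchy x"
  proof (rule metric_CauchyI)
    fix e :: real assume "0 < e"
    then have "eventually (\<lambda>n. (norm (p - x n))\<^sup>2 - d\<^sup>2 < e\<^sup>2 / 4) sequentially"
      by (intro order_tendstoD[OF lim]) simp
    then obtain N where N: "\<And>n. n \<ge> N \<Longrightarrow> (norm (p - x n))\<^sup>2 - d\<^sup>2 < e\<^sup>2 / 4"
      by (auto simp: eventually_sequentially)
    show "\<exists>M. \<forall>m\<ge>M. \<forall>n\<ge>M. dist (x m) (x n) < e"
    proof (intro exI allI impI)
      fix m n assume "N \<le> m" "N \<le> n"
      then have "(norm (x m - x n))\<^sup>2 < e\<^sup>2" using par[of m n] N[of m] N[of n] by argo
      then show "dist (x m) (x n) < e" using \<open>0 < e\<close> by (simp add: dist_norm power2_less_imp_less)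
    qed
  qed
  then obtain q where q: "x \<longlonglongrightarrow> q" using convergent_eq_Cauchy by blast
  have qM: "q \<in> M" using closed_sequentially[OF assms(2)] x q by blast
  define z where "z = p - q"
  have "z \<noteq> 0" using qM p by (auto simp: z_def)
  have "(norm z)\<^sup>2 - d\<^sup>2 = 0"
    by (rule LIMSEQ_unique[OF _ lim]) (auto simp: z_def intro!: tendsto_intros q)
  then have nz: "norm z = d" using d0 by (simp add: power2_eq_iff_nonneg)
  have "cinner m z = 0" if "m \<in> M" for m
  proof (cases "m = 0")
    case False
    \<comment> \<open>Subtracting from \<open>z\<close> its projection onto \<open>m\<close> amounts
      to replacing \<open>q\<close> by another point of \<open>M\<close>, which cannot shorten
      \<open>z\<close>; so the projection vanishes.\<close>
    have "d \<le> norm (z - (cinner z m / of_real ((norm m)\<^sup>2)) *\<^sub>C m)"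
      using lb[of "q + (cinner z m / of_real ((norm m)\<^sup>2)) *\<^sub>C m"] qM that by (simp add: z_def diff_diff_eq)
    then have "d\<^sup>2 \<le> (norm (z - (cinner z m / of_real ((norm m)\<^sup>2)) *\<^sub>C m))\<^sup>2"
      using d0 by (intro power_mono) auto
    then have "(cmod (cinner z m))\<^sup>2 / (norm m)\<^sup>2 \<le> 0"
      unfolding norm_diff_projection[OF False] nz by simp
    then have "cinner z m = 0" using False by (simp add: divide_le_0_iff power2_eq_square mult_le_0_iff)
    then show ?thesis using cinner_commute[of m z] by simp
  qed simp
  then show ?thesis using \<open>z \<noteq> 0\<close> by auto
qed

section \<open>Self-adjoint operators\<close>

text \<open>A total function \<open>B\<close> considered on \<open>D\<close> avoids carrying partial
  maps around. \<open>maximal\<close> says that the adjoint is contained in \<open>B\<close>;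
  together with \<open>sym\<close> and density this is self-adjointness, as
  \<open>self_adjoint_iff\<close> shows.\<close>

locale sa_operator =
  fixes D :: "'h::complex_hilbert set" and B :: "'h \<Rightarrow> 'h"
  assumes lin: "clinear_on D B" and dense: "closure D = UNIV"
    and sym: "x \<in> D \<Longrightarrow> y \<in> D \<Longrightarrow> cinner (B x) y = cinner x (B y)"
    and maximal: "(\<And>x. x \<in> D \<Longrightarrow> cinner (B x) y = cinner x z) \<Longrightarrow> y \<in> D \<and> B y = z"
begin

lemmas lin_rules [simp] = clinear_onD[OF lin]

text \<open>The identity that defines the adjoint is continuous in the pair \<open>(y, z)\<close>,
  so it survives limits, and \<open>maximal\<close> applies to the limit.\<close>

lemma closed_graph:
  assumes "\<And>n. x n \<in> D" "x \<longlonglongrightarrow> y" "(\<lambda>n. B (x n)) \<longlonglongrightarrow> z"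
  shows "y \<in> D \<and> B y = z"
proof (rule maximal)
  fix g assume "g \<in> D"
  then have "(\<lambda>n. cinner (B g) (x n)) = (\<lambda>n. cinner g (B (x n)))" using assms(1) sym by auto
  moreover have "(\<lambda>n. cinner (B g) (x n)) \<longlonglongrightarrow> cinner (B g) y"
    by (intro tendsto_cinner tendsto_const assms)
  moreover have "(\<lambda>n. cinner g (B (x n))) \<longlonglongrightarrow> cinner g z"
    by (intro tendsto_cinner tendsto_const assms)
  ultimately show "cinner (B g) y = cinner g z" by (metis LIMSEQ_unique)
qed

text \<open>Lower bounds for \<open>1 + z B\<close> and for its formal adjoint. They hold for
  imaginary \<open>z\<close>, which serves the group, and for \<open>z = 1\<close> if the operator
  is non-negative, which serves the square root.\<close>

definition resolvable :: "complex \<Rightarrow> bool" where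
  "resolvable z \<longleftrightarrow> z \<noteq> 0 \<and> (\<forall>x\<in>D. norm x \<le> norm (x + z *\<^sub>C B x) \<and> norm x \<le> norm (x + cnj z *\<^sub>C B x))"

text \<open>The first bound and the closed graph make the range closed. A vector orthogonal to the
  range is annihilated by \<open>1 + cnj z B\<close>, so it is zero by the second bound.\<close>

lemma resolvable_surj:
  assumes "resolvable z"
  shows "\<exists>x\<in>D. x + z *\<^sub>C B x = y"
proof -
  have False: "z \<noteq> 0" using assms by (simp add: resolvable_def)
  define M where "M = (\<lambda>x. x + z *\<^sub>C B x) ` D"
  have bd: "x \<in> D \<Longrightarrow> norm x \<le> norm (x + z *\<^sub>C B x)" "x \<in> D \<Longrightarrow> norm x \<le> norm (x + cnj z *\<^sub>C B x)" for x
    using assms by (auto simp: resolvable_def)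
  have "clinear_on M (\<lambda>x. x)" unfolding clinear_on_def M_def
  proof (intro conjI ballI allI; (elim imageE)?)
    show "0 \<in> (\<lambda>x. x + z *\<^sub>C B x) ` D" by (rule image_eqI[of _ _ 0]) auto
    fix u v x y assume "u = x + z *\<^sub>C B x" "v = y + z *\<^sub>C B y" "x \<in> D" "y \<in> D"
    then show "u + v \<in> (\<lambda>x. x + z *\<^sub>C B x) ` D"
      by (intro image_eqI[of _ _ "x + y"]) (auto simp: scaleC_add_right)
  next
    fix a u x assume "u = x + z *\<^sub>C B x" "x \<in> D"
    then show "a *\<^sub>C u \<in> (\<lambda>x. x + z *\<^sub>C B x) ` D"
      by (intro image_eqI[of _ _ "a *\<^sub>C x"]) (auto simp: scaleC_add_right scaleC_scaleC mult.commute)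
  qed auto
  moreover have "closed M" unfolding closed_sequential_limits
  proof safe
    fix u l assume u: "\<forall>n. u n \<in> M" "u \<longlonglongrightarrow> l"
    then have "\<forall>n. \<exists>x. x \<in> D \<and> u n = x + z *\<^sub>C B x" by (auto simp: M_def)
    then obtain x where x: "\<And>n. x n \<in> D" "\<And>n. u n = x n + z *\<^sub>C B (x n)" by metis
    have "norm (x m - x n) \<le> norm (u m - u n)" for m n
      using bd(1)[of "x m - x n"] x(1) by (simp add: x(2) scaleC_diff_right algebra_simps)
    then have "Cauchy x" using LIMSEQ_imp_Cauchy[OF u(2)] unfolding Cauchy_def dist_norm
      by (meson le_less_trans)
    then obtain y where y: "x \<longlonglongrightarrow> y" using convergent_eq_Cauchy by blast
    \<comment> \<open>The vectors \<open>B (x n)\<close> are recovered from \<open>u n\<close> and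
      \<open>x n\<close>, so they converge as well.\<close>
    have "(\<lambda>n. (1/z) *\<^sub>C (u n - x n)) \<longlonglongrightarrow> (1/z) *\<^sub>C (l - y)"
      by (intro tendsto_scaleC tendsto_const tendsto_diff u y)
    moreover have "(\<lambda>n. (1/z) *\<^sub>C (u n - x n)) = (\<lambda>n. B (x n))"
      using False by (simp add: x(2) scaleC_scaleC)
    ultimately have "y \<in> D \<and> B y = (1/z) *\<^sub>C (l - y)" by (intro closed_graph[of x] x y) simp
    then show "l \<in> M" unfolding M_def by (intro image_eqI[of _ _ y]) (use False in \<open>auto simp: scaleC_scaleC\<close>)
  qed
  moreover have "w = 0" if w: "\<forall>m\<in>M. cinner m w = 0" for w
  proof -
    have "w \<in> D \<and> B w = (- cnj (1/z)) *\<^sub>C w"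
    proof (rule maximal)
      fix x assume "x \<in> D"
      then have "cinner (x + z *\<^sub>C B x) w = 0" using w by (auto simp: M_def)
      then show "cinner (B x) w = cinner x ((- cnj (1/z)) *\<^sub>C w)"
        using False by (simp add: cinner_algebra field_simps add_eq_0_iff)
    qed
    then have "w \<in> D" and Bw: "B w = (- cnj (1/z)) *\<^sub>C w" by blast+
    have "w + cnj z *\<^sub>C B w = 0" unfolding Bw scaleC_scaleC using False by simp
    then show ?thesis using bd(2)[of w] \<open>w \<in> D\<close> by simp
  qed
  ultimately have "M = UNIV" using exists_orthogonal by blast
  then have "y \<in> M" by simp
  then show ?thesis unfolding M_def by auto
qed

end

section \<open>The unitary group generated by a self-adjoint operator\<close>

text \<open>Linear isometries, onto or not; bijectivity of the group comes later from
  \<open>U (- t)\<close>.\<close>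

definition isom :: "('h::complex_hilbert \<Rightarrow> 'h) \<Rightarrow> bool" where
  "isom P \<longleftrightarrow> (\<forall>x y. P (x + y) = P x + P y) \<and> (\<forall>a x. P (a *\<^sub>C x) = a *\<^sub>C P x) \<and> (\<forall>x. norm (P x) = norm x)"

lemma isomD:
  assumes "isom P"
  shows "P (x + y) = P x + P y" "P (a *\<^sub>C x) = a *\<^sub>C P x" "norm (P x) = norm x"
    "P (x - y) = P x - P y" "P 0 = 0" "P (r *\<^sub>R x) = r *\<^sub>R P x"
proof -
  show a: "P (x + y) = P x + P y" "P (a *\<^sub>C x) = a *\<^sub>C P x" "norm (P x) = norm x" for x y a
    using assms by (auto simp: isom_def)
  show "P (x - y) = P x - P y" using a(1)[of "x - y" y] by (simp add: algebra_simps)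
  show "P 0 = 0" using a(2)[of 0 0] by simp
  show "P (r *\<^sub>R x) = r *\<^sub>R P x" by (simp add: scaleR_scaleC a)
qed

lemma isom_funpow: "isom P \<Longrightarrow> isom (P ^^ n)"
  by (induction n) (auto simp: isom_def)

lemma isom_comp: "isom P \<Longrightarrow> isom Q \<Longrightarrow> isom (P \<circ> Q)"
  by (auto simp: isom_def)

text \<open>Polarisation gives the real part; the imaginary part is a real part with
  \<open>y\<close> replaced by \<open>\<i> y\<close>.\<close>

lemma isom_cinner:
  assumes "isom P"
  shows "cinner (P x) (P y) = cinner x y"
proof -
  have Re: "Re (cinner (P x) (P y)) = Re (cinner x y)" for x y
  proof -
    have *: "Re (cinner x y) = ((norm (x + y))\<^sup>2 - (norm x)\<^sup>2 - (norm y)\<^sup>2) / 2" for x y :: 'a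
      using cinner_commute[of y x] by (simp add: norm_eq_cinner cinner_algebra)
    show ?thesis unfolding * by (simp add: isomD[OF assms] flip: isomD(1)[OF assms])
  qed
  moreover have "Im (cinner (P x) (P y)) = Im (cinner x y)"
    using Re[of x "\<i> *\<^sub>C y"] by (simp add: isomD[OF assms] cinner_algebra)
  ultimately show ?thesis by (simp add: complex_eq_iff)
qed

lemma funpow_commute:
  assumes "\<And>x. P (Q x) = Q (P x)"
  shows "(P ^^ n) (Q x) = Q ((P ^^ n) x)"
  by (induction n) (simp_all add: assms)

lemma funpow_comp_commute:
  assumes "\<And>x. P (Q x) = Q (P x)"
  shows "(P ^^ n) ((Q ^^ n) x) = ((P \<circ> Q) ^^ n) x"
proof (induction n)
  case (Suc n)
  have "(P ^^ Suc n) ((Q ^^ Suc n) x) = P (Q ((P ^^ n) ((Q ^^ n) x)))"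
    by (simp add: funpow_commute[where P=P and Q=Q, OF assms])
  then show ?case by (simp add: Suc)
qed simp

text \<open>Commuting isometries do not amplify errors, so \<open>n\<close> steps cost at most
  \<open>n\<close> one-step differences. A local error of order \<open>1 / n\<^sup>2\<close>
  therefore leaves a global one of order \<open>1 / n\<close>.\<close>

lemma isom_telescope:
  assumes P: "isom P" and Q: "isom Q" and PQ: "\<And>x. P (Q x) = Q (P x)"
  shows "norm ((P ^^ n) x - (Q ^^ n) x) \<le> n * norm (P x - Q x)"
proof (induction n)
  case (Suc n)
  note Pn = isomD[OF isom_funpow[OF P, of n]]
  have "(P ^^ Suc n) x - (Q ^^ Suc n) x = (P ^^ n) (P x - Q x) + Q ((P ^^ n) x - (Q ^^ n) x)"
    using funpow_commute[of P P n x] by (simp add: Pn isomD[OF Q] funpow_commute[of P Q, OF PQ])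
  also have "norm \<dots> \<le> norm (P x - Q x) + norm ((P ^^ n) x - (Q ^^ n) x)"
    using norm_triangle_ineq by (simp add: Pn(3) isomD(3)[OF Q] order_trans[OF norm_triangle_ineq])
  also have "\<dots> \<le> Suc n * norm (P x - Q x)" using Suc by (simp add: algebra_simps)
  finally show ?case .
qed simp

context sa_operator begin

text \<open>Symmetry makes \<open>cinner x (B x)\<close> real, so the cross term disappears. This
  identity yields uniqueness and contractivity of the resolvent and the isometry of the Cayley
  transform.\<close>

lemma norm_add_imag:
  assumes "x \<in> D"
  shows "(norm (x + (\<i> * complex_of_real h) *\<^sub>C B x))\<^sup>2 = (norm x)\<^sup>2 + h\<^sup>2 * (norm (B x))\<^sup>2"
proof -
  have "cinner x (B x) = cnj (cinner x (B x))" using sym[OF assms assms] cinner_commute[of "B x" x] by simp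
  then have "Im (cinner x (B x)) = 0" by (simp add: complex_eq_iff)
  then show ?thesis using sym[OF assms assms] unfolding norm_eq_cinner
    by (simp add: cinner_algebra power2_eq_square algebra_simps)
qed

lemma resolvable_imag:
  assumes "h \<noteq> 0"
  shows "resolvable (\<i> * complex_of_real h)"
proof -
  have "norm x \<le> norm (x + (\<i> * complex_of_real k) *\<^sub>C B x)" if "x \<in> D" for x k
    by (rule power2_le_imp_le) (simp_all add: norm_add_imag[OF that])
  from this this[of _ "-h"] show ?thesis using assms by (auto simp: resolvable_def)
qed

text \<open>\<open>J h = (1 - i h B)\<^sup>-\<^sup>1\<close>, and \<open>C h\<close> below is the Cayley transform
  \<open>(1 + i h B) (1 - i h B)\<^sup>-\<^sup>1\<close>, which approximates \<open>exp (2 i h B)\<close>.\<close>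

definition J :: "real \<Rightarrow> 'h \<Rightarrow> 'h" where
  "J h y = (if h = 0 then y else (THE x. x \<in> D \<and> x - (\<i> * complex_of_real h) *\<^sub>C B x = y))"

lemma J_left:
  assumes "x \<in> D"
  shows "J h (x - (\<i> * complex_of_real h) *\<^sub>C B x) = x"
proof (cases "h = 0")
  case False
  have "y = x" if "y \<in> D" "y - (\<i> * complex_of_real h) *\<^sub>C B y = x - (\<i> * complex_of_real h) *\<^sub>C B x" for y
  proof -
    define w where "w = y - x"
    have "w + (\<i> * complex_of_real (-h)) *\<^sub>C B w
        = (y - (\<i> * complex_of_real h) *\<^sub>C B y) - (x - (\<i> * complex_of_real h) *\<^sub>C B x)"
      using that(1) assms by (simp add: scaleC_diff_right w_def)
    then have 0: "w + (\<i> * complex_of_real (-h)) *\<^sub>C B w = 0" unfolding that(2) by simp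
    have "(norm w)\<^sup>2 + (-h)\<^sup>2 * (norm (B w))\<^sup>2 = 0"
      using norm_add_imag[of w "-h", unfolded 0] that(1) assms by (simp add: w_def)
    then show ?thesis by (simp add: add_nonneg_eq_0_iff w_def)
  qed
  then have "(THE y. y \<in> D \<and> y - (\<i> * complex_of_real h) *\<^sub>C B y = x - (\<i> * complex_of_real h) *\<^sub>C B x) = x"
    using assms by (intro the_equality) auto
  then show ?thesis using False by (simp add: J_def)
qed (simp add: J_def)

lemma J_obtain:
  assumes "h \<noteq> 0"
  obtains x where "x \<in> D" "y = x - (\<i> * complex_of_real h) *\<^sub>C B x" "J h y = x"
proof -
  have "resolvable (\<i> * complex_of_real (-h))" using assms by (intro resolvable_imag) simp
  from resolvable_surj[OF this, of y] obtain x where "x \<in> D" "y = x - (\<i> * complex_of_real h) *\<^sub>C B x" by auto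
  then show ?thesis using that J_left by blast
qed

lemma J_0 [simp]: "J 0 y = y" by (simp add: J_def)

lemma J_add: "J h (x + y) = J h x + J h y"
proof (cases "h = 0")
  case False
  obtain x' where x: "x' \<in> D" "x = x' - (\<i> * complex_of_real h) *\<^sub>C B x'" "J h x = x'" using J_obtain[OF False] by blast
  obtain y' where y: "y' \<in> D" "y = y' - (\<i> * complex_of_real h) *\<^sub>C B y'" "J h y = y'" using J_obtain[OF False] by blast
  have eq: "x + y = (x' + y') - (\<i> * complex_of_real h) *\<^sub>C B (x' + y')"
    using x(1) y(1) by (simp add: x(2) y(2) scaleC_add_right algebra_simps)
  then show ?thesis using J_left[of "x' + y'" h, folded eq] x(1,3) y(1,3) by simp
qed simp

lemma J_scale: "J h (a *\<^sub>C x) = a *\<^sub>C J h x"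
proof (cases "h = 0")
  case False
  obtain x' where x: "x' \<in> D" "x = x' - (\<i> * complex_of_real h) *\<^sub>C B x'" "J h x = x'" using J_obtain[OF False] by blast
  have "a *\<^sub>C x = a *\<^sub>C x' - (\<i> * complex_of_real h) *\<^sub>C B (a *\<^sub>C x')"
    using x(1) by (simp add: x(2) scaleC_diff_right scaleC_scaleC mult.commute)
  then show ?thesis using J_left[of "a *\<^sub>C x'" h] x by simp
qed simp

lemma J_norm: "norm (J h y) \<le> norm y"
proof (cases "h = 0")
  case False
  obtain x where x: "x \<in> D" "y = x - (\<i> * complex_of_real h) *\<^sub>C B x" "J h y = x" using J_obtain[OF False] by blast
  have "(norm x)\<^sup>2 \<le> (norm y)\<^sup>2" using norm_add_imag[OF x(1), of "-h"] by (simp add: x(2))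
  then show ?thesis unfolding x(3) by (rule power2_le_imp_le) simp
qed simp

lemma J_diff: "J h (x - y) = J h x - J h y"
  using J_add[of h "x - y" y] by (simp add: eq_diff_eq)

text \<open>For \<open>h \<noteq> 0\<close> the vector \<open>B y\<close> is a multiple of
  \<open>y - x\<close>. If both lie in \<open>D\<close>, so does \<open>B y\<close>: the resolvent
  maps \<open>D\<close> into the domain of \<open>B\<^sup>2\<close>.\<close>

lemma J_commute:
  assumes "x \<in> D"
  shows "J h x \<in> D" "B (J h x) = J h (B x)" "h \<noteq> 0 \<Longrightarrow> B (J h x) \<in> D"
proof -
  have *: "J h x \<in> D \<and> B (J h x) = J h (B x) \<and> B (J h x) \<in> D" if nz: "h \<noteq> 0"
  proof -
    obtain y where y: "y \<in> D" "x = y - (\<i> * complex_of_real h) *\<^sub>C B y" "J h x = y" using J_obtain[OF nz] by blast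
    have "B y = (1 / (\<i> * complex_of_real h)) *\<^sub>C (y - x)" using nz by (simp add: y(2) scaleC_scaleC)
    then have "B y \<in> D" using assms y(1) by simp
    then have "B x = B y - (\<i> * complex_of_real h) *\<^sub>C B (B y)" unfolding y(2) using y(1) by simp
    then have "J h (B x) = B y" using J_left[OF \<open>B y \<in> D\<close>, of h] by simp
    then show ?thesis unfolding y(3) using y(1) \<open>B y \<in> D\<close> by simp
  qed
  show "J h x \<in> D" "B (J h x) = J h (B x)" using * assms by (cases "h = 0", auto)+
  show "h \<noteq> 0 \<Longrightarrow> B (J h x) \<in> D" using * by blast
qed

lemma J_J: "J h (J k y) = J k (J h y)"
proof (cases "h = 0")
  case False
  obtain x where x: "x \<in> D" "y = x - (\<i> * complex_of_real h) *\<^sub>C B x" "J h y = x" using J_obtain[OF False] by blast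
  have "J k y = J k x - (\<i> * complex_of_real h) *\<^sub>C B (J k x)"
    using J_commute(2)[OF x(1)] by (simp add: x(2) J_diff J_scale)
  then show ?thesis using J_left[of "J k x" h] J_commute(1)[OF x(1)] x(3) by simp
qed simp

lemma J_minus_id: "x \<in> D \<Longrightarrow> J h x - x = (\<i> * complex_of_real h) *\<^sub>C J h (B x)"
  using J_left[of x h] by (simp add: J_diff J_scale algebra_simps)

text \<open>On \<open>D\<close> the difference is of order \<open>h\<close> by
  \<open>J_minus_id\<close>; contractivity carries the limit to the closure.\<close>

lemma J_tendsto: "((\<lambda>h. J h y) \<longlongrightarrow> y) (at 0)"
proof (rule tendstoI)
  fix e :: real assume e: "0 < e"
  have "y \<in> closure D" using dense by simp
  then obtain x where x: "x \<in> D" "dist x y < e / 3" using closure_approachableD[of _ _ "e / 3"] e by (metis divide_pos_pos dist_commute zero_less_numeral)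
  have "((\<lambda>h. \<bar>h\<bar> * norm (B x)) \<longlongrightarrow> \<bar>0\<bar> * norm (B x)) (at 0)" by (intro tendsto_intros)
  then have "eventually (\<lambda>h. \<bar>h\<bar> * norm (B x) < e / 3) (at 0)" using e by (intro order_tendstoD(2)[of _ "0"]) auto
  then show "eventually (\<lambda>h. dist (J h y) y < e) (at 0)"
  proof eventually_elim
    case (elim h)
    have "norm (J h x - x) \<le> \<bar>h\<bar> * norm (B x)"
      by (simp add: J_minus_id[OF x(1)] norm_scaleC norm_mult mult_left_mono J_norm)
    moreover have "norm (J h (y - x)) \<le> norm (y - x)" by (rule J_norm)
    moreover have "J h y - y = J h (y - x) + (J h x - x) + (x - y)" by (simp add: J_diff)
    then have "norm (J h y - y) \<le> norm (J h (y - x)) + norm (J h x - x) + norm (x - y)"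
      using norm_triangle_ineq[of "J h (y - x) + (J h x - x)" "x - y"] norm_triangle_ineq[of "J h (y - x)" "J h x - x"] by simp
    ultimately show ?case using elim x(2) by (simp add: dist_norm norm_minus_commute)
  qed
qed

section \<open>The domain of \<open>B\<^sup>2\<close> and the powers of Cayley transforms\<close>

definition D2 where "D2 = {x \<in> D. B x \<in> D}"

text \<open>For \<open>x\<close> in \<open>D\<close> the vectors \<open>J h x\<close> with
  \<open>h \<noteq> 0\<close> lie in \<open>D2\<close> and tend to \<open>x\<close>.\<close>

lemma D2_dense: "closure D2 = UNIV"
proof -
  have "D \<subseteq> closure D2"
  proof
    fix x assume x: "x \<in> D"
    have lim: "((\<lambda>h. J h x) \<longlongrightarrow> x) (at 0)" by (rule J_tendsto)
    have "J h x \<in> closure D2" if "h \<noteq> 0" for h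
      using J_commute(1)[OF x] J_commute(3)[OF x that] closure_subset[of D2] by (auto simp: D2_def)
    then have "eventually (\<lambda>h. J h x \<in> closure D2) (at 0)"
      by (simp add: eventually_at_filter)
    then show "x \<in> closure D2" by (rule Lim_in_closed_set[OF closed_closure]) (auto simp: lim)
  qed
  then show ?thesis using dense closure_minimal[OF _ closed_closure] by blast
qed

text \<open>\<open>2 J h - 1\<close> is the Cayley transform because
  \<open>1 + i h B = 2 - (1 - i h B)\<close>; in this form it makes sense on all of
  \<open>H\<close>.\<close>

definition C :: "real \<Rightarrow> 'h \<Rightarrow> 'h" where
  "C h y = 2 *\<^sub>R J h y - y"

lemma C_isom: "isom (C h)"
  unfolding isom_def
proof (intro conjI allI)
  show "C h (x + y) = C h x + C h y" for x y by (simp add: C_def J_add scaleR_add_right)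
  show "C h (a *\<^sub>C x) = a *\<^sub>C C h x" for a x by (simp add: C_def J_scale scaleC_diff_right scaleC_scaleR_left)
  show "norm (C h y) = norm y" for y
  proof (cases "h = 0")
    case False
    obtain x where x: "x \<in> D" "y = x - (\<i> * complex_of_real h) *\<^sub>C B x" "J h y = x" using J_obtain[OF False] by blast
    have "C h y = x + (\<i> * complex_of_real h) *\<^sub>C B x" unfolding C_def x(3) unfolding x(2) by (simp add: scaleR_2)
    then have "(norm (C h y))\<^sup>2 = (norm y)\<^sup>2"
      using norm_add_imag[OF x(1), of h] norm_add_imag[OF x(1), of "-h"] by (simp add: x(2))
    then show ?thesis by (simp add: power2_eq_iff_nonneg)
  qed (simp add: C_def scaleR_2)
qed

lemma C_C: "C h (C k x) = C k (C h x)"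
  unfolding C_def by (simp add: J_diff scaleR_scaleC J_scale J_J[of h k] scaleC_diff_right)

lemma C_commute: "x \<in> D \<Longrightarrow> C h x \<in> D \<and> B (C h x) = C h (B x)"
  by (simp add: C_def J_commute)

lemma C_minus_id: "x \<in> D \<Longrightarrow> C h x - x = (2 * \<i> * complex_of_real h) *\<^sub>C J h (B x)"
proof -
  assume "x \<in> D"
  have "C h x - x = 2 *\<^sub>R (J h x - x)" by (simp add: C_def scaleR_2)
  then show ?thesis by (simp add: J_minus_id[OF \<open>x \<in> D\<close>] scaleR_scaleC scaleC_scaleC mult.assoc)
qed

lemma C_minus_id_norm: "x \<in> D \<Longrightarrow> norm (C h x - x) \<le> 2 * \<bar>h\<bar> * norm (B x)"
  by (simp add: C_minus_id norm_scaleC norm_mult mult_left_mono J_norm)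

lemma C_first_order:
  assumes "x \<in> D2"
  shows "norm (C h x - x - (2 * \<i> * complex_of_real h) *\<^sub>C B x) \<le> 2 * h\<^sup>2 * norm (B (B x))"
proof -
  have x: "x \<in> D" "B x \<in> D" using assms by (auto simp: D2_def)
  have "C h x - x - (2 * \<i> * complex_of_real h) *\<^sub>C B x
      = (2 * \<i> * complex_of_real h) *\<^sub>C (\<i> * complex_of_real h) *\<^sub>C J h (B (B x))"
    unfolding C_minus_id[OF x(1)] J_minus_id[OF x(2), symmetric] scaleC_diff_right ..
  also have "norm \<dots> = 2 * h\<^sup>2 * norm (J h (B (B x)))"
    by (simp add: norm_scaleC norm_mult power2_eq_square)
  finally show ?thesis by (simp add: mult_left_mono J_norm)
qed

text \<open>\<open>C h C k\<close> and \<open>C (h + k)\<close> agree to first order, so on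
  \<open>D2\<close> they differ by second-order remainders. This is the local error behind both
  convergence and the group law.\<close>

lemma C_add_error:
  assumes "x \<in> D2"
  shows "norm (C h (C k x) - C (h + k) x) \<le> 8 * (h\<^sup>2 + k\<^sup>2) * norm (B (B x))"
proof -
  have x: "x \<in> D" "B x \<in> D" using assms by (auto simp: D2_def)
  note Ch = isomD[OF C_isom, of h]
  let ?e = "\<lambda>h. C h x - x - (2 * \<i> * complex_of_real h) *\<^sub>C B x"
  have norm4: "norm (a + b + c - d) \<le> norm a + norm b + norm c + norm d" for a b c d :: 'h
    using norm_triangle_ineq4[of "a + b + c" d] norm_triangle_ineq[of "a + b" c] norm_triangle_ineq[of a b] by simp
  \<comment> \<open>The first-order terms cancel up to \<open>C h (B x) - B x\<close>, which is of
    order \<open>h\<close> and carries a factor \<open>k\<close>.\<close>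
  have eq: "C h (C k x) - C (h + k) x = C h (?e k) + ?e h + (2 * \<i> * complex_of_real k) *\<^sub>C (C h (B x) - B x) - ?e (h + k)"
  proof -
    have 1: "C h (?e k) = C h (C k x) - C h x - (2 * \<i> * complex_of_real k) *\<^sub>C C h (B x)"
      by (simp only: Ch)
    have 2: "2 * \<i> * complex_of_real (h + k) = 2 * \<i> * complex_of_real h + 2 * \<i> * complex_of_real k"
      by (simp add: distrib_left)
    show ?thesis unfolding 1 2 scaleC_diff_right scaleC_add_left by simp
  qed
  have "norm (C h (C k x) - C (h + k) x) \<le> norm (C h (?e k)) + norm (?e h) + norm ((2 * \<i> * complex_of_real k) *\<^sub>C (C h (B x) - B x)) + norm (?e (h + k))"
    unfolding eq by (rule norm4)
  also have "\<dots> \<le> 2 * k\<^sup>2 * norm (B (B x)) + 2 * h\<^sup>2 * norm (B (B x)) + 2 * \<bar>k\<bar> * (2 * \<bar>h\<bar> * norm (B (B x))) + 2 * (h + k)\<^sup>2 * norm (B (B x))"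
  proof -
    have "norm ((2 * \<i> * complex_of_real k) *\<^sub>C (C h (B x) - B x)) \<le> 2 * \<bar>k\<bar> * (2 * \<bar>h\<bar> * norm (B (B x)))"
      using mult_left_mono[OF C_minus_id_norm[OF x(2), of h], of "2 * \<bar>k\<bar>"] by (simp add: norm_scaleC norm_mult)
    then show ?thesis
      using C_first_order[OF assms, of h] C_first_order[OF assms, of k] C_first_order[OF assms, of "h + k"]
      unfolding Ch(3) by linarith
  qed
  also have "\<dots> = (2 * k\<^sup>2 + 2 * h\<^sup>2 + 4 * \<bar>k * h\<bar> + 2 * (h + k)\<^sup>2) * norm (B (B x))" by (simp add: algebra_simps abs_mult)
  also have "\<dots> \<le> 8 * (h\<^sup>2 + k\<^sup>2) * norm (B (B x))"
  proof (intro mult_right_mono)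
    have "2 * \<bar>k * h\<bar> \<le> h\<^sup>2 + k\<^sup>2" using sum_squares_bound[of "\<bar>h\<bar>" "\<bar>k\<bar>"] by (simp add: abs_mult mult_ac)
    moreover have "(h + k)\<^sup>2 \<le> 2 * h\<^sup>2 + 2 * k\<^sup>2" using sum_squares_bound[of h k] by (simp add: power2_sum)
    moreover have "2 * p \<le> a + b \<Longrightarrow> q \<le> 2 * a + 2 * b \<Longrightarrow> 2 * b + 2 * a + 4 * p + 2 * q \<le> 8 * (a + b)" for p q a b :: real
      by simp
    ultimately show "2 * k\<^sup>2 + 2 * h\<^sup>2 + 4 * \<bar>k * h\<bar> + 2 * (h + k)\<^sup>2 \<le> 8 * (h\<^sup>2 + k\<^sup>2)" by blast
  qed simp
  finally show ?thesis .
qed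

text \<open>\<open>C (t / 2 ^ Suc n)\<close> approximates \<open>exp (i t B / 2 ^ n)\<close>, whence
  the extra factor two. Dyadic exponents make the next approximant a \<open>2 ^ n\<close>-th power
  as well, of two Cayley transforms with half the step.\<close>

definition G :: "nat \<Rightarrow> real \<Rightarrow> 'h \<Rightarrow> 'h" where
  "G n t = C (t / 2 ^ Suc n) ^^ (2 ^ n)"

lemma G_isom: "isom (G n t)" unfolding G_def by (intro isom_funpow C_isom)

text \<open>There are \<open>2 ^ n\<close> steps, each with an error of at most
  \<open>16 (t / 2 ^ (n + 2))\<^sup>2\<close> times \<open>norm (B (B x))\<close>.\<close>

lemma G_step:
  assumes "x \<in> D2"
  shows "norm (G n t x - G (Suc n) t x) \<le> t\<^sup>2 / 2 ^ n * norm (B (B x))"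
proof -
  let ?h = "t / 2 ^ Suc (Suc n)"
  have eq: "G (Suc n) t = (C ?h \<circ> C ?h) ^^ (2 ^ n)"
    unfolding G_def using funpow_mult[where f="C ?h" and m=2 and n="2 ^ n"] by (simp add: eval_nat_numeral)
  have comm: "C a ((C ?h \<circ> C ?h) x) = (C ?h \<circ> C ?h) (C a x)" for a x
    by (simp only: comp_apply C_C[of a ?h])
  have "norm (G n t x - G (Suc n) t x) \<le> (2 ^ n) * norm (C (t / 2 ^ Suc n) x - (C ?h \<circ> C ?h) x)"
    unfolding eq unfolding G_def using isom_telescope[where P = "C (t / 2 ^ Suc n)" and Q = "C ?h \<circ> C ?h" and n = "2^n" and x = x,
        OF C_isom isom_comp[OF C_isom C_isom] comm]
    by simp
  also have "\<dots> \<le> 2 ^ n * (8 * (?h\<^sup>2 + ?h\<^sup>2) * norm (B (B x)))"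
    using C_add_error[OF assms, of ?h ?h] by (intro mult_left_mono) (auto simp: norm_minus_commute)
  also have "\<dots> = t\<^sup>2 / 2 ^ n * norm (B (B x))"
    by (simp add: field_simps power2_eq_square flip: power_mult_distrib)
  finally show ?thesis .
qed

text \<open>The geometric series of \<open>G_step\<close>, with its exact partial sums so that the
  induction closes.\<close>

lemma G_tail:
  assumes "x \<in> D2"
  shows "norm (G n t x - G (n + k) t x) \<le> t\<^sup>2 * norm (B (B x)) * (2 / 2 ^ n - 2 / 2 ^ (n + k))"
proof (induction k)
  case (Suc k)
  have "norm (G n t x - G (n + Suc k) t x) \<le> norm (G n t x - G (n + k) t x) + norm (G (n + k) t x - G (n + Suc k) t x)"
    using norm_triangle_ineq[of "G n t x - G (n + k) t x" "G (n + k) t x - G (n + Suc k) t x"] by simp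
  also have "\<dots> \<le> t\<^sup>2 * norm (B (B x)) * (2 / 2 ^ n - 2 / 2 ^ (n + k)) + t\<^sup>2 / 2 ^ (n + k) * norm (B (B x))"
    using Suc G_step[OF assms, of "n + k" t] by (intro add_mono) simp_all
  also have "\<dots> = t\<^sup>2 * norm (B (B x)) * (2 / 2 ^ n - 2 / 2 ^ (n + Suc k))" by (simp add: field_simps)
  finally show ?case .
qed simp

text \<open>Isometries are equicontinuous, so the Cauchy property passes from a dense set to the
  whole space.\<close>

lemma isom_Cauchy_dense:
  fixes P :: "nat \<Rightarrow> 'h \<Rightarrow> 'h"
  assumes "\<And>n. isom (P n)" "\<And>x. x \<in> S \<Longrightarrow> Cauchy (\<lambda>n. P n x)" "closure S = UNIV"
  shows "Cauchy (\<lambda>n. P n x)"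
proof (rule metric_CauchyI)
  fix e :: real assume e: "0 < e"
  have "x \<in> closure S" using assms(3) by simp
  then obtain y where y: "y \<in> S" "dist y x < e / 3" using closure_approachableD[of _ _ "e / 3"] e by (metis divide_pos_pos dist_commute zero_less_numeral)
  obtain N where N: "\<And>m n. m \<ge> N \<Longrightarrow> n \<ge> N \<Longrightarrow> dist (P m y) (P n y) < e / 3"
    using metric_CauchyD[OF assms(2)[OF y(1)], of "e / 3"] e by auto
  have "dist (P n y) (P n x) < e / 3" for n
    using y(2) by (simp add: dist_norm isomD(3)[OF assms(1)] flip: isomD(4)[OF assms(1)])
  then show "\<exists>M. \<forall>m\<ge>M. \<forall>n\<ge>M. dist (P m x) (P n x) < e"
    using N by (intro exI[of _ N] allI impI) (metis dist_commute dist_triangle_third)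
qed

lemma G_convergent: "convergent (\<lambda>n. G n t x)"
proof -
  have "Cauchy (\<lambda>n. G n t x)"
  proof (rule isom_Cauchy_dense[OF G_isom _ D2_dense])
    fix x assume x: "x \<in> D2"
    have lim: "(\<lambda>n. t\<^sup>2 * norm (B (B x)) * (2 / 2 ^ n)) \<longlonglongrightarrow> t\<^sup>2 * norm (B (B x)) * 0"
      using LIMSEQ_divide_realpow_zero[of 2 2] by (intro tendsto_intros) auto
    show "Cauchy (\<lambda>n. G n t x)"
    proof (rule CauchyI')
      fix e :: real assume "0 < e"
      then have "eventually (\<lambda>n. t\<^sup>2 * norm (B (B x)) * (2 / 2 ^ n) < e) sequentially"
        by (intro order_tendstoD(2)[OF lim]) simp
      then obtain N where N: "\<And>n. n \<ge> N \<Longrightarrow> t\<^sup>2 * norm (B (B x)) * (2 / 2 ^ n) < e" by (auto simp: eventually_sequentially)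
      show "\<exists>M. \<forall>m\<ge>M. \<forall>n>m. dist (G m t x) (G n t x) < e"
      proof (intro exI allI impI)
        fix m n :: nat assume "N \<le> m" "m < n"
        then obtain k where k: "n = m + k" by (metis less_imp_add_positive)
        have "norm (G m t x - G n t x) \<le> t\<^sup>2 * norm (B (B x)) * (2 / 2 ^ m - 2 / 2 ^ (m + k))"
          unfolding k by (rule G_tail[OF x])
        also have "\<dots> \<le> t\<^sup>2 * norm (B (B x)) * (2 / 2 ^ m)" by (intro mult_left_mono) auto
        also have "\<dots> < e" by (rule N) fact
        finally show "dist (G m t x) (G n t x) < e" by (simp add: dist_norm)
      qed
    qed
  qed
  then show ?thesis by (rule Cauchy_convergent)
qed

end

section \<open>The strong limit as a one-parameter unitary group\<close>

context sa_operator begin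

definition U :: "real \<Rightarrow> 'h \<Rightarrow> 'h" where
  "U t x = lim (\<lambda>n. G n t x)"

lemma G_U: "(\<lambda>n. G n t x) \<longlonglongrightarrow> U t x"
  using G_convergent unfolding U_def by (rule convergent_LIMSEQ_iff[THEN iffD1])

lemma U_isom: "isom (U t)"
  unfolding isom_def
proof (intro conjI allI)
  show "U t (x + y) = U t x + U t y" for x y
    using LIMSEQ_unique[OF G_U[of t "x + y"]] tendsto_add[OF G_U[of t x] G_U[of t y]]
    by (simp add: isomD[OF G_isom])
  show "U t (a *\<^sub>C x) = a *\<^sub>C U t x" for a x
    using LIMSEQ_unique[OF G_U[of t "a *\<^sub>C x"]] tendsto_scaleC[OF tendsto_const G_U[of t x], of a]
    by (simp add: isomD[OF G_isom])
  show "norm (U t x) = norm x" for x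
    using LIMSEQ_unique[OF tendsto_norm[OF G_U[of t x]]] tendsto_const[of "norm x"]
    by (simp add: isomD[OF G_isom])
qed

lemmas U_simps = isomD[OF U_isom]

lemma G_commute: "x \<in> D \<Longrightarrow> G n t x \<in> D \<and> B (G n t x) = G n t (B x)"
proof -
  assume x: "x \<in> D"
  have "(C h ^^ m) x \<in> D \<and> B ((C h ^^ m) x) = (C h ^^ m) (B x)" for h m
    by (induction m) (use x C_commute in auto)
  then show ?thesis by (simp add: G_def)
qed

lemma U_commute: "x \<in> D \<Longrightarrow> U t x \<in> D" "x \<in> D \<Longrightarrow> B (U t x) = U t (B x)"
proof -
  assume x: "x \<in> D"
  have "U t x \<in> D \<and> B (U t x) = U t (B x)"
    by (rule closed_graph[of "\<lambda>n. G n t x"]) (use G_commute[OF x] G_U in auto)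
  then show "U t x \<in> D" "B (U t x) = U t (B x)" by auto
qed

lemma eq_on_dense:
  assumes "isom P" "isom Q" "closure S = UNIV" "\<And>x. x \<in> S \<Longrightarrow> P x = Q x"
  shows "P x = (Q x :: 'h)"
proof -
  have cont: "continuous_on UNIV R" if "isom R" for R :: "'h \<Rightarrow> 'h"
  proof (rule continuous_onI)
    fix x :: 'h and e :: real assume "0 < e"
    then show "\<exists>d>0. \<forall>x'\<in>UNIV. dist x' x < d \<longrightarrow> dist (R x') (R x) \<le> e"
      by (intro exI[of _ e]) (auto simp: dist_norm isomD(3)[OF that] simp flip: isomD(4)[OF that])
  qed
  have "closed {x. P x = Q x}" by (intro closed_Collect_eq cont assms)
  then have "closure S \<subseteq> {x. P x = Q x}" using assms(4) by (intro closure_minimal) auto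
  then show ?thesis using assms(3) by auto
qed

text \<open>Since the factors commute, the product of the powers is a power of the product.
  \<open>C_add_error\<close> over \<open>2 ^ n\<close> steps then leaves a total of order
  \<open>1 / 2 ^ n\<close>.\<close>

lemma G_add_error:
  assumes "x \<in> D2"
  shows "norm (G n s (G n t x) - G n (s + t) x) \<le> 2 * (s\<^sup>2 + t\<^sup>2) * norm (B (B x)) / 2 ^ n"
proof -
  let ?a = "s / 2 ^ Suc n" and ?b = "t / 2 ^ Suc n"
  have comm: "(C ?a \<circ> C ?b) (C (?a + ?b) x) = C (?a + ?b) ((C ?a \<circ> C ?b) x)" for x
    by (simp only: comp_apply C_C[of "?a + ?b"])
  have "G n s (G n t x) = ((C ?a \<circ> C ?b) ^^ 2 ^ n) x"
    unfolding G_def by (rule funpow_comp_commute[where P = "C ?a" and Q = "C ?b", OF C_C])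
  moreover have "G n (s + t) x = (C (?a + ?b) ^^ 2 ^ n) x"
    by (simp add: G_def add_divide_distrib)
  ultimately have "norm (G n s (G n t x) - G n (s + t) x) \<le> 2 ^ n * norm (C ?a (C ?b x) - C (?a + ?b) x)"
    using isom_telescope[where P = "C ?a \<circ> C ?b" and Q = "C (?a + ?b)" and n = "2^n" and x = x,
        OF isom_comp[OF C_isom C_isom] C_isom comm] by simp
  also have "\<dots> \<le> 2 ^ n * (8 * (?a\<^sup>2 + ?b\<^sup>2) * norm (B (B x)))"
    by (intro mult_left_mono C_add_error assms) simp
  also have "\<dots> = 2 * (s\<^sup>2 + t\<^sup>2) * norm (B (B x)) / 2 ^ n"
    by (simp add: field_simps power2_eq_square)
  finally show ?thesis .
qed

lemma U_add: "U s (U t x) = U (s + t) x"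
proof -
  have *: "(U s \<circ> U t) x = U (s + t) x"
  proof (rule eq_on_dense[OF isom_comp[OF U_isom U_isom] U_isom D2_dense])
    fix x assume x: "x \<in> D2"
    \<comment> \<open>The inner limit may be taken first, since \<open>G n s\<close> preserves the
      norm of \<open>G n t x - U t x\<close>.\<close>
    have "(\<lambda>n. G n s (G n t x - U t x) + G n s (U t x)) \<longlonglongrightarrow> 0 + U s (U t x)"
    proof (intro tendsto_add G_U)
      have "(\<lambda>n. norm (G n t x - U t x)) \<longlonglongrightarrow> 0" using tendsto_norm_zero[OF LIM_zero[OF G_U[of t x]]] .
      then show "(\<lambda>n. G n s (G n t x - U t x)) \<longlonglongrightarrow> 0"
        by - (rule tendsto_norm_zero_cancel, simp add: isomD(3)[OF G_isom])
    qed
    then have 1: "(\<lambda>n. G n s (G n t x)) \<longlonglongrightarrow> U s (U t x)" by (simp add: isomD[OF G_isom])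
    have 2: "(\<lambda>n. G n s (G n t x) - G n (s + t) x) \<longlonglongrightarrow> 0"
    proof (rule Lim_null_comparison[OF always_eventually])
      show "\<forall>n. norm (G n s (G n t x) - G n (s + t) x) \<le> 2 * (s\<^sup>2 + t\<^sup>2) * norm (B (B x)) / 2 ^ n"
        using G_add_error[OF x] by blast
      show "(\<lambda>n. 2 * (s\<^sup>2 + t\<^sup>2) * norm (B (B x)) / 2 ^ n) \<longlonglongrightarrow> 0" by (rule LIMSEQ_divide_realpow_zero) simp
    qed
    show "(U s \<circ> U t) x = U (s + t) x"
      using LIMSEQ_unique[OF tendsto_diff[OF 1 2] ] G_U[of "s + t" x] by simp
  qed
  then show ?thesis by simp
qed

lemma U_0 [simp]: "U 0 x = x"
proof -
  have "C 0 = (\<lambda>x. x)" by (simp add: fun_eq_iff C_def scaleR_2)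
  moreover have "((\<lambda>x::'h. x) ^^ m) x = x" for m by (induction m) auto
  ultimately have "G n 0 x = x" for n by (simp add: G_def)
  then show ?thesis using LIMSEQ_unique[OF G_U[of 0 x]] tendsto_const[of x] by simp
qed

lemma U_cancel [simp]: "U t (U (- t) x) = x" "U (- t) (U t x) = x"
  by (simp_all add: U_add)

lemma cinner_U: "cinner (U t x) y = cinner x (U (- t) y)"
  using isom_cinner[OF U_isom, of t x "U (- t) y"] by simp

text \<open>The constant 3 covers \<open>2 t\<^sup>2\<close> from the whole dyadic tail starting at
  \<open>n = 0\<close> and \<open>t\<^sup>2 / 2\<close> from the single Cayley step with
  \<open>h = t / 2\<close>.\<close>

lemma U_second_order:
  assumes "x \<in> D2"
  shows "norm (U t x - x - (\<i> * complex_of_real t) *\<^sub>C B x) \<le> 3 * t\<^sup>2 * norm (B (B x))"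
proof -
  have G0: "G 0 t x = C (t / 2) x" by (simp add: G_def)
  have "norm (G 0 t x - G n t x) \<le> 2 * t\<^sup>2 * norm (B (B x))" for n
  proof -
    have "norm (G 0 t x - G (0 + n) t x) \<le> t\<^sup>2 * norm (B (B x)) * (2 / 2 ^ 0 - 2 / 2 ^ (0 + n))" by (rule G_tail[OF assms])
    also have "\<dots> \<le> t\<^sup>2 * norm (B (B x)) * 2" by (intro mult_left_mono) auto
    finally show ?thesis by (simp add: mult_ac)
  qed
  then have "norm (G 0 t x - U t x) \<le> 2 * t\<^sup>2 * norm (B (B x))"
    by (intro Lim_bounded[OF tendsto_norm[OF tendsto_diff[OF tendsto_const G_U]]]) auto
  moreover have "norm (C (t / 2) x - x - (\<i> * complex_of_real t) *\<^sub>C B x) \<le> t\<^sup>2 / 2 * norm (B (B x))"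
    using C_first_order[OF assms, of "t / 2"] by (simp add: power2_eq_square)
  moreover have "U t x - x - (\<i> * complex_of_real t) *\<^sub>C B x
      = (C (t / 2) x - x - (\<i> * complex_of_real t) *\<^sub>C B x) - (G 0 t x - U t x)" by (simp add: G0)
  then have "norm (U t x - x - (\<i> * complex_of_real t) *\<^sub>C B x)
      \<le> norm (C (t / 2) x - x - (\<i> * complex_of_real t) *\<^sub>C B x) + norm (G 0 t x - U t x)"
    by (metis norm_triangle_ineq4)
  moreover have "0 \<le> t\<^sup>2 / 2 * norm (B (B x))" by simp
  ultimately show ?thesis by argo
qed

text \<open>Telescoping against the identity uses first-order information, so the bound holds on all
  of \<open>D\<close> and not just on \<open>D2\<close>.\<close>

lemma U_minus_id_norm:
  assumes "x \<in> D"
  shows "norm (U t x - x) \<le> \<bar>t\<bar> * norm (B x)"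
proof -
  have "norm (G n t x - x) \<le> \<bar>t\<bar> * norm (B x)" for n
  proof -
    let ?h = "t / 2 ^ Suc n"
    have id: "isom (\<lambda>x::'h. x)" by (simp add: isom_def)
    have fix_id: "((\<lambda>x::'h. x) ^^ m) x = x" for m by (induction m) auto
    have "norm (G n t x - x) \<le> 2 ^ n * norm (C ?h x - x)"
      using isom_telescope[where P = "C ?h" and Q = "\<lambda>x. x" and n = "2^n" and x = x, OF C_isom id] by (simp add: G_def fix_id)
    also have "\<dots> \<le> 2 ^ n * (2 * \<bar>?h\<bar> * norm (B x))" by (intro mult_left_mono C_minus_id_norm assms) simp
    finally show ?thesis by (simp add: abs_mult)
  qed
  then show ?thesis
    by (intro Lim_bounded[OF tendsto_norm[OF tendsto_diff[OF G_U tendsto_const]]]) auto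
qed

lemma U_tendsto_0: "((\<lambda>t. U t x) \<longlongrightarrow> x) (at 0)"
proof (rule tendstoI)
  fix e :: real assume e: "0 < e"
  have "x \<in> closure D" using dense by simp
  then obtain y where y: "y \<in> D" "dist x y < e / 3" using closure_approachableD[of _ _ "e / 3"] e by (metis divide_pos_pos zero_less_numeral)
  have "((\<lambda>h. \<bar>h\<bar> * norm (B y)) \<longlongrightarrow> \<bar>0\<bar> * norm (B y)) (at 0)" by (intro tendsto_intros)
  then have "eventually (\<lambda>h. \<bar>h\<bar> * norm (B y) < e / 3) (at 0)" using e by (intro order_tendstoD(2)[of _ "0"]) auto
  then show "eventually (\<lambda>h. dist (U h x) x < e) (at 0)"
  proof eventually_elim
    case (elim h)
    have "norm (U h y - y) \<le> \<bar>h\<bar> * norm (B y)" by (rule U_minus_id_norm[OF y(1)])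
    moreover have "U h x - x = U h (x - y) + (U h y - y) + (y - x)" by (simp add: U_simps)
    then have "norm (U h x - x) \<le> norm (U h (x - y)) + norm (U h y - y) + norm (y - x)"
      using norm_triangle_ineq[of "U h (x - y) + (U h y - y)" "y - x"] norm_triangle_ineq[of "U h (x - y)" "U h y - y"] by simp
    ultimately show ?case using elim y(2) by (simp add: dist_norm norm_minus_commute U_simps(3))
  qed
qed

lemma U_continuous: "continuous_on UNIV (\<lambda>t. U t x)"
proof -
  have "isCont (\<lambda>t. U t x) t" for t
  proof -
    have "((\<lambda>h. U h (U t x)) \<longlongrightarrow> U t x) (at 0)" by (rule U_tendsto_0)
    then have "((\<lambda>h. U (t + h) x) \<longlongrightarrow> U t x) (at 0)" by (simp add: U_add add.commute)
    then show ?thesis by (simp add: isCont_iff)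
  qed
  then show ?thesis by (simp add: continuous_on_eq_continuous_at)
qed

text \<open>Isometry makes the convergence in the vector uniform in time, which upgrades strong
  continuity to joint continuity.\<close>

lemma U_tendsto:
  assumes "(f \<longlongrightarrow> t) F" "(g \<longlongrightarrow> x) F"
  shows "((\<lambda>s. U (f s) (g s)) \<longlongrightarrow> U t x) F"
proof -
  have "((\<lambda>s. U (f s) x) \<longlongrightarrow> U t x) F"
    using U_continuous[of x] by (intro isCont_tendsto_compose[OF _ assms(1)]) (simp add: continuous_on_eq_continuous_at)
  moreover have "((\<lambda>s. U (f s) (g s - x)) \<longlongrightarrow> 0) F"
  proof (rule tendsto_norm_zero_cancel)
    show "((\<lambda>s. norm (U (f s) (g s - x))) \<longlongrightarrow> 0) F"
      using tendsto_norm_zero[OF LIM_zero[OF assms(2)]] by (simp add: U_simps(3))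
  qed
  ultimately have "((\<lambda>s. U (f s) x + U (f s) (g s - x)) \<longlongrightarrow> U t x + 0) F" by (rule tendsto_add)
  then show ?thesis by (simp add: U_simps)
qed

lemma continuous_on_U [continuous_intros]:
  "continuous_on S f \<Longrightarrow> continuous_on S g \<Longrightarrow> continuous_on S (\<lambda>t. U (f t) (g t))"
  unfolding continuous_on_def by (auto intro: U_tendsto)

text \<open>The quadratic estimate lives on \<open>D2\<close>, but the derivative exists on
  \<open>D\<close>: \<open>x\<close> is split into \<open>y = J k x\<close> in \<open>D2\<close> and
  a rest for which \<open>B (x - y)\<close> is small, so that the Lipschitz bound controls
  it.\<close>

lemma U_deriv_0:
  assumes x: "x \<in> D"
  shows "((\<lambda>t. U t x) has_vector_derivative \<i> *\<^sub>C B x) (at 0)"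
  unfolding has_vector_derivative_def has_derivative_at2
proof (intro conjI bounded_linear_scaleR_left tendstoI)
  fix e :: real assume e: "0 < e"
  have "((\<lambda>h. J h (B x)) \<longlongrightarrow> B x) (at 0)" by (rule J_tendsto)
  then have "eventually (\<lambda>h. dist (J h (B x)) (B x) < e / 4 \<and> h \<noteq> 0) (at 0)"
    using e by (intro eventually_conj tendstoD eventually_at_topological[THEN iffD2]) auto
  then obtain k where k: "dist (J k (B x)) (B x) < e / 4" "k \<noteq> 0"
    using eventually_happens[of _ "at (0::real)"] by auto
  define y where "y = J k x"
  have y: "y \<in> D" "y \<in> D2" "norm (B (x - y)) < e / 4"
    using J_commute[OF x] k x by (auto simp: y_def D2_def dist_norm norm_minus_commute)
  have "((\<lambda>h. 3 * \<bar>h\<bar> * norm (B (B y))) \<longlongrightarrow> 3 * \<bar>0\<bar> * norm (B (B y))) (at 0)" by (intro tendsto_intros)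
  then have "eventually (\<lambda>h. 3 * \<bar>h\<bar> * norm (B (B y)) < e / 2) (at 0)" using e by (intro order_tendstoD(2)[of _ "0"]) auto
  moreover have "eventually (\<lambda>h::real. h \<noteq> 0) (at 0)" by (simp add: eventually_at_filter)
  ultimately show "eventually (\<lambda>t. dist ((1 / norm (t - 0)) *\<^sub>R (U t x - (U 0 x + (t - 0) *\<^sub>R \<i> *\<^sub>C B x))) 0 < e) (at 0)"
  proof eventually_elim
    case (elim h)
    let ?E = "\<lambda>z. U h z - z - (\<i> * complex_of_real h) *\<^sub>C B z"
    have *: "U h x - (U 0 x + (h - 0) *\<^sub>R \<i> *\<^sub>C B x) = ?E x" by (simp add: scaleR_scaleC scaleC_scaleC mult.commute)
    have E: "?E x = (U h (x - y) - (x - y)) - (\<i> * complex_of_real h) *\<^sub>C B (x - y) + ?E y"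
      using x y(1) by (simp add: U_simps scaleC_diff_right)
    have "norm (?E x) \<le> norm (U h (x - y) - (x - y)) + norm ((\<i> * complex_of_real h) *\<^sub>C B (x - y)) + norm (?E y)"
      unfolding E using norm_triangle_ineq[of "(U h (x - y) - (x - y)) - (\<i> * complex_of_real h) *\<^sub>C B (x - y)" "?E y"]
        norm_triangle_ineq4[of "U h (x - y) - (x - y)" "(\<i> * complex_of_real h) *\<^sub>C B (x - y)"] by linarith
    also have "\<dots> \<le> \<bar>h\<bar> * norm (B (x - y)) + \<bar>h\<bar> * norm (B (x - y)) + 3 * h\<^sup>2 * norm (B (B y))"
    proof -
      have "norm ((\<i> * complex_of_real h) *\<^sub>C B (x - y)) = \<bar>h\<bar> * norm (B (x - y))" by (simp add: norm_scaleC norm_mult)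
      then show ?thesis using U_minus_id_norm[of "x - y" h] x y(1) U_second_order[OF y(2), of h] by simp
    qed
    also have "\<dots> = \<bar>h\<bar> * (2 * norm (B (x - y)) + 3 * \<bar>h\<bar> * norm (B (B y)))"
      by (simp add: power2_eq_square distrib_left)
    also have "\<dots> < \<bar>h\<bar> * e" using elim y(3) by (intro mult_strict_left_mono) auto
    finally show ?case using elim unfolding * by (simp add: divide_less_eq mult.commute)
  qed
qed

lemma U_deriv:
  assumes x: "x \<in> D"
  shows "((\<lambda>t. U t x) has_vector_derivative \<i> *\<^sub>C U t (B x)) (at t within S)"
proof -
  have "((\<lambda>h. U h (U t x)) has_vector_derivative \<i> *\<^sub>C B (U t x)) (at (t - t))"
    using U_deriv_0[OF U_commute(1)[OF x]] by simp
  moreover have "((\<lambda>s. s - t) has_vector_derivative 1) (at t)"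
    by (auto intro!: derivative_eq_intros)
  ultimately have "((\<lambda>h. U h (U t x)) \<circ> (\<lambda>s. s - t) has_vector_derivative 1 *\<^sub>R \<i> *\<^sub>C B (U t x)) (at t)"
    by (intro vector_diff_chain_at) auto
  then have "((\<lambda>s. U s x) has_vector_derivative \<i> *\<^sub>C U t (B x)) (at t)"
    by (simp add: o_def U_add U_commute(2)[OF x])
  then show ?thesis by (rule has_vector_derivative_at_within)
qed

text \<open>Time averages of the group are smoothing: they lie in \<open>D\<close> for every
  \<open>x\<close>. Tested against \<open>B g\<close>, the integrand is the derivative of a multiple
  of \<open>cinner (U (- k * r) g) x\<close>, and \<open>maximal\<close> reads off the
  result.\<close>

lemma integral_U:
  assumes k: "k \<noteq> 0" and ab: "a \<le> b"
  shows "integral {a..b} (\<lambda>r. U (k * r) x) \<in> D"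
    "B (integral {a..b} (\<lambda>r. U (k * r) x)) = (- \<i> / of_real k) *\<^sub>C (U (k * b) x - U (k * a) x)"
proof -
  let ?y = "integral {a..b} (\<lambda>r. U (k * r) x)"
  have int: "(\<lambda>r. U (k * r) x) integrable_on {a..b}"
    by (intro integrable_continuous_interval continuous_intros)
  have "?y \<in> D \<and> B ?y = (- \<i> / of_real k) *\<^sub>C (U (k * b) x - U (k * a) x)"
  proof (rule maximal)
    fix g assume g: "g \<in> D"
    have "((\<lambda>r. cinner (B g) (U (k * r) x)) has_integral cinner (B g) ?y) {a..b}"
      using has_integral_linear[OF integrable_integral[OF int] bounded_bilinear.bounded_linear_right[OF bounded_bilinear_cinner], of "B g"]
      by (simp add: o_def)
    moreover have "((\<lambda>r. cinner (B g) (U (k * r) x)) has_integral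
        (\<i> / of_real k) * cinner (U (- k * b) g) x - (\<i> / of_real k) * cinner (U (- k * a) g) x) {a..b}"
    proof (rule fundamental_theorem_of_calculus[OF ab])
      fix r
      have "((\<lambda>r. - k * r) has_vector_derivative - k) (at r)" by (auto intro!: derivative_eq_intros)
      from vector_diff_chain_at[OF this U_deriv[OF g]]
      have "((\<lambda>r. U (- k * r) g) has_vector_derivative (- k) *\<^sub>R \<i> *\<^sub>C U (- k * r) (B g)) (at r within {a..b})"
        by (simp add: o_def has_vector_derivative_at_within)
      from bounded_linear.has_vector_derivative[OF bounded_linear_cinner_left this, of x]
      have "((\<lambda>r. (\<i> / of_real k) * cinner (U (- k * r) g) x) has_vector_derivative
          (\<i> / of_real k) * cinner ((- k) *\<^sub>R \<i> *\<^sub>C U (- k * r) (B g)) x) (at r within {a..b})"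
        by (rule has_vector_derivative_mult_right)
      moreover have "(\<i> / of_real k) * cinner ((- k) *\<^sub>R \<i> *\<^sub>C U (- k * r) (B g)) x = cinner (B g) (U (k * r) x)"
        using k by (simp add: cinner_algebra cinner_U)
      ultimately show "((\<lambda>r. (\<i> / of_real k) * cinner (U (- k * r) g) x) has_vector_derivative cinner (B g) (U (k * r) x)) (at r within {a..b})"
        by simp
    qed
    ultimately have "cinner (B g) ?y = (\<i> / of_real k) * cinner (U (- k * b) g) x - (\<i> / of_real k) * cinner (U (- k * a) g) x"
      by (rule has_integral_unique)
    then show "cinner (B g) ?y = cinner g ((- \<i> / of_real k) *\<^sub>C (U (k * b) x - U (k * a) x))"
      by (simp add: cinner_algebra cinner_U right_diff_distrib)
  qed
  then show "?y \<in> D" "B ?y = (- \<i> / of_real k) *\<^sub>C (U (k * b) x - U (k * a) x)" by auto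
qed

end

section \<open>Square roots of non-negative self-adjoint operators\<close>

definition bop :: "('h::complex_hilbert \<Rightarrow> 'h) \<Rightarrow> bool" where
  "bop Z \<longleftrightarrow> (\<forall>x y. Z (x + y) = Z x + Z y) \<and> (\<forall>a x. Z (a *\<^sub>C x) = a *\<^sub>C Z x) \<and>
     (\<exists>K. \<forall>x. norm (Z x) \<le> K * norm x)"

lemma bopD:
  assumes "bop Z"
  shows "Z (x + y) = Z x + Z y" "Z (a *\<^sub>C x) = a *\<^sub>C Z x" "Z (r *\<^sub>R x) = r *\<^sub>R Z x"
    "Z 0 = 0" "Z (x - y) = Z x - Z y" "Z (- x) = - Z x"
proof -
  show a: "Z (x + y) = Z x + Z y" "Z (a *\<^sub>C x) = a *\<^sub>C Z x" for x y a
    using assms by (auto simp: bop_def)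
  show "Z (r *\<^sub>R x) = r *\<^sub>R Z x" by (simp add: scaleR_scaleC a)
  show "Z 0 = 0" using a(2)[of 0 0] by simp
  show m: "Z (- x) = - Z x" for x using a(2)[of "-1" x] by simp
  show "Z (x - y) = Z x - Z y" using a(1)[of x "-y"] m[of y] by simp
qed

lemma bopI:
  assumes "\<And>x y. Z (x + y) = Z x + Z y" "\<And>a x. Z (a *\<^sub>C x) = a *\<^sub>C Z x" "\<And>x. norm (Z x) \<le> K * norm x"
  shows "bop Z"
  using assms unfolding bop_def by blast

lemma bop_bounded_linear: "bop Z \<Longrightarrow> bounded_linear Z"
proof -
  assume Z: "bop Z"
  then obtain K where "\<forall>x. norm (Z x) \<le> K * norm x" by (auto simp: bop_def)
  then show ?thesis using Z by (intro bounded_linear_intro[of Z K]) (auto simp: bopD[OF Z] mult.commute)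
qed

lemma bop_tendsto: "bop Z \<Longrightarrow> (f \<longlongrightarrow> l) F \<Longrightarrow> ((\<lambda>x. Z (f x)) \<longlongrightarrow> Z l) F"
  using bounded_linear.tendsto[OF bop_bounded_linear] .

section \<open>Polynomials in a symmetric contraction\<close>

definition opoly :: "('h::complex_hilbert \<Rightarrow> 'h) \<Rightarrow> real poly \<Rightarrow> 'h \<Rightarrow> 'h" where
  "opoly X p = fold_coeffs (\<lambda>a f x. a *\<^sub>R x + X (f x)) p (\<lambda>x. 0)"

text \<open>With non-negative coefficients the triangle inequality bounds the norm of
  \<open>p X\<close> by the value of \<open>p\<close> at 1 if \<open>X\<close> is a
  contraction.\<close>

definition nn_poly :: "real poly \<Rightarrow> bool" where
  "nn_poly p \<longleftrightarrow> (\<forall>i. 0 \<le> coeff p i)"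

lemma nn_poly_0: "nn_poly 0" by (simp add: nn_poly_def)
lemma nn_poly_add: "nn_poly p \<Longrightarrow> nn_poly q \<Longrightarrow> nn_poly (p + q)" by (simp add: nn_poly_def)
lemma nn_poly_mult: "nn_poly p \<Longrightarrow> nn_poly q \<Longrightarrow> nn_poly (p * q)"
  by (auto simp: nn_poly_def coeff_mult intro!: sum_nonneg)
lemma nn_poly_smult: "0 \<le> a \<Longrightarrow> nn_poly p \<Longrightarrow> nn_poly (smult a p)" by (simp add: nn_poly_def)
lemma nn_poly_pCons: "nn_poly (pCons a p) \<longleftrightarrow> 0 \<le> a \<and> nn_poly p"
proof
  assume h: "nn_poly (pCons a p)"
  have "0 \<le> coeff p i" for i using h[unfolded nn_poly_def, rule_format, of "Suc i"] by simp
  then show "0 \<le> a \<and> nn_poly p" using h[unfolded nn_poly_def, rule_format, of 0] by (simp add: nn_poly_def)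
next
  assume "0 \<le> a \<and> nn_poly p"
  then show "nn_poly (pCons a p)" by (auto simp: nn_poly_def coeff_pCons split: nat.split)
qed

context
  fixes X :: "'h::complex_hilbert \<Rightarrow> 'h"
  assumes X: "bop X" and contr: "\<And>x. norm (X x) \<le> norm x" and Xsym: "\<And>x y. cinner (X x) y = cinner x (X y)"
begin

lemma opoly_0: "opoly X 0 x = 0" by (simp add: opoly_def)

lemma opoly_pCons: "opoly X (pCons a p) x = a *\<^sub>R x + X (opoly X p x)"
  by (cases "p = 0 \<and> a = 0") (auto simp: opoly_def bopD[OF X])

lemma opoly_add: "opoly X (p + q) x = opoly X p x + opoly X q x"
  by (induction p q rule: poly_induct2) (simp_all add: opoly_0 opoly_pCons bopD[OF X] scaleR_add_left)

lemma opoly_smult: "opoly X (smult a p) x = a *\<^sub>R opoly X p x"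
  by (induction p) (simp_all add: opoly_0 opoly_pCons bopD[OF X] scaleR_add_right)

lemma opoly_mult: "opoly X (p * q) x = opoly X p (opoly X q x)"
  by (induction p) (simp_all add: opoly_0 opoly_pCons opoly_add opoly_smult)

lemma opoly_diff: "opoly X (p - q) x = opoly X p x - opoly X q x"
  using opoly_add[of "p - q" q x] by simp

lemma opoly_linear: "opoly X p (x + y) = opoly X p x + opoly X p y" "opoly X p (a *\<^sub>C x) = a *\<^sub>C opoly X p x"
  by (induction p)
    (simp_all add: opoly_0 opoly_pCons bopD[OF X] scaleR_add_right scaleC_add_right scaleC_scaleR_left)

text \<open>What commutes with \<open>X\<close> commutes with polynomials in \<open>X\<close>, hence
  with their strong limits. The commutation relations between the various square roots come from
  here.\<close>

lemma opoly_commute: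
  assumes "bop Z" "\<And>x. Z (X x) = X (Z x)"
  shows "Z (opoly X p x) = opoly X p (Z x)"
  by (induction p) (simp_all add: opoly_0 opoly_pCons bopD[OF assms(1)] assms(2))

lemma opoly_sym: "cinner (opoly X p x) y = cinner x (opoly X p y)"
proof (induction p arbitrary: x y)
  case (pCons a p)
  show ?case using opoly_commute[OF X refl, of p]
    by (simp add: opoly_pCons cinner_algebra Xsym pCons)
qed (simp add: opoly_0)

lemma opoly_norm: "nn_poly p \<Longrightarrow> norm (opoly X p x) \<le> poly p 1 * norm x"
proof (induction p)
  case (pCons a p)
  then have *: "0 \<le> a" "norm (opoly X p x) \<le> poly p 1 * norm x" by (auto simp: nn_poly_pCons)
  have "norm (opoly X (pCons a p) x) \<le> norm (a *\<^sub>R x) + norm (X (opoly X p x))"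
    unfolding opoly_pCons by (rule norm_triangle_ineq)
  also have "\<dots> \<le> a * norm x + poly p 1 * norm x"
    using * order_trans[OF contr *(2)] by simp
  finally show ?case by (simp add: distrib_right)
qed (simp add: opoly_0)

text \<open>The iteration \<open>y \<mapsto> (x + y\<^sup>2) / 2\<close> has the fixed point \<open>1 - sqrt (1 - x)\<close>. Its iterates from \<open>0\<close>
  are polynomials in \<open>x\<close> with increasing non-negative coefficients, so that their values at \<open>1\<close>
  control the operator norms.\<close>

primrec root_poly :: "nat \<Rightarrow> real poly" where
  "root_poly 0 = 0"
| "root_poly (Suc n) = smult (1/2) ([:0, 1:] + root_poly n * root_poly n)"

lemma nn_root_poly: "nn_poly (root_poly n)"
  by (induction n) (auto simp: nn_poly_pCons nn_poly_0 intro!: nn_poly_smult nn_poly_add nn_poly_mult)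

text \<open>By the recursion each step is half the previous step times the sum of two iterates, and
  sums and products keep coefficients non-negative.\<close>

lemma nn_root_poly_step: "nn_poly (root_poly (Suc n) - root_poly n)"
proof (induction n)
  case 0
  show ?case by (simp add: nn_poly_pCons nn_poly_0)
next
  case (Suc n)
  have "root_poly (Suc (Suc n)) - root_poly (Suc n)
      = smult (1/2) ((root_poly (Suc n) - root_poly n) * (root_poly (Suc n) + root_poly n))"
  proof -
    have "smult c (x + a * a) - smult c (x + b * b) = smult c ((a - b) * (a + b))" for c and x a b :: "real poly"
      unfolding smult_diff_right[symmetric] by (simp add: algebra_simps)
    from this[of "1/2" "[:0, 1:]" "root_poly (Suc n)" "root_poly n", folded root_poly.simps(2)]
    show ?thesis .
  qed
  then show ?case using Suc nn_root_poly[of "Suc n"] nn_root_poly[of n]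
    by (metis nn_poly_add nn_poly_mult nn_poly_smult zero_le_divide_1_iff zero_le_numeral)
qed

lemma nn_root_poly_diff: "n \<le> m \<Longrightarrow> nn_poly (root_poly m - root_poly n)"
proof (induction m rule: dec_induct)
  case (step m)
  have "root_poly (Suc m) - root_poly n = (root_poly (Suc m) - root_poly m) + (root_poly m - root_poly n)" by simp
  then show ?case using nn_poly_add[OF nn_root_poly_step step.IH] by metis
qed (simp add: nn_poly_0)

text \<open>The bound 1 is the fixed point of
  \<open>y \<mapsto> (1 + y\<^sup>2) / 2\<close>.\<close>

lemma root_poly_le_1: "0 \<le> poly (root_poly n) 1 \<and> poly (root_poly n) 1 \<le> 1"
proof (induction n)
  case (Suc n)
  then have "poly (root_poly n) 1 * poly (root_poly n) 1 \<le> 1 * 1" by (intro mult_mono) auto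
  with Suc show ?case by simp
qed simp

lemma poly_1_nonneg: "nn_poly p \<Longrightarrow> 0 \<le> poly p 1"
  by (induction p) (auto simp: nn_poly_pCons)

lemma root_poly_Cauchy: "Cauchy (\<lambda>n. poly (root_poly n) 1)"
proof -
  have "incseq (\<lambda>n. poly (root_poly n) 1)"
    using poly_1_nonneg[OF nn_root_poly_diff] by (auto simp: incseq_def)
  then have "convergent (\<lambda>n. poly (root_poly n) 1)"
    using root_poly_le_1 by (intro Bseq_mono_convergent[of "\<lambda>n. poly (root_poly n) 1"] BseqI'[of _ 1])
      (auto simp: incseq_def)
  then show ?thesis by (rule convergent_Cauchy)
qed

text \<open>\<open>S = 1 - Y\<close> with \<open>Y\<close> the limit of the iterates, so that
  \<open>S\<^sup>2 = 1 - X\<close> is the fixed-point equation \<open>2 Y = X + Y\<^sup>2\<close>.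
  The bound on \<open>1 - S\<close> encodes positivity of \<open>S\<close>; the last clause places
  \<open>S\<close> in the double commutant of \<open>X\<close>.\<close>

lemma contraction_sqrt:
  "\<exists>S. bop S \<and> (\<forall>x y. cinner (S x) y = cinner x (S y)) \<and> (\<forall>x. S (S x) = x - X x) \<and>
     (\<forall>x. norm (x - S x) \<le> norm x) \<and>
     (\<forall>Z. bop Z \<and> (\<forall>x. Z (X x) = X (Z x)) \<longrightarrow> (\<forall>x. Z (S x) = S (Z x)))"
proof -
  let ?P = "\<lambda>n. opoly X (root_poly n)"
  let ?y = "\<lambda>n. poly (root_poly n) 1"
  have diff: "norm (?P m x - ?P n x) \<le> \<bar>?y m - ?y n\<bar> * norm x" for m n x
  proof -
    have *: "norm (?P m x - ?P n x) \<le> \<bar>?y m - ?y n\<bar> * norm x" if "n \<le> m" for m n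
    proof -
      have "norm (?P m x - ?P n x) \<le> (?y m - ?y n) * norm x"
        using opoly_norm[OF nn_root_poly_diff[OF that], of x] by (simp add: opoly_diff)
      also have "\<dots> \<le> \<bar>?y m - ?y n\<bar> * norm x" by (intro mult_right_mono) auto
      finally show ?thesis .
    qed
    show ?thesis using *[of m n] *[of n m] by (cases "n \<le> m") (auto simp: norm_minus_commute abs_minus_commute)
  qed
  have Pn: "norm (?P n x) \<le> norm x" for n x
    using order_trans[OF opoly_norm[OF nn_root_poly] mult_right_mono[of "?y n" 1 "norm x"]] root_poly_le_1[of n] by simp
  have "convergent (\<lambda>n. ?P n x)" for x
  proof (rule Cauchy_convergent, rule metric_CauchyI)
    fix e :: real assume "0 < e"
    then have "0 < e / (norm x + 1)" by (simp add: add_nonneg_pos)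
    from metric_CauchyD[OF root_poly_Cauchy this] obtain N where
      N: "\<And>m n. N \<le> m \<Longrightarrow> N \<le> n \<Longrightarrow> \<bar>?y m - ?y n\<bar> < e / (norm x + 1)" by (auto simp: dist_real_def)
    show "\<exists>M. \<forall>m\<ge>M. \<forall>n\<ge>M. dist (?P m x) (?P n x) < e"
    proof (intro exI allI impI)
      fix m n assume mn: "N \<le> m" "N \<le> n"
      have "dist (?P m x) (?P n x) \<le> \<bar>?y m - ?y n\<bar> * (norm x + 1)"
        unfolding dist_norm by (rule order_trans[OF diff]) (intro mult_left_mono, auto)
      also have "\<dots> < e" using N[OF mn] by (simp add: pos_less_divide_eq add_nonneg_pos)
      finally show "dist (?P m x) (?P n x) < e" .
    qed
  qed
  then obtain Y where Y: "(\<lambda>n. ?P n x) \<longlonglongrightarrow> Y x" for x unfolding convergent_def by metis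
  have Yn: "norm (Y x) \<le> norm x" for x
    by (rule Lim_bounded[OF tendsto_norm[OF Y], of 0]) (simp add: Pn)
  have Yadd: "Y (x + z) = Y x + Y z" for x z
    using LIMSEQ_unique[OF Y[of "x + z"]] tendsto_add[OF Y[of x] Y[of z]] by (simp add: opoly_linear)
  have Yscale: "Y (a *\<^sub>C x) = a *\<^sub>C Y x" for a x
    using LIMSEQ_unique[OF Y[of "a *\<^sub>C x"]] tendsto_scaleC[OF tendsto_const[of a] Y[of x]] by (simp add: opoly_linear)
  have Ybop: "bop Y" by (rule bopI[of Y 1]) (simp_all add: Yadd Yscale Yn)
  have Ysym: "cinner (Y x) z = cinner x (Y z)" for x z
    using LIMSEQ_unique[OF tendsto_cinner[OF Y[of x] tendsto_const[of z]]] tendsto_cinner[OF tendsto_const[of x] Y[of z]]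
    by (simp add: opoly_sym)
  have Ycomm: "Z (Y x) = Y (Z x)" if Z: "bop Z" "\<And>x. Z (X x) = X (Z x)" for Z x
    using LIMSEQ_unique[OF bop_tendsto[OF Z(1) Y[of x]]] Y[of "Z x"] by (simp add: opoly_commute[OF Z])
  have YY: "2 *\<^sub>R Y x = X x + Y (Y x)" for x
  proof -
    \<comment> \<open>Contractivity of the outer factor, uniform in \<open>n\<close>, lets both
      factors pass to the limit.\<close>
    have "(\<lambda>n. ?P n (?P n x - Y x)) \<longlonglongrightarrow> 0"
    proof (rule Lim_null_comparison[OF always_eventually])
      show "\<forall>n. norm (?P n (?P n x - Y x)) \<le> norm (?P n x - Y x)" using Pn by blast
      show "(\<lambda>n. norm (?P n x - Y x)) \<longlonglongrightarrow> 0" using tendsto_norm_zero[OF LIM_zero[OF Y]] .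
    qed
    from tendsto_add[OF this Y[of "Y x"]] have "(\<lambda>n. ?P n (?P n x)) \<longlonglongrightarrow> Y (Y x)"
      by (simp flip: opoly_linear)
    then have "(\<lambda>n. X x + ?P n (?P n x)) \<longlonglongrightarrow> X x + Y (Y x)" by (intro tendsto_intros)
    moreover have "(\<lambda>n. 2 *\<^sub>R ?P (Suc n) x) \<longlonglongrightarrow> 2 *\<^sub>R Y x"
      by (intro tendsto_intros LIMSEQ_Suc Y)
    moreover have "2 *\<^sub>R ?P (Suc n) x = X x + ?P n (?P n x)" for n
      by (simp add: opoly_smult opoly_add opoly_mult opoly_pCons opoly_0 bopD[OF X])
    ultimately show ?thesis by (simp add: LIMSEQ_unique)
  qed
  show ?thesis
  proof (intro exI[of _ "\<lambda>x. x - Y x"] conjI allI impI; (elim conjE)?)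
    show "bop (\<lambda>x. x - Y x)"
    proof (rule bopI)
      show "norm (x - Y x) \<le> 2 * norm x" for x using norm_triangle_ineq4[of x "Y x"] Yn[of x] by simp
    qed (simp_all add: Yadd Yscale scaleC_diff_right)
    show "cinner (x - Y x) y = cinner x (y - Y y)" for x y by (simp add: cinner_algebra Ysym)
    show "(x - Y x) - Y (x - Y x) = x - X x" for x
      using YY[of x] by (simp add: bopD[OF Ybop] scaleR_2 algebra_simps)
    show "norm (x - (x - Y x)) \<le> norm x" for x by (simp add: Yn)
    show "Z (x - Y x) = Z x - Y (Z x)" if "bop Z" "\<forall>x. Z (X x) = X (Z x)" for Z x
      using that by (simp add: bopD[OF that(1)] Ycomm)
  qed
qed

end

text \<open>Density makes the adjoint single-valued, so that the \<open>THE\<close> in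
  \<open>op_adjoint\<close> can be evaluated; \<open>maximal\<close> then corresponds to the
  inclusion of the adjoint in \<open>T\<close>.\<close>

lemma self_adjoint_iff: "self_adjoint T \<longleftrightarrow> sa_operator (dom T) (op_app T)"
proof
  assume h: "self_adjoint T"
  then have lin: "clinear_on (dom T) (op_app T)" and dense: "closure (dom T) = UNIV" and adj: "op_adjoint T = T"
    by (auto simp: self_adjoint_def)
  have uniq: "z = z'" if "\<forall>x\<in>dom T. cinner x z = cinner x z'" for z z' :: 'a
  proof -
    have "z - z' = 0"
    proof (rule eq_0_of_cinner[OF _ dense])
      fix g assume "g \<in> dom T"
      then show "cinner (z - z') g = 0"
        using that cinner_commute[of "z - z'" g] by (simp add: cinner_algebra)
    qed
    then show ?thesis by simp
  qed
  have max: "y \<in> dom T \<and> op_app T y = z" if "\<And>x. x \<in> dom T \<Longrightarrow> cinner (op_app T x) y = cinner x z" for y z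
  proof -
    have "(THE z. \<forall>x\<in>dom T. cinner (op_app T x) y = cinner x z) = z"
      using that uniq by (intro the_equality) auto
    then have "op_adjoint T y = Some z" using that by (auto simp: op_adjoint_def)
    then show ?thesis unfolding adj by (auto simp: op_app_def)
  qed
  show "sa_operator (dom T) (op_app T)"
  proof
    fix x y assume x: "x \<in> dom T" and y: "y \<in> dom T"
    then obtain z where "T y = Some z" by auto
    then have "op_adjoint T y = Some z" using adj by simp
    then obtain z' where z': "\<forall>x\<in>dom T. cinner (op_app T x) y = cinner x z'"
      by (auto simp: op_adjoint_def split: if_splits)
    have "y \<in> dom T \<and> op_app T y = z'" by (rule max) (use z' in blast)
    then show "cinner (op_app T x) y = cinner x (op_app T y)" using z' x by simp
  qed (use lin dense max in auto)
next
  assume "sa_operator (dom T) (op_app T)"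
  then interpret sa_operator "dom T" "op_app T" .
  have "op_adjoint T y = T y" for y
  proof (cases "\<exists>z. \<forall>x\<in>dom T. cinner (op_app T x) y = cinner x z")
    case True
    then obtain z where z: "\<forall>x\<in>dom T. cinner (op_app T x) y = cinner x z" by blast
    have "(THE z. \<forall>x\<in>dom T. cinner (op_app T x) y = cinner x z) = z"
    proof (rule the_equality)
      fix z' assume "\<forall>x\<in>dom T. cinner (op_app T x) y = cinner x z'"
      then have "y \<in> dom T \<and> op_app T y = z'" by (intro maximal) blast
      moreover have "y \<in> dom T \<and> op_app T y = z" by (intro maximal) (use z in blast)
      ultimately show "z' = z" by simp
    qed (rule z)
    then have "op_adjoint T y = Some z" using z by (auto simp: op_adjoint_def)
    moreover have "y \<in> dom T \<and> op_app T y = z" using maximal z by blast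
    ultimately show ?thesis by (auto simp: op_app_def)
  next
    case False
    then have "y \<notin> dom T" using sym by blast
    then show ?thesis using False by (auto simp: op_adjoint_def domIff)
  qed
  then show "self_adjoint T" using lin dense by (auto simp: self_adjoint_def)
qed

text \<open>With \<open>R = (1 + A)\<^sup>-\<^sup>1\<close>, \<open>S = R\<^sup>1\<^sup>/\<^sup>2\<close> and \<open>Q = (1 - R)\<^sup>1\<^sup>/\<^sup>2\<close>, the square root of \<open>A\<close> is \<open>Q S\<^sup>-\<^sup>1\<close> on
  the range of \<open>S\<close>; self-adjointness rests on \<open>S\<^sup>2 + Q\<^sup>2 = 1\<close>.\<close>

lemma sqrt_exists:
  fixes A :: "'h::complex_hilbert \<rightharpoonup> 'h"
  assumes sa: "self_adjoint A" and nn: "nonneg_op A"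
  shows "\<exists>B. self_adjoint B \<and> nonneg_op B \<and> B \<circ>\<^sub>m B = A"
proof -
  let ?A = "op_app A"
  interpret sa_operator "dom A" ?A using sa by (simp add: self_adjoint_iff)
  \<comment> \<open>Non-negativity gives the mixed term a sign, so \<open>1 + A\<close> is bounded
    below and \<open>resolvable 1\<close> follows.\<close>
  have exp: "(norm (x + ?A x))\<^sup>2 = (norm x)\<^sup>2 + 2 * Re (cinner (?A x) x) + (norm (?A x))\<^sup>2" if "x \<in> dom A" for x
    using sym[OF that that] by (simp add: norm_eq_cinner cinner_algebra)
  have pos: "0 \<le> Re (cinner (?A x) x)" if "x \<in> dom A" for x using nn that by (auto simp: nonneg_op_def)
  have le: "norm x \<le> norm (x + ?A x)" "norm (?A x) \<le> norm (x + ?A x)" if "x \<in> dom A" for x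
    by (rule power2_le_imp_le; use exp[OF that] pos[OF that] in simp)+
  have res: "resolvable 1" using le(1) by (simp add: resolvable_def)
  have "\<exists>x. x \<in> dom A \<and> x + ?A x = y" for y using resolvable_surj[OF res, of y] by auto
  then obtain R where R: "\<And>y. R y \<in> dom A" "\<And>y. R y + ?A (R y) = y" by metis
  have R_eq: "R (x + ?A x) = x" if "x \<in> dom A" for x
  proof -
    have "R (x + ?A x) - x + ?A (R (x + ?A x) - x) = 0"
      using R[of "x + ?A x"] that by (simp add: algebra_simps)
    then show ?thesis using le(1)[of "R (x + ?A x) - x"] R(1) that by simp
  qed
  have Radd: "R (y + z) = R y + R z" for y z
  proof -
    have "R y + R z + ?A (R y + R z) = (R y + ?A (R y)) + (R z + ?A (R z))" using R(1) by (simp add: add_ac)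
    then show ?thesis using R_eq[of "R y + R z"] R(1) unfolding R(2) by simp
  qed
  have Rscale: "R (a *\<^sub>C y) = a *\<^sub>C R y" for a y
  proof -
    have "a *\<^sub>C R y + ?A (a *\<^sub>C R y) = a *\<^sub>C (R y + ?A (R y))" using R(1) by (simp add: scaleC_add_right)
    then show ?thesis using R_eq[of "a *\<^sub>C R y"] R(1) unfolding R(2) by simp
  qed
  have Rn: "norm (R y) \<le> norm y" for y using le(1)[OF R(1), of y] R(2) by simp
  have Rbop: "bop R" by (rule bopI[of R 1]) (simp_all add: Radd Rscale Rn)
  have Rsym: "cinner (R x) y = cinner x (R y)" for x y
  proof -
    have "cinner (R x) (R y + ?A (R y)) = cinner (R x + ?A (R x)) (R y)"
      using sym[OF R(1) R(1)] by (simp add: cinner_algebra)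
    then show ?thesis by (simp add: R(2))
  qed
  define X where "X y = y - R y" for y
  have Xbop: "bop X"
  proof (rule bopI)
    show "norm (X x) \<le> 2 * norm x" for x using norm_triangle_ineq4[of x "R x"] Rn[of x] by (simp add: X_def)
  qed (simp_all add: X_def Radd Rscale scaleC_diff_right)
  have Xn: "norm (X y) \<le> norm y" for y
  proof -
    have "X y = ?A (R y)" using R(2)[of y] by (simp add: X_def diff_eq_eq add.commute)
    then show ?thesis using le(2)[OF R(1), of y] R(2) by simp
  qed
  have Xsym: "cinner (X x) y = cinner x (X y)" for x y by (simp add: X_def cinner_algebra Rsym)
  from contraction_sqrt[OF Xbop Xn Xsym] obtain S where
    S: "bop S" "\<And>x y. cinner (S x) y = cinner x (S y)" "\<And>x. S (S x) = x - X x" "\<And>x. norm (x - S x) \<le> norm x"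
      "\<And>Z x. bop Z \<Longrightarrow> (\<And>x. Z (X x) = X (Z x)) \<Longrightarrow> Z (S x) = S (Z x)" by blast
  from contraction_sqrt[OF Rbop Rn Rsym] obtain Q where
    Q: "bop Q" "\<And>x y. cinner (Q x) y = cinner x (Q y)" "\<And>x. Q (Q x) = x - R x" "\<And>x. norm (x - Q x) \<le> norm x"
      "\<And>Z x. bop Z \<Longrightarrow> (\<And>x. Z (R x) = R (Z x)) \<Longrightarrow> Z (Q x) = Q (Z x)" by blast
  have SS: "S (S x) = R x" for x by (simp add: S(3) X_def)
  have QR: "Q (R x) = R (Q x)" for x using Q(5)[OF Rbop refl] by simp
  have QS: "Q (S x) = S (Q x)" for x by (rule S(5)[OF Q(1)]) (simp add: X_def bopD[OF Q(1)] QR)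
  have QQ: "Q (Q x) + S (S x) = x" for x by (simp add: Q(3) SS)
  \<comment> \<open>Preparation for \<open>T\<close> with \<open>T\<^sup>2 = S\<close>, a fourth
    root of \<open>R\<close>. It symmetrises \<open>S Q\<close> to \<open>T Q T\<close>, which shows
    that the square root of \<open>A\<close> is non-negative.\<close>
  define X' where "X' y = y - S y" for y
  have X'bop: "bop X'"
    by (rule bopI[of X' 1]) (simp_all add: X'_def bopD[OF S(1)] S(4) scaleC_diff_right)
  from contraction_sqrt[OF X'bop, unfolded X'_def, OF S(4)] obtain T where
    T: "bop T" "\<And>x y. cinner (T x) y = cinner x (T y)" "\<And>x. T (T x) = S x"
      "\<And>Z x. bop Z \<Longrightarrow> (\<And>x. Z (S x) = S (Z x)) \<Longrightarrow> Z (T x) = T (Z x)"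
    using S(2) by (auto simp: cinner_algebra bopD)
  have QT: "Q (T x) = T (Q x)" for x by (rule T(4)[OF Q(1) QS])
  \<comment> \<open>Positivity is recovered from \<open>norm (x - Q x) \<le> norm x\<close> by
    expanding the square.\<close>
  have Qpos: "0 \<le> Re (cinner (Q x) x)" for x
  proof -
    have "(norm (x - Q x))\<^sup>2 \<le> (norm x)\<^sup>2" by (intro power_mono Q(4)) simp
    moreover have "(norm (x - Q x))\<^sup>2 = (norm x)\<^sup>2 - 2 * Re (cinner (Q x) x) + (norm (Q x))\<^sup>2"
      using Q(2)[of x x] by (simp add: norm_eq_cinner cinner_algebra)
    moreover have "0 \<le> (norm (Q x))\<^sup>2" by simp
    ultimately show ?thesis by linarith
  qed
  have inj: "inj S"
  proof (rule injI)
    fix x y assume "S x = S y"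
    then have "R x = R y" by (metis SS)
    then show "x = y" using R(2) by metis
  qed
  define b where "b x = Q (inv S x)" for x
  have bS: "b (S y) = Q y" for y by (simp add: b_def inv_f_f[OF inj])
  define B where "B x = (if x \<in> range S then Some (b x) else None)" for x
  have dom: "dom B = range S" by (auto simp: B_def dom_def)
  have app: "op_app B (S y) = Q y" for y by (simp add: op_app_def B_def bS)
  have sub: "dom A \<subseteq> range S"
  proof
    fix x assume "x \<in> dom A"
    then have "x = S (S (x + ?A x))" by (simp add: SS R_eq)
    then show "x \<in> range S" by blast
  qed
  have B: "sa_operator (dom B) (op_app B)"
  proof
    show "clinear_on (dom B) (op_app B)" unfolding clinear_on_def dom
    proof (intro conjI ballI allI; (elim rangeE, hypsubst)?)
      show "0 \<in> range S" by (metis bopD(4)[OF S(1)] rangeI)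
      fix u v a
      show "S u + S v \<in> range S" "op_app B (S u + S v) = op_app B (S u) + op_app B (S v)"
        by (simp_all add: app bopD[OF Q(1)] flip: bopD(1)[OF S(1)])
      show "a *\<^sub>C S u \<in> range S" "op_app B (a *\<^sub>C S u) = a *\<^sub>C op_app B (S u)"
        by (simp_all add: app bopD[OF Q(1)] flip: bopD(2)[OF S(1)])
    qed
    show "closure (dom B) = UNIV" using closure_mono[OF sub] dense dom by auto
    show "cinner (op_app B x) y = cinner x (op_app B y)" if xy: "x \<in> dom B" "y \<in> dom B" for x y
    proof -
      obtain u v where "x = S u" "y = S v" using xy dom by auto
      then show ?thesis by (simp add: app Q(2) S(2) QS)
    qed
    show "y \<in> dom B \<and> op_app B y = z" if h: "\<And>x. x \<in> dom B \<Longrightarrow> cinner (op_app B x) y = cinner x z" for y z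
    proof -
      have "cinner u (Q y - S z) = 0" for u
        using h[of "S u"] by (simp add: dom app Q(2) S(2) cinner_algebra)
      then have "Q y = S z" by (metis cinner_eq_0_iff right_minus_eq)
      \<comment> \<open>\<open>S\<^sup>2 + Q\<^sup>2 = 1\<close> exhibits the preimage of
        \<open>y\<close> under \<open>S\<close> as \<open>S y + Q z\<close>; \<open>Q\<close> maps
        the same vector to \<open>z\<close>.\<close>
      then have "S (S y + Q z) = y" "Q (S y + Q z) = z"
        using QQ[of y] QQ[of z] by (simp_all add: bopD[OF S(1)] bopD[OF Q(1)] QS add.commute)
      then show ?thesis using app dom by (metis rangeI)
    qed
  qed
  moreover have "nonneg_op B"
    unfolding nonneg_op_def
  proof
    fix x assume "x \<in> dom B"
    then obtain u where u: "x = S u" using dom by auto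
    have "cinner (Q u) (S u) = cinner (Q (T u)) (T u)" by (simp add: QT T(2,3))
    then show "0 \<le> Re (cinner (op_app B x) x)" unfolding u app using Qpos by simp
  qed
  moreover have "B \<circ>\<^sub>m B = A"
  proof
    fix x
    show "(B \<circ>\<^sub>m B) x = A x"
    proof (cases "x \<in> dom A")
      case True
      define w where "w = x + ?A x"
      have x: "x = S (S w)" by (simp add: w_def SS R_eq True)
      have "?A x = w - R w" by (simp add: w_def R_eq True)
      then have "A x = Some (Q (Q w))" using True by (auto simp: op_app_def Q(3))
      moreover have "(B \<circ>\<^sub>m B) x = Some (Q (Q w))"
        by (simp add: x map_comp_def B_def bS QS)
      ultimately show ?thesis by simp
    next
      case False
      have "(B \<circ>\<^sub>m B) x = None"
      proof (rule ccontr)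
        assume "(B \<circ>\<^sub>m B) x \<noteq> None"
        then have "x \<in> range S" "b x \<in> range S"
          by (auto simp: map_comp_def B_def split: if_splits option.splits)
        then obtain y z where y: "x = S y" "Q y = S z" using bS by auto
        \<comment> \<open>\<open>S y = S (S\<^sup>2 y + Q\<^sup>2 y)\<close>, and
          \<open>Q\<^sup>2 y = Q S z = S Q z\<close>, so two factors \<open>S\<close> can be pulled
          out.\<close>
        then have "x = R (S y + Q z)" using QQ[of y] by (simp flip: SS add: bopD[OF S(1)] QS add.commute)
        then show False using False R(1) by metis
      qed
      then show ?thesis using False by (simp add: domIff)
    qed
  qed
  ultimately show ?thesis using self_adjoint_iff by blast
qed

lemma op_sqrt:
  assumes "self_adjoint A" "nonneg_op A"
  shows "sa_operator (dom (op_sqrt A)) (op_app (op_sqrt A))" "op_sqrt A \<circ>\<^sub>m op_sqrt A = A"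
proof -
  have "self_adjoint (op_sqrt A) \<and> nonneg_op (op_sqrt A) \<and> op_sqrt A \<circ>\<^sub>m op_sqrt A = A"
    unfolding op_sqrt_def by (rule someI_ex[OF sqrt_exists[OF assms]])
  then show "sa_operator (dom (op_sqrt A)) (op_app (op_sqrt A))" "op_sqrt A \<circ>\<^sub>m op_sqrt A = A"
    by (simp_all add: self_adjoint_iff)
qed

text \<open>The kernel of the root is contained in the kernel of its square.\<close>

lemma op_sqrt_injective:
  assumes "self_adjoint A" "nonneg_op A" "injective_op A" "x \<in> dom (op_sqrt A)" "op_app (op_sqrt A) x = 0"
  shows "x = 0"
proof -
  interpret sa_operator "dom (op_sqrt A)" "op_app (op_sqrt A)" by (rule op_sqrt(1)) fact+
  have "op_sqrt A x = Some 0" using assms(4,5) by (auto simp: op_app_def)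
  moreover obtain z where z: "op_sqrt A 0 = Some z" by (meson domD lin_rules(1))
  moreover have "z = 0" using lin_rules(8) z by (simp add: op_app_def)
  moreover have "A y = Some 0" if y: "op_sqrt A y = Some 0" and 0: "op_sqrt A 0 = Some 0" for y
  proof -
    have "(op_sqrt A \<circ>\<^sub>m op_sqrt A) y = Some 0" using y 0 by (simp add: map_comp_def)
    then show ?thesis by (simp add: op_sqrt(2)[OF assms(1,2)])
  qed
  ultimately have "A x = Some 0" "A 0 = Some 0" by simp_all
  then show ?thesis using assms(3) by (auto simp: injective_op_def inj_on_def op_app_def dom_def)
qed

section \<open>Absolutely continuous functions and functions of bounded variation\<close>

text \<open>On the tags in the exceptional null set the Riemann sum is controlled by absolute continuity;
  the gauge making their total length small is the one witnessing that the indicator function of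
  the null set has integral zero.\<close>

lemma AC_fundamental_theorem:
  fixes f :: "real \<Rightarrow> 'a::banach"
  assumes AC: "absolutely_continuous_on {a..b} f" and ab: "a \<le> b" and N: "negligible N"
    and der: "\<And>t. t \<in> {a..b} - N \<Longrightarrow> (f has_vector_derivative f' t) (at t within {a..b})"
  shows "(f' has_integral (f b - f a)) {a..b}"
proof (rule has_integral_spike[OF N])
  \<comment> \<open>With value 0 on \<open>N\<close>, a tag in \<open>N\<close> contributes just an
    increment of \<open>f\<close>, which absolute continuity can bound.\<close>
  define g where "g t = (if t \<in> N then 0 else f' t)" for t
  show "f' t = g t" if "t \<in> {a..b} - N" for t using that by (simp add: g_def)
  show "(g has_integral (f b - f a)) {a..b}"
    unfolding has_integral_real
  proof (intro allI impI)
    fix e :: real assume e: "0 < e"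
    \<comment> \<open>The summand 1 keeps the denominator positive when
      \<open>a = b\<close>.\<close>
    define e1 where "e1 = e / (2 * (b - a + 1))"
    have e1: "0 < e1" "e1 * (b - a) < e / 2"
    proof -
      show "0 < e1" using e ab by (simp add: e1_def)
      have "e1 * (b - a) < e1 * (b - a + 1)" using \<open>0 < e1\<close> by simp
      also have "\<dots> = e / 2"
      proof -
        have "b - a + 1 \<noteq> 0" using ab by simp
        then show ?thesis unfolding e1_def by (metis divide_divide_eq_left mult.commute nonzero_eq_divide_eq)
      qed
      finally show "e1 * (b - a) < e / 2" .
    qed
    obtain \<delta> where \<delta>: "0 < \<delta>" "\<And>n (x::nat \<Rightarrow> real) (y::nat \<Rightarrow> real).
        (\<forall>i<n. x i \<le> y i \<and> {x i..y i} \<subseteq> {a..b}) \<Longrightarrow> disjoint_family_on (\<lambda>i. {x i<..<y i}) {..<n} \<Longrightarrow>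
        (\<Sum>i<n. y i - x i) < \<delta> \<Longrightarrow> (\<Sum>i<n. norm (f (y i) - f (x i))) < e / 2"
      using AC[unfolded absolutely_continuous_on_def, THEN spec, THEN mp, OF half_gt_zero[OF e]] by blast
    have "((indicat_real N) has_integral 0) {a..b}" using N[unfolded negligible_def, rule_format, of a b] by simp
    from this[unfolded has_integral_real, THEN spec, THEN mp, OF \<delta>(1)]
    obtain d1 where d1: "gauge d1 \<and> (\<forall>p. p tagged_division_of {a..b} \<and> d1 fine p \<longrightarrow>
        norm ((\<Sum>(x,k)\<in>p. measure lborel k *\<^sub>R indicat_real N x) - 0) < \<delta>)" ..
    have "\<forall>x. \<exists>d>0. x \<in> {a..b} - N \<longrightarrow>
         (\<forall>y\<in>{a..b}. norm (y-x) < d \<longrightarrow> norm (f y - f x - (y-x) *\<^sub>R f' x) \<le> e1 * norm (y-x))"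
    proof
      fix x
      show "\<exists>d>0. x \<in> {a..b} - N \<longrightarrow>
         (\<forall>y\<in>{a..b}. norm (y-x) < d \<longrightarrow> norm (f y - f x - (y-x) *\<^sub>R f' x) \<le> e1 * norm (y-x))"
      proof (cases "x \<in> {a..b} - N")
        case True
        from der[OF True, unfolded has_vector_derivative_def has_derivative_within_alt, THEN conjunct2, rule_format, OF e1(1)]
        show ?thesis by blast
      next
        case False
        then show ?thesis using zero_less_one by blast
      qed
    qed
    from choice[OF this] obtain d where d': "\<forall>x. 0 < d x \<and> (x \<in> {a..b} - N \<longrightarrow>
         (\<forall>y\<in>{a..b}. norm (y-x) < d x \<longrightarrow> norm (f y - f x - (y-x) *\<^sub>R f' x) \<le> e1 * norm (y-x)))" ..
    have d: "\<And>x. 0 < d x"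
        "\<And>x y. x \<in> {a..b} - N \<Longrightarrow> y \<in> {a..b} \<Longrightarrow> norm (y-x) < d x \<Longrightarrow> norm (f y - f x - (y-x) *\<^sub>R f' x) \<le> e1 * norm (y-x)"
      using d' by simp_all
    show "\<exists>\<gamma>. gauge \<gamma> \<and> (\<forall>p. p tagged_division_of {a..b} \<and> \<gamma> fine p \<longrightarrow>
        norm ((\<Sum>(x,k)\<in>p. measure lborel k *\<^sub>R g x) - (f b - f a)) < e)"
    proof (intro exI[of _ "\<lambda>x. d1 x \<inter> ball x (d x)"] conjI allI impI; (elim conjE)?)
      show "gauge (\<lambda>x. d1 x \<inter> ball x (d x))" by (rule gauge_Int[OF conjunct1[OF d1] gauge_ball_dependent]) (use d' in blast)
      fix p assume p: "p tagged_division_of {a..b}" and fine: "(\<lambda>x. d1 x \<inter> ball x (d x)) fine p"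
      have fine1: "d1 fine p" and fine2: "(\<lambda>x. ball x (d x)) fine p" using fine by (auto simp: fine_Int)
      have fin: "finite p" by (rule tagged_division_ofD(1)[OF p])
      have form: "\<exists>u v. K = {u..v} \<and> u \<le> v \<and> x \<in> K \<and> K \<subseteq> {a..b} \<and> Inf K = u \<and> Sup K = v \<and> measure lborel K = v - u"
        if xKp: "(x, K) \<in> p" for x K
      proof -
        have xK: "x \<in> K" "K \<subseteq> {a..b}" using tagged_division_ofD(2,3)[OF p xKp] by auto
        obtain u v where K: "K = cbox u v" using tagged_division_ofD(4)[OF p xKp] by blast
        then have "u \<le> v" using xK by auto
        then show ?thesis using K xK by auto
      qed
      have sums: "b - a = (\<Sum>(x,K)\<in>p. Sup K - Inf K)" "f b - f a = (\<Sum>(x,K)\<in>p. f(Sup K) - f(Inf K))"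
        using additive_tagged_division_1[where f= "\<lambda>x. x"] additive_tagged_division_1[where f= f] ab p by auto
      define h where "h = (\<lambda>(x,K). measure lborel K *\<^sub>R g x - (f (Sup K) - f (Inf K)))"
      define pN where "pN = {q\<in>p. fst q \<in> N}"
      have sub: "pN \<subseteq> p" and finN: "finite pN" using fin by (auto simp: pN_def)
      have "(\<Sum>(x,k)\<in>p. measure lborel k *\<^sub>R g x) - (f b - f a) = sum h p"
        unfolding sums(2) h_def by (simp add: sum_subtractf case_prod_beta)
      also have "\<dots> = sum h (p - pN) + sum h pN" by (rule sum.subset_diff[OF sub fin])
      finally have eq: "(\<Sum>(x,k)\<in>p. measure lborel k *\<^sub>R g x) - (f b - f a) = sum h (p - pN) + sum h pN" .
      have len: "0 \<le> (case q of (x,K) \<Rightarrow> Sup K - Inf K)" if "q \<in> p" for q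
        using form[of "fst q" "snd q"] that by (auto simp: case_prod_beta)
      have 1: "norm (sum h (p - pN)) < e / 2"
      proof -
        have "norm (sum h (p - pN)) \<le> (\<Sum>q\<in>p - pN. e1 * (case q of (x,K) \<Rightarrow> Sup K - Inf K))"
        proof (rule sum_norm_le)
          fix q assume q: "q \<in> p - pN"
          obtain x K where qq: "q = (x, K)" by (cases q)
          then have xK: "(x, K) \<in> p" "x \<notin> N" using q by (auto simp: pN_def)
          obtain u v where uv: "K = {u..v}" "u \<le> v" "x \<in> K" "K \<subseteq> {a..b}" "Inf K = u" "Sup K = v" "measure lborel K = v - u"
            using form[OF xK(1)] by blast
          have ball: "K \<subseteq> ball x (d x)" using fine2 xK(1) by (auto simp: fine_def)
          have x: "x \<in> {a..b} - N" using uv xK by auto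
          have u: "u \<in> K" "v \<in> K" using uv by auto
          have "u \<in> {a..b}" "v \<in> {a..b}" using u uv(4) by auto
          moreover have "u \<in> ball x (d x)" "v \<in> ball x (d x)" using u ball by auto
          then have "norm (u - x) < d x" "norm (v - x) < d x" by (simp_all add: dist_norm norm_minus_commute)
          ultimately have nu: "norm (f u - f x - (u-x) *\<^sub>R f' x) \<le> e1 * norm (u - x)"
            and nv: "norm (f v - f x - (v-x) *\<^sub>R f' x) \<le> e1 * norm (v - x)"
            using d(2)[OF x] by blast+
          have nn: "norm (u - x) = x - u" "norm (v - x) = v - x" using uv(1,3) by auto
          note nu = nu[unfolded nn] and nv = nv[unfolded nn]
          have "h q = (v - u) *\<^sub>R f' x - (f v - f u)" using xK(2) by (simp add: h_def qq uv(5-7) g_def)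
          \<comment> \<open>The tag lies between \<open>u\<close> and \<open>v\<close>, so both
            linearisations are taken at \<open>x\<close> and the two error bounds add up to the
            length of the interval.\<close>
          also have "\<dots> = (f u - f x - (u-x) *\<^sub>R f' x) - (f v - f x - (v-x) *\<^sub>R f' x)"
            by (simp add: algebra_simps)
          finally have hq: "h q = (f u - f x - (u-x) *\<^sub>R f' x) - (f v - f x - (v-x) *\<^sub>R f' x)" .
          have "norm (h q) \<le> e1 * (x - u) + e1 * (v - x)"
            unfolding hq using norm_triangle_ineq4[of "f u - f x - (u-x) *\<^sub>R f' x" "f v - f x - (v-x) *\<^sub>R f' x"] nu nv
            by linarith
          also have "\<dots> = e1 * (v - u)" by (simp add: algebra_simps)
          finally show "norm (h q) \<le> e1 * (case q of (x,K) \<Rightarrow> Sup K - Inf K)" by (simp add: qq uv)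
        qed
        also have "\<dots> \<le> (\<Sum>q\<in>p. e1 * (case q of (x,K) \<Rightarrow> Sup K - Inf K))"
          using e1(1) len by (intro sum_mono2 fin) (auto intro!: mult_nonneg_nonneg)
        also have "\<dots> = e1 * (b - a)" by (simp add: sums(1) sum_distrib_left)
        finally show ?thesis using e1(2) by simp
      qed
      have 2: "norm (sum h pN) < e / 2"
      proof -
        \<comment> \<open>Absolute continuity is stated for finite sequences of intervals, so the
          pairs tagged in \<open>N\<close> are enumerated.\<close>
        obtain \<phi> where \<phi>: "bij_betw \<phi> {..<card pN} pN" using ex_bij_betw_nat_finite[OF finN] by (auto simp: lessThan_atLeast0)
        define K where "K i = snd (\<phi> i)" for i
        have \<phi>p: "\<phi> i \<in> p" "fst (\<phi> i) \<in> N" if "i < card pN" for i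
          using bij_betwE[OF \<phi>] that by (auto simp: pN_def)
        have fK: "\<exists>u v. K i = {u..v} \<and> u \<le> v \<and> K i \<subseteq> {a..b} \<and> Inf (K i) = u \<and> Sup (K i) = v \<and> measure lborel (K i) = v - u"
          if "i < card pN" for i
          using form[of "fst (\<phi> i)" "K i"] \<phi>p(1)[OF that] by (auto simp: K_def)
        have "(\<Sum>i<card pN. norm (f (Sup (K i)) - f (Inf (K i)))) < e / 2"
        proof (rule \<delta>(2))
          show "\<forall>i<card pN. Inf (K i) \<le> Sup (K i) \<and> {Inf (K i)..Sup (K i)} \<subseteq> {a..b}"
            using fK by metis
          show "disjoint_family_on (\<lambda>i. {Inf (K i)<..<Sup (K i)}) {..<card pN}"
            unfolding disjoint_family_on_def
          proof (intro ballI impI)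
            fix i j assume ij: "i \<in> {..<card pN}" "j \<in> {..<card pN}" "i \<noteq> j"
            then have "\<phi> i \<noteq> \<phi> j" using \<phi> by (metis bij_betw_def inj_onD)
            moreover have "(fst (\<phi> i), K i) \<in> p" "(fst (\<phi> j), K j) \<in> p" using \<phi>p(1) ij by (auto simp: K_def)
            ultimately have "interior (K i) \<inter> interior (K j) = {}"
              using tagged_division_ofD(5)[OF p] unfolding K_def by (metis prod.collapse)
            moreover have "interior (K l) = {Inf (K l)<..<Sup (K l)}" if "l < card pN" for l
              using fK[OF that] interior_atLeastAtMost_real by metis
            ultimately show "{Inf (K i)<..<Sup (K i)} \<inter> {Inf (K j)<..<Sup (K j)} = {}" using ij by auto
          qed
          have "(\<Sum>i<card pN. Sup (K i) - Inf (K i)) = (\<Sum>i<card pN. measure lborel (snd (\<phi> i)))"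
            using fK by (intro sum.cong) (auto simp: K_def)
          also have "\<dots> = (\<Sum>q\<in>pN. measure lborel (snd q))" by (rule sum.reindex_bij_betw[OF \<phi>])
          also have "\<dots> = (\<Sum>q\<in>pN. measure lborel (snd q) *\<^sub>R indicat_real N (fst q))"
            by (intro sum.cong) (auto simp: pN_def)
          also have "\<dots> \<le> (\<Sum>q\<in>p. measure lborel (snd q) *\<^sub>R indicat_real N (fst q))"
            by (intro sum_mono2 fin sub) auto
          also have "\<dots> < \<delta>" using d1[THEN conjunct2, THEN spec, THEN mp, OF conjI[OF p fine1]] by (simp add: case_prod_beta)
          finally show "(\<Sum>i<card pN. Sup (K i) - Inf (K i)) < \<delta>" .
        qed
        moreover have "norm (sum h pN) \<le> (\<Sum>i<card pN. norm (f (Sup (K i)) - f (Inf (K i))))"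
        proof -
          have "sum h pN = (\<Sum>i<card pN. h (\<phi> i))" by (rule sum.reindex_bij_betw[OF \<phi>, symmetric])
          also have "norm \<dots> \<le> (\<Sum>i<card pN. norm (f (Sup (K i)) - f (Inf (K i))))"
            by (intro sum_norm_le) (use \<phi>p(2) in \<open>auto simp: h_def K_def g_def case_prod_beta norm_minus_commute\<close>)
          finally show ?thesis .
        qed
        ultimately show ?thesis by simp
      qed
      show "norm ((\<Sum>(x,k)\<in>p. measure lborel k *\<^sub>R g x) - (f b - f a)) < e"
        unfolding eq using norm_triangle_ineq[of "sum h (p - pN)" "sum h pN"] 1 2 by simp
    qed
  qed
qed

lemma absolutely_continuous_on_compose:
  assumes "absolutely_continuous_on S f" and "\<And>x y. norm (\<phi> x - \<phi> y) \<le> L * norm (x - y)"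
  shows "absolutely_continuous_on S (\<lambda>t. \<phi> (f t))"
  unfolding absolutely_continuous_on_def
proof (intro allI impI)
  fix e :: real assume e: "0 < e"
  define L' where "L' = \<bar>L\<bar> + 1"
  have L': "0 < L'" "norm (\<phi> x - \<phi> y) \<le> L' * norm (x - y)" for x y
  proof -
    show "0 < L'" by (simp add: L'_def)
    have "L * norm (x - y) \<le> L' * norm (x - y)" by (intro mult_right_mono) (auto simp: L'_def)
    then show "norm (\<phi> x - \<phi> y) \<le> L' * norm (x - y)" using assms(2)[of x y] by linarith
  qed
  obtain \<delta> where \<delta>: "0 < \<delta>" "\<And>n (x::nat \<Rightarrow> real) (y::nat \<Rightarrow> real).
        (\<forall>i<n. x i \<le> y i \<and> {x i..y i} \<subseteq> S) \<and> disjoint_family_on (\<lambda>i. {x i<..<y i}) {..<n} \<and>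
        (\<Sum>i<n. y i - x i) < \<delta> \<Longrightarrow> (\<Sum>i<n. norm (f (y i) - f (x i))) < e / L'"
    using assms(1)[unfolded absolutely_continuous_on_def, THEN spec, THEN mp, OF divide_pos_pos[OF e L'(1)]] by blast
  show "\<exists>\<delta>>0. \<forall>n (x::nat \<Rightarrow> real) (y::nat \<Rightarrow> real).
        (\<forall>i<n. x i \<le> y i \<and> {x i..y i} \<subseteq> S) \<and> disjoint_family_on (\<lambda>i. {x i<..<y i}) {..<n} \<and>
        (\<Sum>i<n. y i - x i) < \<delta> \<longrightarrow> (\<Sum>i<n. norm (\<phi> (f (y i)) - \<phi> (f (x i)))) < e"
  proof (intro exI[of _ \<delta>] conjI \<delta>(1) allI impI)
    fix n :: nat and x y :: "nat \<Rightarrow> real"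
    assume h: "(\<forall>i<n. x i \<le> y i \<and> {x i..y i} \<subseteq> S) \<and> disjoint_family_on (\<lambda>i. {x i<..<y i}) {..<n} \<and> (\<Sum>i<n. y i - x i) < \<delta>"
    have "(\<Sum>i<n. norm (\<phi> (f (y i)) - \<phi> (f (x i)))) \<le> (\<Sum>i<n. L' * norm (f (y i) - f (x i)))"
      by (intro sum_mono L'(2))
    also have "\<dots> = L' * (\<Sum>i<n. norm (f (y i) - f (x i)))" by (simp add: sum_distrib_left)
    also have "\<dots> < L' * (e / L')" using \<delta>(2)[OF h] L'(1) by (intro mult_strict_left_mono)
    finally show "(\<Sum>i<n. norm (\<phi> (f (y i)) - \<phi> (f (x i)))) < e" using L'(1) by simp
  qed
qed

lemma absolutely_continuous_on_Lipschitz: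
  fixes f :: "real \<Rightarrow> 'b::real_normed_vector"
  assumes "\<And>x y. x \<in> S \<Longrightarrow> y \<in> S \<Longrightarrow> norm (f x - f y) \<le> L * norm (x - y)"
  shows "absolutely_continuous_on S f"
  unfolding absolutely_continuous_on_def
proof (intro allI impI)
  fix e :: real assume e: "0 < e"
  define L' where "L' = \<bar>L\<bar> + 1"
  have L': "0 < L'" by (simp add: L'_def)
  show "\<exists>\<delta>>0. \<forall>n (x::nat \<Rightarrow> real) (y::nat \<Rightarrow> real).
        (\<forall>i<n. x i \<le> y i \<and> {x i..y i} \<subseteq> S) \<and> disjoint_family_on (\<lambda>i. {x i<..<y i}) {..<n} \<and>
        (\<Sum>i<n. y i - x i) < \<delta> \<longrightarrow> (\<Sum>i<n. norm (f (y i) - f (x i))) < e"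
  proof (intro exI[of _ "e / L'"] conjI allI impI)
    show "0 < e / L'" using e L' by simp
    fix n :: nat and x y :: "nat \<Rightarrow> real"
    assume h: "(\<forall>i<n. x i \<le> y i \<and> {x i..y i} \<subseteq> S) \<and> disjoint_family_on (\<lambda>i. {x i<..<y i}) {..<n} \<and> (\<Sum>i<n. y i - x i) < e / L'"
    have "norm (f (y i) - f (x i)) \<le> L' * (y i - x i)" if i: "i < n" for i
    proof -
      have xy: "x i \<le> y i" "{x i..y i} \<subseteq> S" using h i by auto
      then have "x i \<in> S" "y i \<in> S" by auto
      note xy = xy(1) this
      have "L * norm (y i - x i) \<le> L' * norm (y i - x i)" by (intro mult_right_mono) (auto simp: L'_def)
      then show ?thesis using assms[OF xy(3,2)] xy(1) by simp
    qed
    then have "(\<Sum>i<n. norm (f (y i) - f (x i))) \<le> (\<Sum>i<n. L' * (y i - x i))" by (intro sum_mono) auto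
    also have "\<dots> = L' * (\<Sum>i<n. y i - x i)" by (simp add: sum_distrib_left)
    also have "\<dots> < L' * (e / L')" using h L' by (intro mult_strict_left_mono) auto
    finally show "(\<Sum>i<n. norm (f (y i) - f (x i))) < e" using L' by simp
  qed
qed

text \<open>A mean value inequality without derivatives. Over a fine partition the increments of
  \<open>\<mu>\<close> telescope to the main term, while the errors telescope to
  \<open>e (\<rho> b - \<rho> a)\<close> with \<open>e\<close> arbitrary. Measuring the error by
  \<open>\<rho>\<close> rather than by length admits functions that jump.\<close>

lemma increment_bound:
  fixes F :: "real \<Rightarrow> 'a::real_normed_vector"
  assumes ab: "a \<le> b"
    and loc: "\<And>e. 0 < e \<Longrightarrow> \<exists>\<delta>>0. \<forall>s t. a \<le> s \<and> s \<le> t \<and> t \<le> b \<and> t - s < \<delta> \<longrightarrow>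
        norm (F t - F s) \<le> \<mu> t - \<mu> s + e * (\<rho> t - \<rho> s)"
  shows "norm (F b - F a) \<le> \<mu> b - (\<mu> a :: real)"
proof -
  have *: "norm (F b - F a) \<le> \<mu> b - \<mu> a + e * (\<rho> b - \<rho> a)" if e: "0 < e" for e
  proof -
    obtain \<delta> where \<delta>: "0 < \<delta>" "\<And>s t. a \<le> s \<Longrightarrow> s \<le> t \<Longrightarrow> t \<le> b \<Longrightarrow> t - s < \<delta> \<Longrightarrow>
        norm (F t - F s) \<le> \<mu> t - \<mu> s + e * (\<rho> t - \<rho> s)" using loc[OF e] by blast
    obtain n :: nat where n: "(b - a) / \<delta> < n" using reals_Archimedean2 by blast
    have n0: "0 < real n" using n ab \<delta>(1) by (metis divide_nonneg_pos diff_ge_0_iff_ge le_less_trans)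
    define x where "x i = a + i * ((b - a) / n)" for i :: nat
    have x0: "x 0 = a" "x n = b" using n0 by (auto simp: x_def)
    have step: "x (Suc i) - x i = (b - a) / n" for i unfolding x_def of_nat_Suc distrib_right by simp
    have sd: "(b - a) / n < \<delta>" using n n0 \<delta>(1) by (simp add: field_simps)
    have mono: "x i \<le> x j" if "i \<le> j" for i j using that ab n0 by (auto simp: x_def intro!: divide_right_mono mult_right_mono)
    have "norm (F (x k) - F a) \<le> \<mu> (x k) - \<mu> a + e * (\<rho> (x k) - \<rho> a)" if "k \<le> n" for k
      using that
    proof (induction k)
      case (Suc k)
      have "norm (F (x (Suc k)) - F (x k)) \<le> \<mu> (x (Suc k)) - \<mu> (x k) + e * (\<rho> (x (Suc k)) - \<rho> (x k))"
        using Suc.prems mono[of 0 k] mono[of k "Suc k"] mono[of "Suc k" n] x0 step[of k] sd by (intro \<delta>(2)) auto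
      moreover have "norm (F (x k) - F a) \<le> \<mu> (x k) - \<mu> a + e * (\<rho> (x k) - \<rho> a)" using Suc by simp
      moreover have "norm (F (x (Suc k)) - F a) \<le> norm (F (x (Suc k)) - F (x k)) + norm (F (x k) - F a)"
        using norm_triangle_ineq[of "F (x (Suc k)) - F (x k)" "F (x k) - F a"] by simp
      ultimately show ?case by (simp add: algebra_simps)
    qed (simp add: x0)
    from this[of n] show ?thesis by (simp add: x0)
  qed
  show ?thesis
  proof (rule field_le_epsilon)
    fix e :: real assume e: "0 < e"
    define r where "r = \<bar>\<rho> b - \<rho> a\<bar> + 1"
    have r: "0 < r" by (simp add: r_def)
    have "norm (F b - F a) \<le> \<mu> b - \<mu> a + e / r * (\<rho> b - \<rho> a)" using e r by (intro *) simp
    also have "e / r * (\<rho> b - \<rho> a) \<le> e / r * r" using e r by (intro mult_left_mono) (auto simp: r_def)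
    finally show "norm (F b - F a) \<le> \<mu> b - \<mu> a + e" using r by simp
  qed
qed

text \<open>\<open>\<nu> T\<close> is the total variation of \<open>c\<close> on the interval from
  0, excluded, to \<open>T\<close>. The value 0 for \<open>T \<le> 0\<close> makes the bounds hold
  on the whole line.\<close>

lemma bounded_variation_dominating:
  assumes "bounded_variation_on c {0<..}"
  obtains \<nu> :: "real \<Rightarrow> real" and M where "\<And>s t. 0 < s \<Longrightarrow> s \<le> t \<Longrightarrow> \<bar>c t - c s\<bar> \<le> \<nu> t - \<nu> s"
    "\<And>t. 0 \<le> \<nu> t \<and> \<nu> t \<le> M"
proof -
  obtain M where M: "\<And>n (t::nat \<Rightarrow> real). (\<forall>i\<le>n. 0 < t i) \<Longrightarrow> (\<forall>i<n. t i \<le> t (Suc i)) \<Longrightarrow>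
      (\<Sum>i<n. \<bar>c (t (Suc i)) - c (t i)\<bar>) \<le> M"
    using assms unfolding bounded_variation_on_def greaterThan_iff by blast
  define P where "P T = {(\<Sum>i<n. \<bar>c (t (Suc i)) - c (t i)\<bar>) | n (t::nat \<Rightarrow> real). (\<forall>i\<le>n. 0 < t i \<and> t i \<le> T) \<and> (\<forall>i<n. t i \<le> t (Suc i))}" for T
  have M0: "0 \<le> M" using M[of 0 "\<lambda>_. 1"] by simp
  define \<nu> where "\<nu> T = (if 0 < T then Sup (P T) else 0)" for T
  have mem0: "0 \<in> P T" if "0 < T" for T
    unfolding P_def by (rule CollectI, rule exI[of _ 0], rule exI[of _ "\<lambda>_. T"]) (use that in auto)
  have le: "v \<le> M" if "v \<in> P T" for v T using that M unfolding P_def by blast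
  have bdd: "bdd_above (P T)" for T using le by (rule bdd_aboveI)
  have 1: "0 \<le> \<nu> T \<and> \<nu> T \<le> M" for T
  proof (cases "0 < T")
    case True
    have "Sup (P T) \<le> M" using mem0[OF True] le by (intro cSup_least) auto
    then show ?thesis using cSup_upper[OF mem0[OF True] bdd] True by (simp add: \<nu>_def)
  qed (simp add: \<nu>_def M0)
  have 2: "\<bar>c t - c s\<bar> \<le> \<nu> t - \<nu> s" if st: "0 < s" "s \<le> t" for s t
  proof -
    have "v \<le> \<nu> t - \<bar>c t - c s\<bar>" if v: "v \<in> P s" for v
    proof -
      obtain n and x :: "nat \<Rightarrow> real" where x: "v = (\<Sum>i<n. \<bar>c (x (Suc i)) - c (x i)\<bar>)"
        "\<forall>i\<le>n. 0 < x i \<and> x i \<le> s" "\<forall>i<n. x i \<le> x (Suc i)" using v unfolding P_def by blast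
      \<comment> \<open>A partition up to \<open>s\<close> is prolonged by \<open>s\<close> and
        \<open>t\<close>, which adds at least \<open>|c t - c s|\<close> to its sum.\<close>
      define y where "y i = (if i \<le> n then x i else if i = Suc n then s else t)" for i
      let ?w = "\<Sum>i<Suc (Suc n). \<bar>c (y (Suc i)) - c (y i)\<bar>"
      have "?w \<in> P t" unfolding P_def
      proof (rule CollectI, intro exI conjI)
        show "\<forall>i\<le>Suc (Suc n). 0 < y i \<and> y i \<le> t"
          using x(2) st by (auto simp: y_def intro: order_trans)
        show "\<forall>i<Suc (Suc n). y i \<le> y (Suc i)"
          using x(2,3) st by (auto simp: y_def less_Suc_eq)
      qed (rule refl)
      then have "?w \<le> \<nu> t" using cSup_upper[OF _ bdd] st by (auto simp: \<nu>_def)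
      moreover have "(\<Sum>i<n. \<bar>c (y (Suc i)) - c (y i)\<bar>) = v"
        unfolding x(1) by (intro sum.cong) (auto simp: y_def)
      ultimately show ?thesis by (simp add: y_def)
    qed
    then have "Sup (P s) \<le> \<nu> t - \<bar>c t - c s\<bar>" using mem0[OF st(1)] by (intro cSup_least) auto
    then show ?thesis using st by (simp add: \<nu>_def)
  qed
  show thesis by (rule that[OF 2 1])
qed

text \<open>Jordan decomposition: \<open>\<nu>\<close> and \<open>\<nu> - f\<close> are monotone on
  the positive axis, and monotone functions are integrable.\<close>

lemma integrable_of_dominating:
  fixes f \<nu> :: "real \<Rightarrow> real"
  assumes "\<And>s t. 0 < s \<Longrightarrow> s \<le> t \<Longrightarrow> \<bar>f t - f s\<bar> \<le> \<nu> t - \<nu> s"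
    and "\<And>t. 0 < t \<Longrightarrow> \<bar>\<nu> t\<bar> \<le> M" "\<And>t. 0 < t \<Longrightarrow> \<bar>f t\<bar> \<le> K" and a: "0 \<le> a"
  shows "f integrable_on {a..b}"
proof -
  \<comment> \<open>\<open>- M - K\<close> lies below both functions, so monotonicity survives the
    extension to \<open>t \<le> 0\<close>; the altered point 0 is negligible.\<close>
  define f1 where "f1 t = (if t \<le> 0 then - M - K else \<nu> t)" for t
  define f2 where "f2 t = (if t \<le> 0 then - M - K else \<nu> t - f t)" for t
  have K: "0 \<le> K" using assms(3)[of 1] by simp
  have "mono f1"
  proof (rule monoI)
    fix s t :: real assume "s \<le> t"
    then show "f1 s \<le> f1 t"
      using assms(1)[of s t] assms(2)[of t] K by (auto simp: f1_def abs_le_iff)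
  qed
  moreover have "mono f2"
  proof (rule monoI)
    fix s t :: real assume st: "s \<le> t"
    consider "s \<le> 0" "t \<le> 0" | "s \<le> 0" "0 < t" | "0 < s" "0 < t" using st by linarith
    then show "f2 s \<le> f2 t"
    proof cases
      case 2
      then show ?thesis using assms(2)[of t] assms(3)[of t] by (auto simp: f2_def abs_le_iff)
    next
      case 3
      then show ?thesis using assms(1)[of s t] st by (auto simp: f2_def abs_le_iff)
    qed (simp add: f2_def)
  qed
  ultimately have "(\<lambda>t. f1 t - f2 t) integrable_on {a..b}"
    by (intro integrable_diff integrable_on_mono_on) (auto intro: mono_on_subset[of UNIV])
  then show ?thesis
    by (rule integrable_spike[where S = "{0}"]) (use a in \<open>auto simp: f1_def f2_def\<close>)
qed

section \<open>The wave equation in energy space\<close>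

lemma has_integral_norm_bound:
  fixes f :: "real \<Rightarrow> 'b::real_normed_vector"
  assumes "(f has_integral i) {a..b}" "a \<le> b" "\<And>r. r \<in> {a..b} \<Longrightarrow> norm (f r) \<le> Q"
  shows "norm i \<le> Q * (b - a)"
proof -
  have "0 \<le> Q" using order_trans[OF norm_ge_zero assms(3)[of a]] assms(2) by simp
  then show ?thesis using has_integral_bound[of Q f i a b] assms by simp
qed

context sa_operator begin

text \<open>\<open>W\<close> stands for \<open>\<A> u\<close> and \<open>V\<close> for the velocity.
  The system is integrated in time and \<open>B\<close> sits on the test vector, so it is meaningful
  for functions with values in \<open>H\<close>.\<close>

definition sol :: "(real \<Rightarrow> real) \<Rightarrow> (real \<Rightarrow> complex) \<Rightarrow> (real \<Rightarrow> 'h) \<Rightarrow> (real \<Rightarrow> 'h) \<Rightarrow> bool" where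
  "sol c b W V \<longleftrightarrow> continuous_on {0..} W \<and> continuous_on {0..} V \<and>
     (\<forall>g\<in>D. \<forall>s\<ge>0. \<forall>t\<ge>s.
        ((\<lambda>r. cinner (V r) (B g)) has_integral cinner (W t - W s) g) {s..t} \<and>
        ((\<lambda>r. - (of_real ((c r)\<^sup>2) * cinner (W r) (B g) + b r * cinner (V r) g))
           has_integral cinner (V t - V s) g) {s..t})"

end

text \<open>The bounds on \<open>c\<close> concern \<open>t > 0\<close>: its variation is controlled
  on the open half-line, so \<open>c 0\<close> may be detached from the values to its right.\<close>

locale wave = sa_operator D B for D :: "'h::complex_hilbert set" and B +
  fixes c :: "real \<Rightarrow> real" and b :: "real \<Rightarrow> complex" and \<nu> :: "real \<Rightarrow> real" and M K \<kappa> :: real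
  assumes nu: "0 < s \<Longrightarrow> s \<le> t \<Longrightarrow> \<bar>c t - c s\<bar> \<le> \<nu> t - \<nu> s"
    and nu_bounds: "0 \<le> \<nu> t" "\<nu> t \<le> M"
    and c_lower: "0 < t \<Longrightarrow> \<kappa> \<le> c t" and kappa: "0 < \<kappa>" and c_upper: "0 < t \<Longrightarrow> c t \<le> K"
    and b_int: "b absolutely_integrable_on {0..}"
begin

lemma K_pos: "0 < K" using c_lower[OF zero_less_one] c_upper[OF zero_less_one] kappa by linarith

lemma c_abs: "0 < t \<Longrightarrow> \<bar>c t\<bar> \<le> K" using c_lower[of t] c_upper[of t] kappa by linarith

lemma c_integrable: "0 \<le> s \<Longrightarrow> c integrable_on {s..t}"
  by (rule integrable_of_dominating[of c \<nu> M K]) (use nu nu_bounds c_abs in auto)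

definition \<tau> :: "real \<Rightarrow> real" where "\<tau> t = integral {0..t} c"

lemma tau_integral: "0 \<le> s \<Longrightarrow> s \<le> t \<Longrightarrow> (c has_integral (\<tau> t - \<tau> s)) {s..t}"
proof -
  assume st: "0 \<le> s" "s \<le> t"
  have "integral {0..s} c + integral {s..t} c = integral {0..t} c"
    using st by (intro Henstock_Kurzweil_Integration.integral_combine c_integrable) auto
  then have "\<tau> t - \<tau> s = integral {s..t} c" unfolding \<tau>_def by linarith
  then show ?thesis using integrable_integral[OF c_integrable[OF st(1), of t]] by simp
qed

lemma tau_0 [simp]: "\<tau> 0 = 0" by (simp add: \<tau>_def)

lemma tau_first_order:
  assumes "0 < s" "s \<le> t" and close: "\<And>r. s \<le> r \<Longrightarrow> r \<le> t \<Longrightarrow> \<bar>c r - a\<bar> \<le> Q"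
  shows "\<bar>\<tau> t - \<tau> s - a * (t - s)\<bar> \<le> Q * (t - s)"
proof -
  have "((\<lambda>r. c r - a) has_integral (\<tau> t - \<tau> s) - a * (t - s)) {s..t}"
    using has_integral_diff[OF tau_integral[of s t] has_integral_const_real[of a s t]] assms by (simp add: mult.commute)
  then have "norm ((\<tau> t - \<tau> s) - a * (t - s)) \<le> Q * (t - s)"
    by (rule has_integral_norm_bound) (use assms in auto)
  then show ?thesis by simp
qed

lemma tau_Lipschitz:
  assumes "0 < s" "s \<le> t"
  shows "\<bar>\<tau> t - \<tau> s\<bar> \<le> K * (t - s)"
  using tau_first_order[OF assms, of 0 K] c_abs assms by simp

text \<open>The Lipschitz bound starts at positive times; continuity at 0 comes from the indefinite
  integral.\<close>

lemma tau_continuous: "continuous_on {0..} \<tau>"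
  unfolding continuous_on_eq_continuous_within
proof
  fix t :: real assume t: "t \<in> {0..}"
  have "continuous_on {0..t + 1} \<tau>" unfolding \<tau>_def by (rule indefinite_integral_continuous_1[OF c_integrable]) simp
  then have "continuous (at t within {0..t + 1}) \<tau>" using t by (simp add: continuous_on_eq_continuous_within)
  moreover have "at t within {0..t + 1} = at t within {0..}"
    by (rule at_within_nhd[of _ "{..<t + 1}"]) (use t in auto)
  ultimately show "continuous (at t within {0..}) \<tau>" by simp
qed

definition \<beta> :: "real \<Rightarrow> real" where "\<beta> t = integral {0..t} (\<lambda>r. norm (b r))"

lemma b_int_on: "0 \<le> s \<Longrightarrow> b absolutely_integrable_on {s..t}"
  by (rule set_integrable_subset[OF b_int]) auto

lemma norm_b_integrable: "0 \<le> s \<Longrightarrow> (\<lambda>r. norm (b r)) integrable_on {s..t}"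
  using b_int_on absolutely_integrable_on_def by blast

lemma beta_integral: "0 \<le> s \<Longrightarrow> s \<le> t \<Longrightarrow> integral {s..t} (\<lambda>r. norm (b r)) = \<beta> t - \<beta> s"
  using Henstock_Kurzweil_Integration.integral_combine[OF _ _ norm_b_integrable, of 0 s t] by (simp add: \<beta>_def)

text \<open>Increments of \<open>m\<close> dominate the mass of \<open>|b| dt + |dc|\<close>, the
  only source of change of \<open>\<psi>\<close>.\<close>

definition m :: "real \<Rightarrow> real" where "m t = \<beta> t + \<nu> t"

lemma beta_mono: "0 \<le> s \<Longrightarrow> s \<le> t \<Longrightarrow> \<beta> s \<le> \<beta> t"
  using beta_integral[of s t] integral_nonneg[OF norm_b_integrable, of s t] by simp

lemma nu_mono: "0 < s \<Longrightarrow> s \<le> t \<Longrightarrow> \<nu> s \<le> \<nu> t"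
  using nu[of s t] by linarith

lemma m_mono: "0 < s \<Longrightarrow> s \<le> t \<Longrightarrow> m s \<le> m t"
  using beta_mono[of s t] nu_mono[of s t] by (simp add: m_def)

lemma m_bounded: "\<exists>C. \<forall>t>0. m t \<le> C"
proof (intro exI allI impI)
  fix t :: real assume "0 < t"
  have "\<beta> t \<le> integral {0..} (\<lambda>r. norm (b r))" unfolding \<beta>_def
    by (rule integral_subset_le) (use b_int norm_b_integrable in \<open>auto simp: absolutely_integrable_on_def\<close>)
  then show "m t \<le> integral {0..} (\<lambda>r. norm (b r)) + M" using nu_bounds by (simp add: m_def add_mono)
qed

lemma m_tail:
  assumes "0 < e"
  obtains s where "0 < s" "\<And>p q. s \<le> p \<Longrightarrow> p \<le> q \<Longrightarrow> m q - m p \<le> e"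
proof -
  have bdd: "bdd_above (m ` {0<..})" using m_bounded by (auto simp: bdd_above_def)
  have "Sup (m ` {0<..}) - e < Sup (m ` {0<..})" using assms by simp
  then obtain s where s: "0 < s" "Sup (m ` {0<..}) - e < m s"
    by (rule less_cSupE) auto
  have "m q - m p \<le> e" if "s \<le> p" "p \<le> q" for p q
    using cSUP_upper[OF _ bdd, of q] m_mono[of s p] s that by simp
  then show thesis using that s(1) by blast
qed

text \<open>The analogue of \<open>m_tail\<close> on the left of a finite \<open>T\<close>.
  \<open>T\<close> itself is excluded because \<open>\<nu>\<close> may jump there.\<close>

lemma m_left:
  assumes "0 < e" "0 < T"
  obtains s where "0 < s" "s < T" "\<And>p q. s \<le> p \<Longrightarrow> p \<le> q \<Longrightarrow> q < T \<Longrightarrow> m q - m p \<le> e"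
proof -
  have "m x \<le> C" if "\<forall>t>0. m t \<le> C" "x \<in> {0<..<T}" for x C using that by simp
  then have bdd: "bdd_above (m ` {0<..<T})" using m_bounded by (metis bdd_aboveI2)
  have lt: "Sup (m ` {0<..<T}) - e < Sup (m ` {0<..<T})" using assms by simp
  have "T / 2 \<in> {0<..<T}" using assms(2) by simp
  then have ne: "m ` {0<..<T} \<noteq> {}" by blast
  obtain y where y: "y \<in> m ` {0<..<T}" "Sup (m ` {0<..<T}) - e < y" by (rule less_cSupE[OF lt ne])
  then obtain s where s: "0 < s" "s < T" "Sup (m ` {0<..<T}) - e < m s" by auto
  have "m q - m p \<le> e" if "s \<le> p" "p \<le> q" "q < T" for p q
    using cSUP_upper[OF _ bdd, of q] m_mono[of s p] s that by simp
  then show thesis by (rule that[OF s(1,2)])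
qed

end

locale wave_solution = wave D B c b \<nu> M K \<kappa>
  for D :: "'h::complex_hilbert set" and B and c b \<nu> M K \<kappa> +
  fixes W V :: "real \<Rightarrow> 'h"
  assumes sol: "sol c b W V"
begin

lemma W_cont: "continuous_on {0..} W" and V_cont: "continuous_on {0..} V"
  using sol by (auto simp: sol_def)

lemma sol_W: "g \<in> D \<Longrightarrow> 0 \<le> s \<Longrightarrow> s \<le> t \<Longrightarrow> ((\<lambda>r. cinner (V r) (B g)) has_integral cinner (W t - W s) g) {s..t}"
  using sol by (simp add: sol_def)

lemma sol_V: "g \<in> D \<Longrightarrow> 0 \<le> s \<Longrightarrow> s \<le> t \<Longrightarrow>
    ((\<lambda>r. - (of_real ((c r)\<^sup>2) * cinner (W r) (B g) + b r * cinner (V r) g)) has_integral cinner (V t - V s) g) {s..t}"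
  using sol by (simp add: sol_def)

text \<open>Continuity of \<open>V\<close> makes the pairing bounded and measurable on a compact
  interval, so it may multiply the merely integrable \<open>b\<close>.\<close>

lemma b_term:
  assumes "0 \<le> s" "s \<le> t" "\<And>r. s \<le> r \<Longrightarrow> r \<le> t \<Longrightarrow> norm (V r) \<le> L"
  shows "(\<lambda>r. b r * cinner (V r) g) integrable_on {s..t}"
    "norm (integral {s..t} (\<lambda>r. b r * cinner (V r) g)) \<le> L * norm g * (\<beta> t - \<beta> s)"
proof -
  have cont: "continuous_on {s..t} (\<lambda>r. cinner (V r) g)"
    by (intro continuous_intros continuous_on_subset[OF V_cont]) (use assms in auto)
  have "(\<lambda>r. cinner (V r) g * b r) absolutely_integrable_on {s..t}"
  proof (rule absolutely_integrable_bounded_measurable_product[where h = "\<lambda>x y::complex. x * y"])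
    show "bilinear (\<lambda>x y::complex. x * y)" by (rule bilinear_times)
    show "(\<lambda>r. cinner (V r) g) \<in> borel_measurable (lebesgue_on {s..t})"
      by (rule continuous_imp_measurable_on_sets_lebesgue[OF cont]) simp
    show "bounded ((\<lambda>r. cinner (V r) g) ` {s..t})"
      by (rule compact_imp_bounded[OF compact_continuous_image[OF cont]]) simp
  qed (use b_int_on assms in auto)
  then show int: "(\<lambda>r. b r * cinner (V r) g) integrable_on {s..t}"
    by (simp add: absolutely_integrable_on_def mult.commute)
  have "norm (integral {s..t} (\<lambda>r. b r * cinner (V r) g)) \<le> integral {s..t} (\<lambda>r. (L * norm g) * norm (b r))"
  proof (rule integral_norm_bound_integral[OF int])
    show "(\<lambda>r. (L * norm g) * norm (b r)) integrable_on {s..t}"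
      using integrable_on_cmult_left[OF norm_b_integrable[OF assms(1)], of "L * norm g"] by simp
    fix r assume r: "r \<in> {s..t}"
    have "norm (cinner (V r) g) \<le> L * norm g"
      using order_trans[OF Cauchy_Schwarz_cinner mult_right_mono[OF assms(3)[of r]]] r by simp
    from mult_left_mono[OF this, of "norm (b r)"]
    show "norm (b r * cinner (V r) g) \<le> (L * norm g) * norm (b r)" by (simp add: norm_mult mult_ac)
  qed
  then show "norm (integral {s..t} (\<lambda>r. b r * cinner (V r) g)) \<le> L * norm g * (\<beta> t - \<beta> s)"
    using assms by (simp add: beta_integral)
qed

text \<open>A real parameter \<open>\<sigma>\<close> treats both signs at once: the computations use
  \<open>\<sigma> * \<sigma> = 1\<close> and nothing else about it.\<close>

definition \<phi> where "\<phi> \<sigma> t = V t + (\<i> * of_real \<sigma> * of_real (c t)) *\<^sub>C W t" for \<sigma> :: real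

definition \<psi> where "\<psi> \<sigma> t = U (- \<sigma> * \<tau> t) (\<phi> \<sigma> t)" for \<sigma> :: real

text \<open>On a short interval the coefficient is frozen at the right end point. What remains are the
  contributions of \<open>b\<close> and of the jump of \<open>c\<close>, and an error of second order.\<close>

lemma local_estimate:
  assumes \<sigma>: "\<sigma> * \<sigma> = (1::real)" and g: "g \<in> D2" and pq: "0 < p" "p \<le> q"
    and L: "\<And>r. p \<le> r \<Longrightarrow> r \<le> q \<Longrightarrow> norm (V r) \<le> L \<and> norm (W r) \<le> L"
    and \<omega>: "\<And>r. p \<le> r \<Longrightarrow> r \<le> q \<Longrightarrow> norm (V q - V r) \<le> \<omega> \<and> norm (W q - W r) \<le> \<omega>"
  shows "norm (cinner (\<phi> \<sigma> q) (U (\<sigma> * \<tau> q) g) - cinner (\<phi> \<sigma> p) (U (\<sigma> * \<tau> p) g))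
    \<le> L * norm g * (m q - m p)
      + (q - p) * ((K + 1) * norm (B g) * (L * (\<nu> q - \<nu> p) + K * \<omega>) + 3 * L * (1 + K) * K\<^sup>2 * norm (B (B g)) * (q - p))"
proof -
  \<comment> \<open>The group is expanded around the left end \<open>p\<close>; \<open>e\<close> is
    its Taylor remainder over the phase increment \<open>\<theta>\<close>.\<close>
  define h where "h = U (\<sigma> * \<tau> p) g"
  define \<theta> where "\<theta> = \<tau> q - \<tau> p"
  define e where "e = U (\<sigma> * \<theta>) h - h - (\<i> * complex_of_real (\<sigma> * \<theta>)) *\<^sub>C B h"
  define d\<nu> where "d\<nu> = \<nu> q - \<nu> p"
  define Ib where "Ib = integral {p..q} (\<lambda>r. b r * cinner (V r) h)"
  have gD: "g \<in> D" "B g \<in> D" using g by (auto simp: D2_def)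
  have h: "h \<in> D" "B h = U (\<sigma> * \<tau> p) (B g)" "B h \<in> D" "B (B h) = U (\<sigma> * \<tau> p) (B (B g))" "norm h = norm g"
    using gD by (auto simp: h_def U_commute U_simps)
  then have hn: "norm (B h) = norm (B g)" "norm (B (B h)) = norm (B (B g))" "h \<in> D2"
    by (auto simp: U_simps D2_def)
  have hq: "U (\<sigma> * \<tau> q) g = h + (\<i> * complex_of_real (\<sigma> * \<theta>)) *\<^sub>C B h + e"
    by (simp add: e_def h_def \<theta>_def U_add algebra_simps)
  have \<sigma>1: "\<bar>\<sigma>\<bar> = 1" using \<sigma> by (metis abs_mult_self_eq abs_1 abs_square_eq_1 power2_eq_square)
  have L0: "0 \<le> L" using L[of p] pq norm_ge_zero order_trans by blast
  have \<omega>0: "0 \<le> \<omega>" using \<omega>[of q] pq by simp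
  have d\<nu>0: "0 \<le> d\<nu>" using nu_mono[of p q] pq by (simp add: d\<nu>_def)
  have K0: "0 \<le> K" using K_pos by simp
  have \<theta>: "\<bar>\<theta>\<bar> \<le> K * (q - p)" unfolding \<theta>_def by (rule tau_Lipschitz) (use pq in auto)
  have cr: "\<bar>c r\<bar> \<le> K" "\<bar>c q - c r\<bar> \<le> d\<nu>" if "p \<le> r" "r \<le> q" for r
    using c_abs[of r] nu[of r q] nu_mono[of p r] that pq by (auto simp: d\<nu>_def)
  have CS: "norm (cinner x (B h)) \<le> C * norm (B g)" if "norm x \<le> C" for x C
    using order_trans[OF Cauchy_Schwarz_cinner mult_right_mono[OF that, of "norm (B h)"]] hn(1) by simp
  have en: "norm e \<le> 3 * (K * (q - p))\<^sup>2 * norm (B (B g))"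
  proof -
    have "norm e \<le> 3 * (\<sigma> * \<theta>)\<^sup>2 * norm (B (B h))" unfolding e_def by (rule U_second_order[OF hn(3)])
    also have "(\<sigma> * \<theta>)\<^sup>2 = \<bar>\<theta>\<bar>\<^sup>2" using \<sigma>1 by (metis abs_mult mult_1 power2_abs)
    also have "3 * \<bar>\<theta>\<bar>\<^sup>2 * norm (B (B h)) \<le> 3 * (K * (q - p))\<^sup>2 * norm (B (B g))"
      unfolding hn(2) by (intro mult_right_mono mult_left_mono power_mono \<theta>) auto
    finally show ?thesis .
  qed
  \<comment> \<open>\<open>E1\<close> comes from the equation for \<open>V\<close>,
    \<open>E2\<close> from the one for \<open>W\<close>, \<open>E3\<close> from the Taylor remainder
    and \<open>E5\<close> from the change of \<open>c\<close>. In \<open>E1\<close> and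
    \<open>E2\<close> the phase increment is written as an integral of \<open>c\<close>, so that the
    main terms cancel under the integral.\<close>
  define E1 where "E1 = of_real (c q * \<theta>) * cinner (W q) (B h) + cinner (V q - V p) h + Ib"
  define E2 where "E2 = \<i> * of_real \<sigma> * (of_real (c q) * cinner (W q - W p) h - of_real \<theta> * cinner (V q) (B h))"
  define E3 where "E3 = cinner (V q) e + \<i> * of_real \<sigma> * of_real (c q) * cinner (W q) e"
  define E5 where "E5 = \<i> * of_real \<sigma> * of_real (c q - c p) * cinner (W p) h"
  have tau_h: "((\<lambda>r. complex_of_real (c r) * z) has_integral of_real \<theta> * z) {p..q}" for z
    using has_integral_mult_left[OF has_integral_of_real[OF tau_integral[of p q]], where c = z] pq by (simp add: \<theta>_def)
  have Ib_h: "((\<lambda>r. b r * cinner (V r) h) has_integral Ib) {p..q}"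
    unfolding Ib_def by (rule integrable_integral[OF b_term(1)]) (use pq L in auto)
  have Ib_n: "norm Ib \<le> L * norm g * (\<beta> q - \<beta> p)"
    unfolding Ib_def h(5)[symmetric] by (rule b_term(2)) (use pq L in auto)
  have E1_n: "norm E1 \<le> (K * norm (B g) * (L * d\<nu> + K * \<omega>)) * (q - p)"
  proof -
    have "((\<lambda>r. complex_of_real (c r) * (of_real (c q) * cinner (W q) (B h))
        + (- (of_real ((c r)\<^sup>2) * cinner (W r) (B h) + b r * cinner (V r) h)) + b r * cinner (V r) h)
        has_integral of_real \<theta> * (of_real (c q) * cinner (W q) (B h)) + cinner (V q - V p) h + Ib) {p..q}"
      by (intro has_integral_add tau_h sol_V Ib_h h(1)) (use pq in auto)
    then have "norm (of_real \<theta> * (of_real (c q) * cinner (W q) (B h)) + cinner (V q - V p) h + Ib)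
        \<le> (K * norm (B g) * (L * d\<nu> + K * \<omega>)) * (q - p)"
    proof (rule has_integral_norm_bound)
      show "p \<le> q" by (rule pq(2))
      fix r assume "r \<in> {p..q}"
      then have r: "p \<le> r" "r \<le> q" by auto
      \<comment> \<open>A factor \<open>c r\<close> is common; what remains is the variation of
        \<open>c\<close> and the oscillation of \<open>W\<close>.\<close>
      have eq: "complex_of_real (c r) * (of_real (c q) * cinner (W q) (B h))
        + (- (of_real ((c r)\<^sup>2) * cinner (W r) (B h) + b r * cinner (V r) h)) + b r * cinner (V r) h
        = of_real (c r) * (of_real (c q - c r) * cinner (W q) (B h) + of_real (c r) * cinner (W q - W r) (B h))"
        by (simp add: cinner_diff_left algebra_simps power2_eq_square)
      have 1: "norm (of_real (c q - c r) * cinner (W q) (B h)) \<le> d\<nu> * (L * norm (B g))"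
        unfolding norm_mult by (intro mult_mono) (use cr(2)[OF r] CS[of "W q" L] L[of q] pq d\<nu>0 in \<open>auto simp del: of_real_diff\<close>)
      have 2: "norm (of_real (c r) * cinner (W q - W r) (B h)) \<le> K * (\<omega> * norm (B g))"
        unfolding norm_mult by (intro mult_mono) (use cr(1)[OF r] CS[of "W q - W r" \<omega>] \<omega>[OF r] K0 in auto)
      have "norm (of_real (c r) * (of_real (c q - c r) * cinner (W q) (B h) + of_real (c r) * cinner (W q - W r) (B h)))
        \<le> K * (d\<nu> * (L * norm (B g)) + K * (\<omega> * norm (B g)))"
        unfolding norm_mult[of "of_real (c r)"]
        by (intro mult_mono order_trans[OF norm_triangle_ineq add_mono[OF 1 2]]) (use cr(1)[OF r] K0 in auto)
      then show "norm (complex_of_real (c r) * (of_real (c q) * cinner (W q) (B h))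
        + (- (of_real ((c r)\<^sup>2) * cinner (W r) (B h) + b r * cinner (V r) h)) + b r * cinner (V r) h)
        \<le> K * norm (B g) * (L * d\<nu> + K * \<omega>)" unfolding eq by (simp add: algebra_simps)
    qed
    then show ?thesis using pq by (simp add: E1_def mult_ac)
  qed
  have E2_n: "norm E2 \<le> (norm (B g) * (L * d\<nu> + K * \<omega>)) * (q - p)"
  proof -
    have "((\<lambda>r. of_real (c q) * cinner (V r) (B h) - complex_of_real (c r) * cinner (V q) (B h))
        has_integral of_real (c q) * cinner (W q - W p) h - of_real \<theta> * cinner (V q) (B h)) {p..q}"
      by (intro has_integral_diff has_integral_mult_right tau_h sol_W h(1)) (use pq in auto)
    then have "norm (of_real (c q) * cinner (W q - W p) h - of_real \<theta> * cinner (V q) (B h))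
        \<le> (norm (B g) * (L * d\<nu> + K * \<omega>)) * (q - p)"
    proof (rule has_integral_norm_bound)
      show "p \<le> q" by (rule pq(2))
      fix r assume "r \<in> {p..q}"
      then have r: "p \<le> r" "r \<le> q" by auto
      have eq: "of_real (c q) * cinner (V r) (B h) - complex_of_real (c r) * cinner (V q) (B h)
        = of_real (c q - c r) * cinner (V q) (B h) - of_real (c q) * cinner (V q - V r) (B h)"
        by (simp add: cinner_diff_left algebra_simps)
      have 1: "norm (of_real (c q - c r) * cinner (V q) (B h)) \<le> d\<nu> * (L * norm (B g))"
        unfolding norm_mult by (intro mult_mono) (use cr(2)[OF r] CS[of "V q" L] L[of q] pq d\<nu>0 in \<open>auto simp del: of_real_diff\<close>)
      have 2: "norm (of_real (c q) * cinner (V q - V r) (B h)) \<le> K * (\<omega> * norm (B g))"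
        unfolding norm_mult by (intro mult_mono) (use cr(1)[of q] pq CS[of "V q - V r" \<omega>] \<omega>[OF r] K0 in auto)
      show "norm (of_real (c q) * cinner (V r) (B h) - complex_of_real (c r) * cinner (V q) (B h))
          \<le> norm (B g) * (L * d\<nu> + K * \<omega>)"
        unfolding eq using order_trans[OF norm_triangle_ineq4 add_mono[OF 1 2]] by (simp add: algebra_simps)
    qed
    then show ?thesis using pq \<sigma>1 by (simp add: E2_def norm_mult)
  qed
  have E3_n: "norm E3 \<le> (1 + K) * (L * (3 * (K * (q - p))\<^sup>2 * norm (B (B g))))"
  proof -
    have x: "norm (cinner x e) \<le> L * (3 * (K * (q - p))\<^sup>2 * norm (B (B g)))" if "norm x \<le> L" for x
      using order_trans[OF Cauchy_Schwarz_cinner mult_mono[OF that en]] L0 by simp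
    have "norm (\<i> * of_real \<sigma> * of_real (c q) * cinner (W q) e) = \<bar>c q\<bar> * norm (cinner (W q) e)"
      using \<sigma>1 by (simp add: norm_mult)
    also have "\<dots> \<le> K * (L * (3 * (K * (q - p))\<^sup>2 * norm (B (B g))))"
      by (intro mult_mono x) (use cr(1)[of q] L[of q] pq K0 in auto)
    finally have 2: "norm (\<i> * of_real \<sigma> * of_real (c q) * cinner (W q) e) \<le> K * (L * (3 * (K * (q - p))\<^sup>2 * norm (B (B g))))" .
    have 1: "norm (cinner (V q) e) \<le> L * (3 * (K * (q - p))\<^sup>2 * norm (B (B g)))" by (rule x) (use L[of q] pq in auto)
    show ?thesis unfolding E3_def distrib_right mult_1 by (rule order_trans[OF norm_triangle_ineq add_mono[OF 1 2]])
  qed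
  have E5_n: "norm E5 \<le> L * norm g * d\<nu>"
  proof -
    have "norm E5 = \<bar>c q - c p\<bar> * norm (cinner (W p) h)" using \<sigma>1 by (simp add: E5_def norm_mult del: of_real_diff)
    also have "\<dots> \<le> d\<nu> * (L * norm g)"
    proof (intro mult_mono)
      show "norm (cinner (W p) h) \<le> L * norm g"
        using order_trans[OF Cauchy_Schwarz_cinner mult_right_mono[of "norm (W p)" L "norm h"]] L[of p] pq h(5) by simp
    qed (use cr(2)[of p] pq d\<nu>0 in \<open>auto simp del: of_real_diff\<close>)
    finally show ?thesis by (simp add: mult_ac)
  qed
  have \<sigma>c: "complex_of_real \<sigma> * complex_of_real \<sigma> = 1" using \<sigma> by (metis of_real_1 of_real_mult)
  have "cinner (\<phi> \<sigma> q) (U (\<sigma> * \<tau> q) g) - cinner (\<phi> \<sigma> p) (U (\<sigma> * \<tau> p) g) = E1 - Ib + E2 + E3 + E5"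
  proof -
    have t: "complex_of_real (\<sigma> * \<theta>) = of_real \<sigma> * of_real \<theta>" "complex_of_real (c q * \<theta>) = of_real (c q) * of_real \<theta>"
      "complex_of_real (c q - c p) = of_real (c q) - of_real (c p)" by simp_all
    \<comment> \<open>\<open>\<sigma>\<^sup>2 = 1\<close> turns the first-order group term acting on
      \<open>W\<close> into \<open>c q * \<theta>\<close>, which is what the equation for
      \<open>V\<close> cancels.\<close>
    have id: "(v + \<i> * s * cq * w) + ((v1 + \<i> * s * cq * w1) * - (\<i> * s * th)) + (ve + \<i> * s * cq * we) - (vp + \<i> * s * cp * wp)
       = cq * th * w1 + (v - vp) + \<i> * s * (cq * (w - wp) - th * v1) + (ve + \<i> * s * cq * we) + \<i> * s * (cq - cp) * wp"
      if "s * s = 1" for v w v1 w1 ve we vp wp s cq cp th :: complex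
    proof -
      have "\<i> * s * cq * w1 * - (\<i> * s * th) = (s * s) * cq * th * w1" by (simp add: algebra_simps)
      then have "\<i> * s * cq * w1 * - (\<i> * s * th) = cq * th * w1" using that by simp
      then show ?thesis by (simp add: algebra_simps)
    qed
    have "cinner (\<phi> \<sigma> q) (U (\<sigma> * \<tau> q) g) =
        (cinner (V q) h + \<i> * of_real \<sigma> * of_real (c q) * cinner (W q) h)
        + ((cinner (V q) (B h) + \<i> * of_real \<sigma> * of_real (c q) * cinner (W q) (B h)) * - (\<i> * of_real \<sigma> * of_real \<theta>))
        + (cinner (V q) e + \<i> * of_real \<sigma> * of_real (c q) * cinner (W q) e)"
      unfolding hq \<phi>_def by (simp add: cinner_algebra algebra_simps)
    moreover have "cinner (\<phi> \<sigma> p) (U (\<sigma> * \<tau> p) g) = cinner (V p) h + \<i> * of_real \<sigma> * of_real (c p) * cinner (W p) h"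
      unfolding h_def[symmetric] \<phi>_def by (simp add: cinner_algebra)
    ultimately show ?thesis
      unfolding E1_def E2_def E3_def E5_def t cinner_diff_left
      using id[OF \<sigma>c, of "cinner (V q) h" "of_real (c q)" "cinner (W q) h" "cinner (V q) (B h)" "cinner (W q) (B h)" "of_real \<theta>"
          "cinner (V q) e" "cinner (W q) e" "cinner (V p) h" "of_real (c p)" "cinner (W p) h"]
      by simp
  qed
  also have "norm \<dots> \<le> norm E1 + norm Ib + norm E2 + norm E3 + norm E5"
    using norm_triangle_ineq[of "E1 - Ib + E2 + E3" E5] norm_triangle_ineq[of "E1 - Ib + E2" E3]
      norm_triangle_ineq[of "E1 - Ib" E2] norm_triangle_ineq4[of E1 Ib] by linarith
  also have "\<dots> \<le> (K * norm (B g) * (L * d\<nu> + K * \<omega>)) * (q - p) + L * norm g * (\<beta> q - \<beta> p)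
      + (norm (B g) * (L * d\<nu> + K * \<omega>)) * (q - p) + (1 + K) * (L * (3 * (K * (q - p))\<^sup>2 * norm (B (B g)))) + L * norm g * d\<nu>"
    by (intro add_mono E1_n E2_n E3_n E5_n Ib_n)
  also have "\<dots> = L * norm g * (m q - m p)
      + (q - p) * ((K + 1) * norm (B g) * (L * (\<nu> q - \<nu> p) + K * \<omega>) + 3 * L * (1 + K) * K\<^sup>2 * norm (B (B g)) * (q - p))"
    by (simp add: m_def d\<nu>_def algebra_simps power2_eq_square)
  finally show ?thesis .
qed

end

lemma Cauchy_at_top_tendsto:
  fixes f :: "real \<Rightarrow> 'a::banach"
  assumes tail: "\<And>e. 0 < e \<Longrightarrow> \<exists>s. \<forall>p\<ge>s. \<forall>q\<ge>s. norm (f q - f p) < e"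
  shows "\<exists>l. (f \<longlongrightarrow> l) at_top"
proof -
  have "Cauchy (\<lambda>n::nat. f (real n))"
  proof (rule metric_CauchyI)
    fix e :: real assume "0 < e"
    then obtain s where s: "\<forall>p\<ge>s. \<forall>q\<ge>s. norm (f q - f p) < e" using tail by blast
    obtain n0 :: nat where "s \<le> real n0" using real_arch_simple by blast
    then show "\<exists>M. \<forall>m\<ge>M. \<forall>n\<ge>M. dist (f (real m)) (f (real n)) < e"
      using s by (intro exI[of _ n0]) (auto simp: dist_norm)
  qed
  then obtain l where l: "(\<lambda>n::nat. f (real n)) \<longlonglongrightarrow> l" using convergent_eq_Cauchy by blast
  have "(f \<longlongrightarrow> l) at_top"
  proof (rule tendstoI)
    fix e :: real assume e: "0 < e"
    then obtain s where s: "\<forall>p\<ge>s. \<forall>q\<ge>s. norm (f q - f p) < e / 2" using tail[of "e / 2"] by auto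
    have "norm (f t - l) \<le> e / 2" if "s \<le> t" for t
    proof -
      obtain n0 :: nat where n0: "s \<le> real n0" using real_arch_simple by blast
      have lim: "(\<lambda>n::nat. norm (f t - f (real n))) \<longlonglongrightarrow> norm (f t - l)"
        by (intro tendsto_intros l)
      show ?thesis
      proof (rule Lim_bounded[OF lim])
        show "\<forall>n\<ge>n0. norm (f t - f (real n)) \<le> e / 2" using s that n0 by (auto intro: less_imp_le)
      qed
    qed
    then show "eventually (\<lambda>t. dist (f t) l < e) at_top"
      unfolding eventually_at_top_linorder using e by (intro exI[of _ s]) (force simp: dist_norm)
  qed
  then show ?thesis by blast
qed

context wave_solution begin

text \<open>In \<open>cinner (\<psi> \<sigma> r) g\<close> the group moves onto \<open>g\<close>,
  where the regularity of \<open>D2\<close> is available. \<open>increment_bound\<close> sums the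
  local estimates, and density of \<open>D2\<close> gives the norm.\<close>

lemma psi_increment:
  assumes \<sigma>: "\<sigma> * \<sigma> = (1::real)" and st: "0 < s" "s \<le> t"
    and L: "\<And>r. s \<le> r \<Longrightarrow> r \<le> t \<Longrightarrow> norm (V r) \<le> L \<and> norm (W r) \<le> L"
  shows "norm (\<psi> \<sigma> t - \<psi> \<sigma> s) \<le> L * (m t - m s)"
proof (rule norm_le_of_cinner[OF _ D2_dense])
  have L0: "0 \<le> L" using L[of s] st norm_ge_zero order_trans by blast
  show "0 \<le> L * (m t - m s)" using L0 m_mono[OF st] by simp
  fix g assume g: "g \<in> D2"
  define F where "F r = cinner (\<phi> \<sigma> r) (U (\<sigma> * \<tau> r) g)" for r
  have psi_F: "cinner (\<psi> \<sigma> r) g = F r" for r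
    by (simp add: \<psi>_def F_def cinner_U)
  \<comment> \<open>Chosen so that, when length and oscillations are at most \<open>e\<close>, the
    error in \<open>local_estimate\<close> is at most \<open>e\<close> times the increment of
    \<open>Q * (r + \<nu> r)\<close>.\<close>
  define Q where "Q = (K + 1) * norm (B g) * (L + K) + 3 * L * (1 + K) * K\<^sup>2 * norm (B (B g))"
  have K0: "0 \<le> K" using K_pos by simp
  have uc: "uniformly_continuous_on {s..t} V" "uniformly_continuous_on {s..t} W"
    by (intro compact_uniformly_continuous continuous_on_subset[OF V_cont] continuous_on_subset[OF W_cont]; use st in auto)+
  have "norm (F t - F s) \<le> L * norm g * m t - L * norm g * m s"
  proof (rule increment_bound[where \<rho> = "\<lambda>r. Q * (r + \<nu> r)", OF st(2)])
    fix e :: real assume e: "0 < e"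
    obtain d1 where d1: "0 < d1" "\<forall>x\<in>{s..t}. \<forall>x'\<in>{s..t}. dist x' x < d1 \<longrightarrow> dist (V x') (V x) < e"
      using uc(1) e unfolding uniformly_continuous_on_def by blast
    obtain d2 where d2: "0 < d2" "\<forall>x\<in>{s..t}. \<forall>x'\<in>{s..t}. dist x' x < d2 \<longrightarrow> dist (W x') (W x) < e"
      using uc(2) e unfolding uniformly_continuous_on_def by blast
    show "\<exists>\<delta>>0. \<forall>p q. s \<le> p \<and> p \<le> q \<and> q \<le> t \<and> q - p < \<delta> \<longrightarrow>
        norm (F q - F p) \<le> L * norm g * m q - L * norm g * m p + e * (Q * (q + \<nu> q) - Q * (p + \<nu> p))"
    proof (intro exI[of _ "min e (min d1 d2)"] conjI allI impI; (elim conjE)?)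
      show "0 < min e (min d1 d2)" using e d1 d2 by simp
      fix p q assume pq: "s \<le> p" "p \<le> q" "q \<le> t" "q - p < min e (min d1 d2)"
      have \<omega>: "norm (V q - V r) \<le> e \<and> norm (W q - W r) \<le> e" if "p \<le> r" "r \<le> q" for r
      proof -
        have "r \<in> {s..t}" "q \<in> {s..t}" "dist q r < d1" "dist q r < d2" using that pq by (auto simp: dist_real_def)
        then have "dist (V q) (V r) < e" "dist (W q) (W r) < e" using d1(2) d2(2) by blast+
        then show ?thesis by (simp add: dist_norm)
      qed
      define d where "d = q - p"
      define n where "n = \<nu> q - \<nu> p"
      have d: "0 \<le> d" "d \<le> e" using pq by (auto simp: d_def)
      have n: "0 \<le> n" using nu_mono[of p q] pq st by (simp add: n_def)
      have "norm (F q - F p) \<le> L * norm g * (m q - m p)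
          + d * ((K + 1) * norm (B g) * (L * n + K * e) + 3 * L * (1 + K) * K\<^sup>2 * norm (B (B g)) * d)"
        unfolding F_def d_def n_def by (rule local_estimate[OF \<sigma> g]) (use \<omega> L pq st in auto)
      also have "d * ((K + 1) * norm (B g) * (L * n + K * e) + 3 * L * (1 + K) * K\<^sup>2 * norm (B (B g)) * d)
          \<le> e * (Q * (d + n))"
      proof -
        define X where "X = (K + 1) * norm (B g)"
        define Y where "Y = 3 * L * (1 + K) * K\<^sup>2 * norm (B (B g))"
        have Q: "Q = X * (L + K) + Y" by (simp add: Q_def X_def Y_def)
        have X: "0 \<le> X" and Y: "0 \<le> Y" using K0 L0 by (simp_all add: X_def Y_def)
        have 1: "d * (L * n) \<le> e * ((L + K) * n)"
          using mult_mono[OF d(2) mult_right_mono[of L "L + K" n]] n e L0 K0 by simp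
        have 2: "d * (K * e) \<le> e * ((L + K) * d)"
        proof -
          have "K * (d * e) \<le> (L + K) * (d * e)" using L0 d e by (intro mult_right_mono) auto
          then show ?thesis by (simp add: mult_ac)
        qed
        have 3: "d * d \<le> e * (d + n)" using mult_mono[OF d(2), of d "d + n"] d n e by simp
        have "d * (X * (L * n + K * e) + Y * d) = X * (d * (L * n) + d * (K * e)) + Y * (d * d)" by (simp add: algebra_simps)
        also have "\<dots> \<le> X * (e * ((L + K) * n) + e * ((L + K) * d)) + Y * (e * (d + n))"
          using 1 2 3 X Y by (intro add_mono mult_left_mono) auto
        also have "\<dots> = e * (Q * (d + n))" by (simp add: Q algebra_simps)
        finally show ?thesis by (simp add: X_def Y_def)
      qed
      finally show "norm (F q - F p) \<le> L * norm g * m q - L * norm g * m p + e * (Q * (q + \<nu> q) - Q * (p + \<nu> p))"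
        by (simp add: d_def n_def algebra_simps)
    qed
  qed
  then show "cmod (cinner (\<psi> \<sigma> t - \<psi> \<sigma> s) g) \<le> L * (m t - m s) * norm g"
    by (simp add: cinner_diff_left psi_F algebra_simps)
qed

section \<open>Energy bounds forward and backward in time\<close>

definition N where "N t = norm (V t) + norm (W t)"

lemma N_nonneg: "0 \<le> N t" by (simp add: N_def)

lemma N_cont: "continuous_on {0..} N"
  unfolding N_def by (intro continuous_intros V_cont W_cont)

lemma psi_norm: "norm (\<psi> \<sigma> t) = norm (\<phi> \<sigma> t)"
  by (simp add: \<psi>_def U_simps)

lemma V_phi: "V t = (1/2) *\<^sub>R (\<phi> 1 t + \<phi> (-1) t)"
  by (simp add: \<phi>_def scaleR_add_right flip: scaleR_add_left)

lemma W_phi: "0 < t \<Longrightarrow> W t = (1 / (2 * \<i> * of_real (c t))) *\<^sub>C (\<phi> 1 t - \<phi> (-1) t)"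
proof -
  assume t: "0 < t"
  have "\<phi> 1 t - \<phi> (-1) t = (2 * \<i> * of_real (c t)) *\<^sub>C W t"
    by (simp add: \<phi>_def scaleC_add_left[symmetric] mult.assoc flip: mult_2)
  moreover have "c t \<noteq> 0" using c_lower[OF t] kappa by simp
  ultimately show ?thesis by (simp add: scaleC_scaleC)
qed

lemma psi_le_N: "0 < t \<Longrightarrow> \<bar>\<sigma>\<bar> = 1 \<Longrightarrow> norm (\<psi> \<sigma> t) \<le> (1 + K) * N t"
proof -
  assume t: "0 < t" and \<sigma>: "\<bar>\<sigma>\<bar> = 1"
  have "norm (\<psi> \<sigma> t) \<le> norm (V t) + norm ((\<i> * of_real \<sigma> * of_real (c t)) *\<^sub>C W t)"
    unfolding psi_norm \<phi>_def by (rule norm_triangle_ineq)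
  also have "norm ((\<i> * of_real \<sigma> * of_real (c t)) *\<^sub>C W t) = \<bar>c t\<bar> * norm (W t)"
    using \<sigma> by (simp add: norm_scaleC norm_mult)
  also have "norm (V t) + \<bar>c t\<bar> * norm (W t) \<le> (1 + K) * norm (V t) + (1 + K) * norm (W t)"
    using c_abs[OF t] K_pos by (intro add_mono mult_right_mono) (auto simp: mult_le_cancel_right1 intro: order_trans)
  finally show ?thesis by (simp add: N_def distrib_left)
qed

text \<open>With \<open>psi_le_N\<close> this makes \<open>N\<close> equivalent to the size of the
  pair of \<open>\<psi>\<close>. The lower bound \<open>\<kappa>\<close> enters when
  \<open>W\<close> is recovered from \<open>\<phi> 1 - \<phi> (-1)\<close>.\<close>

lemma N_le_psi: "0 < t \<Longrightarrow> N t \<le> (1 + 1 / \<kappa>) * (norm (\<psi> 1 t) + norm (\<psi> (-1) t)) / 2"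
proof -
  assume t: "0 < t"
  let ?S = "norm (\<phi> 1 t) + norm (\<phi> (-1) t)"
  have c: "0 < c t" "\<kappa> \<le> c t" using c_lower[OF t] kappa by auto
  have "norm (V t) = norm (\<phi> 1 t + \<phi> (-1) t) / 2" by (subst V_phi) simp
  also have "\<dots> \<le> ?S / 2" by (rule divide_right_mono[OF norm_triangle_ineq]) simp
  finally have "norm (V t) \<le> ?S / 2" .
  moreover have "norm (W t) \<le> (1 / \<kappa>) * ?S / 2"
  proof -
    have "norm (W t) = (1 / c t) * norm (\<phi> 1 t - \<phi> (-1) t) / 2"
      unfolding W_phi[OF t] using c by (simp add: norm_scaleC norm_divide norm_mult)
    also have "\<dots> \<le> (1 / \<kappa>) * ?S / 2"
      using c kappa norm_triangle_ineq4[of "\<phi> 1 t" "\<phi> (-1) t"]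
      by (intro divide_right_mono mult_mono) (auto simp: frac_le)
    finally show ?thesis .
  qed
  ultimately show ?thesis unfolding psi_norm N_def by (simp add: distrib_right add_divide_distrib)
qed

text \<open>\<open>K1\<close> is the cost of passing from \<open>N\<close> to \<open>\<psi>\<close>
  and back, \<open>K2\<close> that of the way back.\<close>

definition K1 where "K1 = (1 + 1 / \<kappa>) * (1 + K)"
definition K2 where "K2 = 1 + 1 / \<kappa>"

lemma K2_pos: "0 < K2"
  using kappa by (simp add: K2_def add_pos_pos)

text \<open>The increment estimate is symmetric in its two end points, so the energy at either end
  controls the other. The backward inequality is the source of uniqueness from infinity.\<close>

lemma N_step:
  assumes st: "0 < s" "s \<le> t" and L: "\<And>r. s \<le> r \<Longrightarrow> r \<le> t \<Longrightarrow> N r \<le> L"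
  shows "N t \<le> K1 * N s + K2 * L * (m t - m s)" "N s \<le> K1 * N t + K2 * L * (m t - m s)"
proof -
  have L': "norm (V r) \<le> L \<and> norm (W r) \<le> L" if "s \<le> r" "r \<le> t" for r
    using L[OF that] norm_ge_zero[of "V r"] norm_ge_zero[of "W r"] unfolding N_def by linarith
  have d: "norm (\<psi> \<sigma> t - \<psi> \<sigma> s) \<le> L * (m t - m s)" if "\<sigma> * \<sigma> = 1" for \<sigma>
    by (rule psi_increment[OF that st L'])
  have gen: "N q \<le> K1 * N p + K2 * L * (m t - m s)" if pq: "0 < p" "0 < q"
    and dd: "\<And>\<sigma>. \<sigma> * \<sigma> = 1 \<Longrightarrow> norm (\<psi> \<sigma> q) \<le> norm (\<psi> \<sigma> p) + L * (m t - m s)" for p q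
  proof -
    have "N q \<le> K2 * (norm (\<psi> 1 q) + norm (\<psi> (-1) q)) / 2" unfolding K2_def by (rule N_le_psi[OF pq(2)])
    also have "\<dots> \<le> K2 * (((1 + K) * N p + L * (m t - m s)) + ((1 + K) * N p + L * (m t - m s))) / 2"
      using dd[of 1] dd[of "-1"] psi_le_N[OF pq(1), of 1] psi_le_N[OF pq(1), of "-1"] K2_pos
      by (intro divide_right_mono mult_left_mono add_mono) auto
    also have "\<dots> = K2 * ((1 + K) * N p + L * (m t - m s))" by simp
    also have "\<dots> = K1 * N p + K2 * L * (m t - m s)"
    proof -
      have "K1 = K2 * (1 + K)" by (simp add: K1_def K2_def)
      then show ?thesis by (simp add: algebra_simps)
    qed
    finally show ?thesis .
  qed
  show "N t \<le> K1 * N s + K2 * L * (m t - m s)"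
  proof (rule gen)
    fix \<sigma> :: real assume "\<sigma> * \<sigma> = 1"
    from d[OF this] show "norm (\<psi> \<sigma> t) \<le> norm (\<psi> \<sigma> s) + L * (m t - m s)"
      using norm_triangle_ineq2[of "\<psi> \<sigma> t" "\<psi> \<sigma> s"] by linarith
  qed (use st in auto)
  show "N s \<le> K1 * N t + K2 * L * (m t - m s)"
  proof (rule gen)
    fix \<sigma> :: real assume "\<sigma> * \<sigma> = 1"
    from d[OF this] show "norm (\<psi> \<sigma> s) \<le> norm (\<psi> \<sigma> t) + L * (m t - m s)"
      using norm_triangle_ineq2[of "\<psi> \<sigma> s" "\<psi> \<sigma> t"] by (simp add: norm_minus_commute)
  qed (use st in auto)
qed

text \<open>At a maximum point of \<open>N\<close> the error term is at most half of the maximum and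
  is absorbed. This replaces a Gronwall argument and explains the factor 2.\<close>

lemma N_control:
  assumes st: "0 < s" "s \<le> t" and small: "K2 * (m t - m s) \<le> 1 / 2" and r: "s \<le> r" "r \<le> t"
  shows "N r \<le> 2 * K1 * N s" "N r \<le> 2 * K1 * N t"
proof -
  have "continuous_on {s..t} N" by (rule continuous_on_subset[OF N_cont]) (use st in auto)
  then obtain q where q: "q \<in> {s..t}" "\<And>r. r \<in> {s..t} \<Longrightarrow> N r \<le> N q"
    using continuous_attains_sup[of "{s..t}" N] st by auto
  have *: "K2 * N q * (m y - m x) \<le> N q / 2" if "s \<le> x" "x \<le> y" "y \<le> t" for x y
  proof -
    have "m y - m x \<le> m t - m s" using m_mono[of s x] m_mono[of y t] that st by simp
    then have "K2 * (m y - m x) \<le> 1 / 2" using small K2_pos by (meson less_imp_le mult_left_mono order_trans)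
    from mult_right_mono[OF this N_nonneg[of q]] show ?thesis by (simp add: mult_ac)
  qed
  have "N q \<le> K1 * N s + K2 * N q * (m q - m s)" by (rule N_step(1)) (use q st in auto)
  then have "N q \<le> 2 * K1 * N s" using *[of s q] q(1) by simp
  then show "N r \<le> 2 * K1 * N s" using q(2)[of r] r by simp
  have "N q \<le> K1 * N t + K2 * N q * (m t - m q)" by (rule N_step(2)) (use q st in auto)
  then have "N q \<le> 2 * K1 * N t" using *[of q t] q(1) by simp
  then show "N r \<le> 2 * K1 * N t" using q(2)[of r] r by simp
qed

lemma small_exists: "0 < 1 / (2 * K2)" using K2_pos by simp

text \<open>Beyond some time \<open>s\<close> the remaining increment of \<open>m\<close> is small
  enough for \<open>N_control\<close>; up to \<open>s\<close> compactness suffices.\<close>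

lemma N_bounded: "\<exists>L. \<forall>t\<ge>0. N t \<le> L"
proof -
  obtain s where s: "0 < s" "\<And>p q. s \<le> p \<Longrightarrow> p \<le> q \<Longrightarrow> m q - m p \<le> 1 / (2 * K2)" using m_tail[OF small_exists] by blast
  have "continuous_on {0..s} N" by (rule continuous_on_subset[OF N_cont]) auto
  then have "bounded (N ` {0..s})" by (intro compact_imp_bounded compact_continuous_image) auto
  then obtain L where L: "\<And>t. 0 \<le> t \<Longrightarrow> t \<le> s \<Longrightarrow> N t \<le> L"
    unfolding bounded_iff by (metis abs_le_D1 atLeastAtMost_iff imageI real_norm_def)
  have "N t \<le> max L (2 * K1 * N s)" if t: "0 \<le> t" for t
  proof (cases "t \<le> s")
    case False
    have "K2 * (m t - m s) \<le> 1 / 2" using s(2)[of s t] False K2_pos by (simp add: field_simps)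
    then show ?thesis using N_control(1)[of s t t] s(1) False by simp
  qed (use L t in \<open>simp add: max.coboundedI1\<close>)
  then show ?thesis by blast
qed

text \<open>Far out, \<open>N s\<close> is bounded by a fixed multiple of every later
  \<open>N t\<close>, so it is zero. Vanishing then propagates back to time 0: just left of the
  infimum \<open>s0\<close> of the times after which \<open>N\<close> is zero, \<open>m\<close> has
  small increments, and \<open>N_control\<close> would push \<open>s0\<close> further left.\<close>

lemma N_vanishes:
  assumes "(N \<longlongrightarrow> 0) at_top"
  shows "\<forall>t\<ge>0. N t = 0"
proof -
  obtain s1 where s1: "0 < s1" "\<And>p q. s1 \<le> p \<Longrightarrow> p \<le> q \<Longrightarrow> m q - m p \<le> 1 / (2 * K2)" using m_tail[OF small_exists] by blast
  have far: "N s = 0" if "s1 \<le> s" for s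
  proof -
    have "N s \<le> 2 * K1 * N t" if "s \<le> t" for t
    proof (rule N_control(2))
      show "K2 * (m t - m s) \<le> 1 / 2" using s1(2)[of s t] \<open>s1 \<le> s\<close> that K2_pos by (simp add: field_simps)
    qed (use s1(1) \<open>s1 \<le> s\<close> that in auto)
    then have "eventually (\<lambda>t. N s \<le> 2 * K1 * N t) at_top" by (auto simp: eventually_at_top_linorder)
    moreover have "((\<lambda>t. 2 * K1 * N t) \<longlongrightarrow> 2 * K1 * 0) at_top" by (intro tendsto_intros assms)
    ultimately have "N s \<le> 2 * K1 * 0" by (intro tendsto_lowerbound) auto
    then show ?thesis using N_nonneg[of s] by simp
  qed
  define S where "S = {s. 0 \<le> s \<and> (\<forall>t\<ge>s. N t = 0)}"
  have S: "s1 \<in> S" "bdd_below S" using far s1(1) by (auto simp: S_def intro: bdd_belowI[of _ 0])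
  define s0 where "s0 = Inf S"
  have s0: "0 \<le> s0" unfolding s0_def using S by (intro cInf_greatest) (auto simp: S_def)
  have above: "N t = 0" if t: "s0 < t" for t
  proof -
    obtain s where "s \<in> S" "s < t" using t S unfolding s0_def by (metis cInf_less_iff empty_iff)
    then show ?thesis by (auto simp: S_def)
  qed
  have at0: "N s0 = 0"
  proof -
    have "(N \<longlongrightarrow> N s0) (at s0 within {0..})" using N_cont s0 by (auto simp: continuous_on_def)
    then have "(N \<longlongrightarrow> N s0) (at_right s0)" by (rule tendsto_within_subset) (use s0 in auto)
    moreover have "(N \<longlongrightarrow> 0) (at_right s0)"
      by (rule tendsto_eventually) (use above in \<open>auto simp: eventually_at_filter\<close>)
    ultimately show ?thesis by (rule tendsto_unique[rotated]) simp
  qed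
  have "s0 = 0"
  proof (rule ccontr)
    assume "s0 \<noteq> 0"
    then have p: "0 < s0" using s0 by simp
    obtain s where s: "0 < s" "s < s0" "\<And>p q. s \<le> p \<Longrightarrow> p \<le> q \<Longrightarrow> q < s0 \<Longrightarrow> m q - m p \<le> 1 / (2 * K2)"
      using m_left[OF small_exists p] by blast
    have zero: "N r = 0" if r: "s \<le> r" "r < s0" for r
    proof -
      have le: "N r \<le> 2 * K1 * N t" if "r \<le> t" "t < s0" for t
      proof (rule N_control(2))
        show "K2 * (m t - m r) \<le> 1 / 2" using s(3)[of r t] r that K2_pos by (simp add: field_simps)
      qed (use s(1) r that in auto)
      \<comment> \<open>\<open>N\<close> is continuous even where \<open>c\<close> jumps, so
        \<open>t\<close> may tend to \<open>s0\<close> from the left although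
        \<open>N_control\<close> is applied strictly before \<open>s0\<close>.\<close>
      have "(N \<longlongrightarrow> N s0) (at s0 within {0..})" using N_cont s0 by (auto simp: continuous_on_def)
      then have "(N \<longlongrightarrow> 0) (at s0 within {r<..<s0})" unfolding at0 by (rule tendsto_within_subset) (use s(1) r in auto)
      then have "((\<lambda>t. 2 * K1 * N t) \<longlongrightarrow> 2 * K1 * 0) (at s0 within {r<..<s0})" by (intro tendsto_intros)
      moreover have "eventually (\<lambda>t. N r \<le> 2 * K1 * N t) (at s0 within {r<..<s0})"
        using le by (auto simp: eventually_at_filter)
      moreover have "at s0 within {r<..<s0} \<noteq> bot" using r by (simp add: at_within_eq_bot_iff)
      ultimately have "N r \<le> 2 * K1 * 0" by (intro tendsto_lowerbound)
      then show ?thesis using N_nonneg[of r] by simp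
    qed
    have "s \<in> S" using zero above at0 s(1) by (auto simp: S_def) (metis linorder_cases)
    then have "s0 \<le> s" unfolding s0_def by (rule cInf_lower[OF _ S(2)])
    then show False using s(2) by simp
  qed
  then show ?thesis using above at0 by (metis order_le_less)
qed

lemma psi_limit:
  assumes \<sigma>: "\<sigma> * \<sigma> = (1::real)"
  shows "\<exists>\<zeta>. ((\<lambda>t. \<psi> \<sigma> t) \<longlongrightarrow> \<zeta>) at_top"
proof -
  obtain L where L: "\<And>t. 0 \<le> t \<Longrightarrow> N t \<le> L" using N_bounded by blast
  have L': "norm (V r) \<le> L \<and> norm (W r) \<le> L" if "0 \<le> r" for r
    using L[OF that] norm_ge_zero[of "V r"] norm_ge_zero[of "W r"] unfolding N_def by linarith
  have L0: "0 \<le> L" using L[of 0] N_nonneg[of 0] by simp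
  show ?thesis
  proof (rule Cauchy_at_top_tendsto)
    fix e :: real assume e: "0 < e"
    have "0 < e / (L + 1)" using e L0 by simp
    then obtain s where s: "0 < s" "\<And>p q. s \<le> p \<Longrightarrow> p \<le> q \<Longrightarrow> m q - m p \<le> e / (L + 1)" using m_tail by blast
    have le: "norm (\<psi> \<sigma> q - \<psi> \<sigma> p) < e" if pq: "s \<le> p" "p \<le> q" for p q
    proof -
      have "norm (\<psi> \<sigma> q - \<psi> \<sigma> p) \<le> L * (m q - m p)" by (rule psi_increment[OF \<sigma>]) (use L' s(1) pq in auto)
      also have "\<dots> \<le> L * (e / (L + 1))" by (intro mult_left_mono s pq L0)
      also have "\<dots> < e" using e L0 by (simp add: field_simps)
      finally show ?thesis .
    qed
    have "norm (\<psi> \<sigma> q - \<psi> \<sigma> p) < e" if "s \<le> p" "s \<le> q" for p q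
      using le[of p q] le[of q p] that by (cases "p \<le> q") (auto simp: norm_minus_commute)
    then show "\<exists>s. \<forall>p\<ge>s. \<forall>q\<ge>s. norm (\<psi> \<sigma> q - \<psi> \<sigma> p) < e" by blast
  qed
qed

lemma N_vanishes_of_psi:
  assumes "((\<lambda>t. \<psi> 1 t) \<longlongrightarrow> 0) at_top" "((\<lambda>t. \<psi> (-1) t) \<longlongrightarrow> 0) at_top"
  shows "\<forall>t\<ge>0. V t = 0 \<and> W t = 0"
proof -
  have "((\<lambda>t. (1 + 1 / \<kappa>) * (norm (\<psi> 1 t) + norm (\<psi> (-1) t)) / 2) \<longlongrightarrow> (1 + 1 / \<kappa>) * (norm (0::'h) + norm (0::'h)) / 2) at_top"
    by (intro tendsto_intros assms) simp
  then have lim: "((\<lambda>t. (1 + 1 / \<kappa>) * (norm (\<psi> 1 t) + norm (\<psi> (-1) t)) / 2) \<longlongrightarrow> 0) at_top" by simp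
  have "eventually (\<lambda>t. N t \<le> (1 + 1 / \<kappa>) * (norm (\<psi> 1 t) + norm (\<psi> (-1) t)) / 2) at_top"
    using eventually_gt_at_top[of 0] by eventually_elim (rule N_le_psi)
  from tendsto_sandwich[OF always_eventually this tendsto_const lim] have "(N \<longlongrightarrow> 0) at_top"
    by (simp add: N_nonneg)
  from N_vanishes[OF this] show ?thesis by (auto simp: N_def add_nonneg_eq_0_iff)
qed

end

section \<open>Asymptotic behaviour\<close>

text \<open>Asymptotic slope \<open>k\<close>, uniformly over bounded time windows. It is weaker
  than convergence of \<open>\<theta> t - k t\<close> and follows from mere convergence of
  \<open>c\<close>.\<close>

definition drift :: "(real \<Rightarrow> real) \<Rightarrow> real \<Rightarrow> bool" where
  "drift \<theta> k \<longleftrightarrow> (\<forall>R>0. \<forall>e>0. \<exists>T. \<forall>t\<ge>T. \<forall>r. 0 \<le> r \<and> r \<le> R \<longrightarrow> \<bar>\<theta> (t + r) - \<theta> t - k * r\<bar> \<le> e)"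

lemma driftD:
  assumes "drift \<theta> k" "0 < R" "0 < e"
  obtains T where "\<And>t r. T \<le> t \<Longrightarrow> 0 \<le> r \<Longrightarrow> r \<le> R \<Longrightarrow> \<bar>\<theta> (t + r) - \<theta> t - k * r\<bar> \<le> e"
proof -
  from assms(1)[unfolded drift_def, THEN spec, THEN mp, OF assms(2), THEN spec, THEN mp, OF assms(3)]
  obtain T where "\<forall>t\<ge>T. \<forall>r. 0 \<le> r \<and> r \<le> R \<longrightarrow> \<bar>\<theta> (t + r) - \<theta> t - k * r\<bar> \<le> e" ..
  then show thesis by (intro that[of T]) simp
qed

context sa_operator begin

text \<open>Pairing with a vector \<open>B g\<close> from the range of \<open>B\<close> gives the
  integrand a primitive that stays bounded in \<open>r\<close>.\<close>

lemma cinner_U_deriv: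
  assumes g: "g \<in> D" and k: "k \<noteq> 0"
  shows "((\<lambda>r. cinner p (U (- k * r) g) / (\<i> * of_real k)) has_vector_derivative cinner (U (k * r) p) (B g)) (at r within S)"
proof -
  have "((\<lambda>r. - k * r) has_vector_derivative - k) (at r)" by (auto intro!: derivative_eq_intros)
  from vector_diff_chain_at[OF this U_deriv[OF g]]
  have "((\<lambda>r. U (- k * r) g) has_vector_derivative (- k) *\<^sub>R \<i> *\<^sub>C U (- k * r) (B g)) (at r)"
    by (simp add: o_def)
  from bounded_linear.has_vector_derivative[OF bounded_bilinear.bounded_linear_right[OF bounded_bilinear_cinner] this, of p]
  have "((\<lambda>r. (1 / (\<i> * of_real k)) * cinner p (U (- k * r) g)) has_vector_derivative
      (1 / (\<i> * of_real k)) * cinner p ((- k) *\<^sub>R \<i> *\<^sub>C U (- k * r) (B g))) (at r)"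
    by (rule has_vector_derivative_mult_right)
  moreover have "(1 / (\<i> * of_real k)) * cinner p ((- k) *\<^sub>R \<i> *\<^sub>C U (- k * r) (B g)) = cinner (U (k * r) p) (B g)"
    using k by (simp add: cinner_algebra cinner_U)
  ultimately show ?thesis by (simp add: has_vector_derivative_at_within)
qed

text \<open>Replacing \<open>t\<close> by \<open>t + r\<close> turns the limit into a statement about \<open>U (k1 r) p + U (k2 r) q\<close>, whose
  integral over \<open>r \<in> [0, R]\<close> against a vector in the range of \<open>B\<close> is bounded independently of \<open>R\<close>.\<close>

lemma oscillating_limit_zero:
  assumes d1: "drift \<theta>1 k1" and d2: "drift \<theta>2 k2" and k: "k1 \<noteq> 0" "k2 \<noteq> 0"
    and lim: "((\<lambda>t. U (\<theta>1 t) p0 + U (\<theta>2 t) q0) \<longlongrightarrow> z) at_top"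
    and inj: "\<And>x. x \<in> D \<Longrightarrow> B x = 0 \<Longrightarrow> x = 0"
  shows "z = 0"
proof -
  have "cinner z (B \<eta>) = 0" if \<eta>: "\<eta> \<in> D" for \<eta>
  proof -
    have "cmod (cinner z (B \<eta>)) \<le> 0 + e" if e: "0 < e" for e
    proof -
      \<comment> \<open>\<open>Q\<close> bounds the primitive at all times; \<open>R\<close> is so
        long that the two boundary terms cost at most \<open>e / 2\<close> per unit of time.\<close>
      define Q where "Q = norm p0 * norm \<eta> / \<bar>k1\<bar> + norm q0 * norm \<eta> / \<bar>k2\<bar>"
      have Q: "0 \<le> Q" by (simp add: Q_def)
      define R where "R = 4 * Q / e + 1"
      have R: "0 < R" "2 * Q \<le> e / 2 * R" using Q e by (simp_all add: R_def add_nonneg_pos field_simps)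
      define e1 where "e1 = e / (2 * (norm (B \<eta>) + 1))"
      have e1: "0 < e1" "e1 * norm (B \<eta>) \<le> e / 2"
      proof -
        have n: "0 < norm (B \<eta>) + 1" by (simp add: add_nonneg_pos)
        then show "0 < e1" using e by (simp add: e1_def)
        have "e1 * norm (B \<eta>) \<le> e1 * (norm (B \<eta>) + 1)" using \<open>0 < e1\<close> by simp
        also have "\<dots> = e / 2" using n by (simp add: e1_def field_simps)
        finally show "e1 * norm (B \<eta>) \<le> e / 2" .
      qed
      have near: "\<exists>d>0. \<forall>s. \<bar>s\<bar> \<le> d \<longrightarrow> norm (U s x - x) \<le> e1 / 3" for x
      proof -
        have "eventually (\<lambda>s. dist (U s x) x < e1 / 3) (at 0)" by (rule tendstoD[OF U_tendsto_0]) (use e1 in simp)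
        then obtain d where d: "0 < d" "\<And>s. s \<noteq> 0 \<Longrightarrow> dist s 0 < d \<Longrightarrow> dist (U s x) x < e1 / 3"
          unfolding eventually_at by blast
        have "norm (U s x - x) \<le> e1 / 3" if "\<bar>s\<bar> \<le> d / 2" for s
        proof (cases "s = 0")
          case False
          then show ?thesis using d(2)[of s] d(1) that by (simp add: dist_norm)
        qed (use e1 in simp)
        then show ?thesis using d(1) by (intro exI[of _ "d / 2"]) simp
      qed
      obtain a1 where a1: "0 < a1" "\<And>s. \<bar>s\<bar> \<le> a1 \<Longrightarrow> norm (U s p0 - p0) \<le> e1 / 3" using near by blast
      obtain a2 where a2: "0 < a2" "\<And>s. \<bar>s\<bar> \<le> a2 \<Longrightarrow> norm (U s q0 - q0) \<le> e1 / 3" using near by blast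
      obtain T1 where T1: "\<And>t r. T1 \<le> t \<Longrightarrow> 0 \<le> r \<Longrightarrow> r \<le> R \<Longrightarrow> \<bar>\<theta>1 (t + r) - \<theta>1 t - k1 * r\<bar> \<le> a1"
        using driftD[OF d1 R(1) a1(1)] by blast
      obtain T2 where T2: "\<And>t r. T2 \<le> t \<Longrightarrow> 0 \<le> r \<Longrightarrow> r \<le> R \<Longrightarrow> \<bar>\<theta>2 (t + r) - \<theta>2 t - k2 * r\<bar> \<le> a2"
        using driftD[OF d2 R(1) a2(1)] by blast
      have "eventually (\<lambda>t. dist (U (\<theta>1 t) p0 + U (\<theta>2 t) q0) z < e1 / 3) at_top" by (rule tendstoD[OF lim]) (use e1 in simp)
      then obtain T3 where T3: "\<And>t. T3 \<le> t \<Longrightarrow> dist (U (\<theta>1 t) p0 + U (\<theta>2 t) q0) z < e1 / 3"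
        unfolding eventually_at_top_linorder by blast
      define t where "t = max T1 (max T2 T3)"
      have tT: "T1 \<le> t" "T2 \<le> t" "T3 \<le> t" by (auto simp: t_def)
      define p where "p = U (\<theta>1 t) p0"
      define q where "q = U (\<theta>2 t) q0"
      \<comment> \<open>Isometry reduces the difference of two phases to a small time acting on the
        fixed vector \<open>x\<close>, so the bound does not depend on \<open>t\<close>.\<close>
      have shift: "norm (U (k * r) (U (\<theta> t) x) - U (\<theta> (t + r)) x) \<le> e1 / 3"
        if "\<And>s. \<bar>s\<bar> \<le> a \<Longrightarrow> norm (U s x - x) \<le> e1 / 3" "\<bar>\<theta> (t + r) - \<theta> t - k * r\<bar> \<le> a" for k \<theta> x a r
      proof -
        have eq: "U (k * r) (U (\<theta> t) x) - U (\<theta> (t + r)) x = - U (k * r + \<theta> t) (U (\<theta> (t + r) - \<theta> t - k * r) x - x)"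
          by (simp add: U_simps U_add)
        show ?thesis unfolding eq norm_minus_cancel U_simps(3) by (rule that(1)[OF that(2)])
      qed
      have close: "norm (U (k1 * r) p + U (k2 * r) q - z) \<le> e1" if r: "0 \<le> r" "r \<le> R" for r
      proof -
        have 1: "norm (U (k1 * r) p - U (\<theta>1 (t + r)) p0) \<le> e1 / 3"
          unfolding p_def by (rule shift[OF a1(2) T1[OF tT(1) r]])
        have 2: "norm (U (k2 * r) q - U (\<theta>2 (t + r)) q0) \<le> e1 / 3"
          unfolding q_def by (rule shift[OF a2(2) T2[OF tT(2) r]])
        have 3: "norm (U (\<theta>1 (t + r)) p0 + U (\<theta>2 (t + r)) q0 - z) \<le> e1 / 3"
          using T3[of "t + r"] r tT(3) by (simp add: dist_norm)
        have eq: "U (k1 * r) p + U (k2 * r) q - z = (U (k1 * r) p - U (\<theta>1 (t + r)) p0)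
          + (U (k2 * r) q - U (\<theta>2 (t + r)) q0) + (U (\<theta>1 (t + r)) p0 + U (\<theta>2 (t + r)) q0 - z)" by simp
        show ?thesis unfolding eq
          by (rule order_trans[OF norm_triangle_le[OF add_mono[OF norm_triangle_le[OF add_mono[OF 1 2]] 3]]]) simp
      qed
      define G where "G r = cinner p (U (- k1 * r) \<eta>) / (\<i> * of_real k1) + cinner q (U (- k2 * r) \<eta>) / (\<i> * of_real k2)" for r
      have "((\<lambda>r. cinner (U (k1 * r) p) (B \<eta>) + cinner (U (k2 * r) q) (B \<eta>)) has_integral G R - G 0) {0..R}"
        by (rule fundamental_theorem_of_calculus)
          (use R(1) in \<open>auto simp: G_def[abs_def] intro!: has_vector_derivative_add cinner_U_deriv[OF \<eta>, unfolded minus_mult_left[symmetric]] k simp del: mult_minus_left\<close>)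
      from has_integral_diff[OF this has_integral_const_real[of "cinner z (B \<eta>)" 0 R]]
      have "((\<lambda>r. cinner (U (k1 * r) p + U (k2 * r) q - z) (B \<eta>)) has_integral (G R - G 0) - R * cinner z (B \<eta>)) {0..R}"
        using R(1) by (simp add: cinner_algebra scaleR_conv_of_real)
      then have "norm ((G R - G 0) - R * cinner z (B \<eta>)) \<le> e1 * norm (B \<eta>) * (R - 0)"
      proof (rule has_integral_norm_bound)
        fix r assume "r \<in> {0..R}"
        then show "norm (cinner (U (k1 * r) p + U (k2 * r) q - z) (B \<eta>)) \<le> e1 * norm (B \<eta>)"
          using order_trans[OF Cauchy_Schwarz_cinner mult_right_mono[OF close[of r]]] by simp
      qed (use R(1) in simp)
      moreover have "norm (R * cinner z (B \<eta>)) \<le> norm ((G R - G 0) - R * cinner z (B \<eta>)) + norm (G R) + norm (G 0)"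
        using norm_triangle_ineq4[of "G R - G 0" "(G R - G 0) - R * cinner z (B \<eta>)"] norm_triangle_ineq4[of "G R" "G 0"] by simp
      moreover have "norm (G r) \<le> Q" for r
      proof -
        have *: "norm (cinner x (U (- k * r) \<eta>) / (\<i> * of_real k)) \<le> norm x * norm \<eta> / \<bar>k\<bar>" for x k
          using Cauchy_Schwarz_cinner[of x "U (- k * r) \<eta>"] by (simp add: norm_divide norm_mult U_simps divide_right_mono)
        show ?thesis unfolding G_def Q_def
          using add_mono[OF *[of p k1] *[of q k2]] by (intro order_trans[OF norm_triangle_ineq]) (simp add: p_def q_def U_simps)
      qed
      note this[of R] this[of 0]
      ultimately have "R * cmod (cinner z (B \<eta>)) \<le> e1 * norm (B \<eta>) * R + 2 * Q"
        using R(1) by (simp add: norm_mult)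
      also have "\<dots> \<le> e / 2 * R + e / 2 * R" using e1(2) R by (intro add_mono mult_right_mono) auto
      also have "\<dots> = R * e" by simp
      finally show ?thesis using R(1) by simp
    qed
    then have "cmod (cinner z (B \<eta>)) \<le> 0" by (rule field_le_epsilon)
    then show ?thesis by simp
  qed
  \<comment> \<open>Orthogonality to the range of \<open>B\<close> puts \<open>z\<close> into the
    kernel of \<open>B\<close>.\<close>
  then have "cinner (B \<eta>) z = cinner \<eta> 0" if "\<eta> \<in> D" for \<eta>
    using that cinner_commute[of "B \<eta>" z] by simp
  then have "z \<in> D \<and> B z = 0" by (rule maximal)
  then show ?thesis using inj by blast
qed

text \<open>The integral of \<open>U r z\<close> over \<open>0 \<le> r \<le> \<delta>\<close> is
  \<open>\<delta> z\<close>. By \<open>integral_U\<close> it lies in \<open>D\<close>, and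
  \<open>B\<close> maps it to a multiple of \<open>U \<delta> z - z\<close>, which is zero.\<close>

lemma fixed_vector_zero:
  assumes \<delta>: "0 < \<delta>" and fixed: "\<And>r. 0 \<le> r \<Longrightarrow> r \<le> \<delta> \<Longrightarrow> U r z = z"
    and inj: "\<And>x. x \<in> D \<Longrightarrow> B x = 0 \<Longrightarrow> x = 0"
  shows "z = 0"
proof -
  have "integral {0..\<delta>} (\<lambda>r. U (1 * r) z) = integral {0..\<delta>} (\<lambda>r. z)"
    by (rule Henstock_Kurzweil_Integration.integral_cong) (use fixed in auto)
  then have y: "integral {0..\<delta>} (\<lambda>r. U (1 * r) z) = \<delta> *\<^sub>R z" using \<delta> by simp
  have "\<delta> *\<^sub>R z \<in> D" "B (\<delta> *\<^sub>R z) = 0"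
    using integral_U[of 1 0 \<delta> z] \<delta> fixed[of \<delta>] unfolding y by auto
  then have "\<delta> *\<^sub>R z = 0" by (rule inj)
  then show ?thesis using \<delta> by simp
qed

text \<open>If \<open>\<theta>\<close> is not Cauchy, it changes by some \<open>\<delta>\<close> at
  arbitrarily late times and, being continuous, takes all values in between. Convergence of
  \<open>U (\<theta> t) x\<close> then makes \<open>z\<close> a fixed vector of \<open>U r\<close>
  for all \<open>0 \<le> r \<le> \<delta>\<close>.\<close>

lemma phase_converges:
  fixes \<theta> :: "real \<Rightarrow> real"
  assumes cont: "continuous_on {0..} \<theta>" and lim: "((\<lambda>t. U (\<theta> t) x) \<longlongrightarrow> z) at_top" and z: "z \<noteq> 0"
    and inj: "\<And>x. x \<in> D \<Longrightarrow> B x = 0 \<Longrightarrow> x = 0"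
  shows "\<exists>l. (\<theta> \<longlongrightarrow> l) at_top"
proof (rule Cauchy_at_top_tendsto)
  fix \<delta> :: real assume \<delta>: "0 < \<delta>"
  show "\<exists>s. \<forall>p\<ge>s. \<forall>q\<ge>s. norm (\<theta> q - \<theta> p) < \<delta>"
  proof (rule ccontr)
    assume not: "\<not> (\<exists>s. \<forall>p\<ge>s. \<forall>q\<ge>s. norm (\<theta> q - \<theta> p) < \<delta>)"
    have gap: "\<exists>p\<ge>s. \<exists>q\<ge>s. \<theta> p + \<delta> \<le> \<theta> q" for s
    proof -
      have "\<not> (\<forall>p\<ge>s. \<forall>q\<ge>s. norm (\<theta> q - \<theta> p) < \<delta>)" using not by (rule contrapos_nn) (rule exI)
      then obtain p q where "s \<le> p" "s \<le> q" "\<delta> \<le> \<bar>\<theta> q - \<theta> p\<bar>" by (auto simp: not_less)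
      then show ?thesis by (cases "\<theta> p \<le> \<theta> q") (force simp: abs_if)+
    qed
    have "U r z = z" if r: "0 \<le> r" "r \<le> \<delta>" for r
    proof -
      have "norm (U r z - z) \<le> 0 + e" if e: "0 < e" for e
      proof -
        have "eventually (\<lambda>t. dist (U (\<theta> t) x) z < e / 2) at_top" by (rule tendstoD[OF lim]) (use e in simp)
        then obtain T where T: "\<And>t. T \<le> t \<Longrightarrow> dist (U (\<theta> t) x) z < e / 2" unfolding eventually_at_top_linorder by blast
        obtain p q where pq: "max T 0 \<le> p" "max T 0 \<le> q" "\<theta> p + \<delta> \<le> \<theta> q" using gap by blast
        \<comment> \<open>The time \<open>p\<close> of the lower value may precede or follow
          \<open>q\<close>, so both versions of the intermediate value theorem occur.\<close>
        have "\<exists>s\<ge>max T 0. \<theta> s = \<theta> p + r"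
        proof (cases "p \<le> q")
          case True
          have "continuous_on {p..q} \<theta>" by (rule continuous_on_subset[OF cont]) (use pq in auto)
          then obtain s where "p \<le> s" "s \<le> q" "\<theta> s = \<theta> p + r" using IVT'[of \<theta> p "\<theta> p + r" q] pq r True by auto
          then show ?thesis using pq(1) by (intro exI[of _ s]) auto
        next
          case False
          have "continuous_on {q..p} \<theta>" by (rule continuous_on_subset[OF cont]) (use pq in auto)
          then obtain s where "q \<le> s" "s \<le> p" "\<theta> s = \<theta> p + r" using IVT2'[of \<theta> p "\<theta> p + r" q] pq r False by auto
          then show ?thesis using pq(2) by (intro exI[of _ s]) auto
        qed
        then obtain s where s: "T \<le> s" "\<theta> s = \<theta> p + r" by auto
        have eq: "U r z - z = - U r (U (\<theta> p) x - z) + (U (\<theta> s) x - z)" by (simp add: U_simps U_add s add.commute)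
        have "norm (U r z - z) \<le> norm (U r (U (\<theta> p) x - z)) + norm (U (\<theta> s) x - z)"
          unfolding eq using norm_triangle_ineq[of "- U r (U (\<theta> p) x - z)"] by (simp only: norm_minus_cancel)
        then show ?thesis using T[of p] T[of s] s pq by (simp add: U_simps(3) dist_norm)
      qed
      then have "norm (U r z - z) \<le> 0" by (rule field_le_epsilon)
      then show ?thesis by simp
    qed
    then have "z = 0" using fixed_vector_zero[OF \<delta> _ inj] by blast
    then show False using z by simp
  qed
qed

end

context wave begin

text \<open>Over a late window the increment of \<open>\<tau>\<close> is an integral of values of
  \<open>c\<close> close to its limit.\<close>

lemma tau_drift:
  assumes c: "(c \<longlongrightarrow> ci) at_top"
  shows "drift (\<lambda>t. a * t + \<sigma> * \<tau> t) (a + \<sigma> * ci)"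
  unfolding drift_def
proof (intro allI impI)
  fix R e :: real assume R: "0 < R" and e: "0 < e"
  define d where "d = e / ((\<bar>\<sigma>\<bar> + 1) * R)"
  have d: "0 < d" using R e by (simp add: d_def add_nonneg_pos)
  then have "eventually (\<lambda>t. dist (c t) ci < d) at_top" by (rule tendstoD[OF c])
  then obtain T where T: "\<And>t. T \<le> t \<Longrightarrow> dist (c t) ci < d" unfolding eventually_at_top_linorder by blast
  show "\<exists>T. \<forall>t\<ge>T. \<forall>r. 0 \<le> r \<and> r \<le> R \<longrightarrow>
      \<bar>(a * (t + r) + \<sigma> * \<tau> (t + r)) - (a * t + \<sigma> * \<tau> t) - (a + \<sigma> * ci) * r\<bar> \<le> e"
  proof (intro exI[of _ "max T 1"] allI impI, elim conjE)
    fix t r assume t: "max T 1 \<le> t" and r: "0 \<le> r" "r \<le> R"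
    have "\<bar>\<tau> (t + r) - \<tau> t - ci * ((t + r) - t)\<bar> \<le> d * ((t + r) - t)"
    proof (rule tau_first_order)
      fix s assume "t \<le> s" "s \<le> t + r"
      then show "\<bar>c s - ci\<bar> \<le> d" using T[of s] t by (simp add: dist_real_def)
    qed (use t r in auto)
    then have 1: "\<bar>\<tau> (t + r) - \<tau> t - ci * r\<bar> \<le> d * r" by simp
    have "(a * (t + r) + \<sigma> * \<tau> (t + r)) - (a * t + \<sigma> * \<tau> t) - (a + \<sigma> * ci) * r = \<sigma> * (\<tau> (t + r) - \<tau> t - ci * r)"
      by (simp add: algebra_simps)
    then have "\<bar>(a * (t + r) + \<sigma> * \<tau> (t + r)) - (a * t + \<sigma> * \<tau> t) - (a + \<sigma> * ci) * r\<bar> = \<bar>\<sigma>\<bar> * \<bar>\<tau> (t + r) - \<tau> t - ci * r\<bar>"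
      by (simp only: abs_mult)
    also have "\<dots> \<le> (\<bar>\<sigma>\<bar> + 1) * (d * R)"
    proof (rule mult_mono)
      show "\<bar>\<tau> (t + r) - \<tau> t - ci * r\<bar> \<le> d * R" using 1 mult_left_mono[OF r(2), of d] d by linarith
    qed auto
    also have "\<dots> = e"
    proof -
      have "\<bar>\<sigma>\<bar> + 1 \<noteq> 0" by linarith
      then show ?thesis using R by (simp add: d_def)
    qed
    finally show "\<bar>(a * (t + r) + \<sigma> * \<tau> (t + r)) - (a * t + \<sigma> * \<tau> t) - (a + \<sigma> * ci) * r\<bar> \<le> e" .
  qed
qed

end

section \<open>Free waves and comparison with them\<close>

context sa_operator begin

text \<open>The d'Alembert form: with \<open>free_W\<close>, the data \<open>p\<close> and
  \<open>q\<close> are such that \<open>V + i k W = U (k t) p\<close> and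
  \<open>V - i k W = U (- k t) q\<close>.\<close>

definition free_V :: "real \<Rightarrow> 'h \<Rightarrow> 'h \<Rightarrow> real \<Rightarrow> 'h" where
  "free_V k p q t = (1/2) *\<^sub>R (U (k * t) p + U (- k * t) q)"

definition free_W :: "real \<Rightarrow> 'h \<Rightarrow> 'h \<Rightarrow> real \<Rightarrow> 'h" where
  "free_W k p q t = (1 / (2 * \<i> * of_real k)) *\<^sub>C (U (k * t) p - U (- k * t) q)"

lemma continuous_on_free: "continuous_on S (free_V k p q)" "continuous_on S (free_W k p q)"
  unfolding free_V_def free_W_def by (intro continuous_intros)+

text \<open>For constant speed and \<open>b = 0\<close> the function \<open>m\<close> vanishes, so
  \<open>psi_increment\<close> makes \<open>\<psi>\<close> constant for \<open>t > 0\<close>; time 0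
  follows by continuity.\<close>

lemma free_representation:
  assumes sol: "sol (\<lambda>_. k) (\<lambda>_. 0) W V" and k: "0 < k"
  shows "\<exists>p q. \<forall>t\<ge>0. V t = free_V k p q t \<and> W t = free_W k p q t"
proof -
  interpret f: wave_solution D B "\<lambda>_. k" "\<lambda>_. 0" "\<lambda>_. 0" 0 k k W V
    by unfold_locales (use k sol in auto)
  have m: "f.m t = 0" for t by (simp add: f.m_def f.\<beta>_def)
  have tau: "0 \<le> t \<Longrightarrow> f.\<tau> t = k * t" for t by (simp add: f.\<tau>_def mult.commute)
  obtain L where L: "\<And>t. 0 \<le> t \<Longrightarrow> f.N t \<le> L" using f.N_bounded by blast
  have L': "norm (V r) \<le> L \<and> norm (W r) \<le> L" if "0 \<le> r" for r
    using L[OF that] norm_ge_zero[of "V r"] norm_ge_zero[of "W r"] unfolding f.N_def by linarith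
  have le: "f.\<psi> \<sigma> t = f.\<psi> \<sigma> s" if "\<sigma> * \<sigma> = 1" "0 < s" "s \<le> t" for \<sigma> s t
    using f.psi_increment[OF that, of L] L' that by (simp add: m)
  have const: "f.\<psi> \<sigma> t = f.\<psi> \<sigma> 1" if "\<sigma> * \<sigma> = 1" "0 < t" for \<sigma> t
  proof (cases "t \<le> 1")
    case True
    show ?thesis by (rule le[OF that True, symmetric])
  next
    case False
    show ?thesis by (rule le[OF that(1)]) (use False in auto)
  qed
  have phi: "f.\<phi> \<sigma> t = U (\<sigma> * (k * t)) (f.\<psi> \<sigma> 1)" if "\<sigma> * \<sigma> = 1" "0 < t" for \<sigma> t
  proof -
    have "f.\<psi> \<sigma> t = U (- \<sigma> * (k * t)) (f.\<phi> \<sigma> t)" using that by (simp add: f.\<psi>_def tau)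
    then have "U (\<sigma> * (k * t)) (f.\<psi> \<sigma> 1) = U (\<sigma> * (k * t)) (U (- \<sigma> * (k * t)) (f.\<phi> \<sigma> t))" using const[OF that] by simp
    then show ?thesis by (simp add: U_add)
  qed
  let ?p = "f.\<psi> 1 1" and ?q = "f.\<psi> (-1) 1"
  have pos: "V t = free_V k ?p ?q t" "W t = free_W k ?p ?q t" if "0 < t" for t
    using f.V_phi[of t] f.W_phi[OF that] phi[of 1 t] phi[of "-1" t] that by (simp_all add: free_V_def free_W_def)
  have zero: "F 0 = F' 0" if "continuous_on {0..} F" "continuous_on {0..} F'" "\<And>t. 0 < t \<Longrightarrow> F t = F' t" for F F' :: "real \<Rightarrow> 'h"
  proof -
    have 1: "(F \<longlongrightarrow> F 0) (at_right 0)" "(F' \<longlongrightarrow> F' 0) (at_right 0)"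
      using that(1,2) by (auto simp: continuous_on_def intro: tendsto_within_subset)
    have "(F \<longlongrightarrow> F' 0) (at_right 0)"
      by (rule Lim_transform_eventually[OF 1(2)]) (use that(3) in \<open>simp add: eventually_at_filter\<close>)
    then show ?thesis using tendsto_unique[OF _ 1(1)] by simp
  qed
  have "V 0 = free_V k ?p ?q 0" "W 0 = free_W k ?p ?q 0"
    by (rule zero[OF f.V_cont continuous_on_free(1) pos(1)] zero[OF f.W_cont continuous_on_free(2) pos(2)]; simp)+
  then show ?thesis using pos by (metis order_le_less)
qed

end

context wave_solution begin

lemma energy_bounded: "\<exists>L. \<forall>t\<ge>0. norm (V t) \<le> L \<and> norm (W t) \<le> L"
proof -
  obtain L where L: "\<And>t. 0 \<le> t \<Longrightarrow> N t \<le> L" using N_bounded by blast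
  have "norm (V r) \<le> L \<and> norm (W r) \<le> L" if "0 \<le> r" for r
    using L[OF that] norm_ge_zero[of "V r"] norm_ge_zero[of "W r"] unfolding N_def by linarith
  then show ?thesis by blast
qed

text \<open>Bounded energy allows \<open>c t\<close> in front of \<open>W\<close> to be exchanged
  for its limit.\<close>

lemma cW_diff_tendsto:
  assumes c: "(c \<longlongrightarrow> ci) at_top"
  shows "((\<lambda>t. of_real (c t - ci) *\<^sub>C W t) \<longlongrightarrow> 0) at_top"
proof -
  obtain L where L: "\<And>t. 0 \<le> t \<Longrightarrow> norm (W t) \<le> L" using energy_bounded by blast
  have "((\<lambda>t. \<bar>c t - ci\<bar> * L) \<longlongrightarrow> \<bar>ci - ci\<bar> * L) at_top" by (intro tendsto_intros c)
  then have lim: "((\<lambda>t. \<bar>c t - ci\<bar> * L) \<longlongrightarrow> 0) at_top" by simp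
  have "eventually (\<lambda>t. norm (of_real (c t - ci) *\<^sub>C W t) \<le> \<bar>c t - ci\<bar> * L) at_top"
    using eventually_ge_at_top[of 0]
    by eventually_elim (auto simp: norm_scaleC L mult_left_mono simp del: of_real_diff)
  then show ?thesis by (rule Lim_null_comparison[OF _ lim])
qed

text \<open>The phases \<open>\<tau> t\<close> and \<open>ci t\<close> differ asymptotically by the
  constant \<open>l\<close>, so the free data are the limits of \<open>\<psi>\<close> rotated by
  \<open>U (\<sigma> l)\<close>.\<close>

lemma asymptotically_free:
  assumes c: "(c \<longlongrightarrow> ci) at_top" and ci: "0 < ci" and l: "((\<lambda>t. \<tau> t - ci * t) \<longlongrightarrow> l) at_top"
  shows "\<exists>p q. ((\<lambda>t. norm (W t - free_W ci p q t) + norm (V t - free_V ci p q t)) \<longlongrightarrow> 0) at_top"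
proof -
  have lim: "\<exists>p. ((\<lambda>t. \<phi> \<sigma> t - U (\<sigma> * ci * t) p) \<longlongrightarrow> 0) at_top" if \<sigma>: "\<sigma> * \<sigma> = 1" for \<sigma>
  proof -
    obtain z where z: "((\<lambda>t. \<psi> \<sigma> t) \<longlongrightarrow> z) at_top" using psi_limit[OF \<sigma>] by blast
    have "((\<lambda>t. U (\<sigma> * (\<tau> t - ci * t)) (\<psi> \<sigma> t) - U (\<sigma> * l) z) \<longlongrightarrow> U (\<sigma> * l) z - U (\<sigma> * l) z) at_top"
      by (intro tendsto_diff tendsto_const U_tendsto z tendsto_mult l)
    then have "((\<lambda>t. norm (U (\<sigma> * (\<tau> t - ci * t)) (\<psi> \<sigma> t) - U (\<sigma> * l) z)) \<longlongrightarrow> 0) at_top"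
      by (simp add: tendsto_norm_zero)
    moreover have "norm (U (\<sigma> * (\<tau> t - ci * t)) (\<psi> \<sigma> t) - U (\<sigma> * l) z) = norm (\<phi> \<sigma> t - U (\<sigma> * ci * t) (U (\<sigma> * l) z))" for t
    proof -
      have a: "\<sigma> * ci * t + \<sigma> * (\<tau> t - ci * t) + - \<sigma> * \<tau> t = 0" by (simp add: algebra_simps)
      have "U (\<sigma> * ci * t) (U (\<sigma> * (\<tau> t - ci * t)) (\<psi> \<sigma> t)) = \<phi> \<sigma> t"
        unfolding \<psi>_def U_add a add.assoc[symmetric] by (simp add: a)
      then have "norm (\<phi> \<sigma> t - U (\<sigma> * ci * t) (U (\<sigma> * l) z))
          = norm (U (\<sigma> * ci * t) (U (\<sigma> * (\<tau> t - ci * t)) (\<psi> \<sigma> t) - U (\<sigma> * l) z))" by (simp add: U_simps(4))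
      then show ?thesis by (simp add: U_simps(3))
    qed
    ultimately have "((\<lambda>t. \<phi> \<sigma> t - U (\<sigma> * ci * t) (U (\<sigma> * l) z)) \<longlongrightarrow> 0) at_top"
      by (simp add: tendsto_norm_zero_iff)
    then show ?thesis by blast
  qed
  obtain p where p: "((\<lambda>t. \<phi> 1 t - U (1 * ci * t) p) \<longlongrightarrow> 0) at_top" using lim[of 1] by auto
  obtain q where q: "((\<lambda>t. \<phi> (-1) t - U (-1 * ci * t) q) \<longlongrightarrow> 0) at_top" using lim[of "-1"] by auto
  have "((\<lambda>t. (1/2) *\<^sub>R ((\<phi> 1 t - U (1 * ci * t) p) + (\<phi> (-1) t - U (-1 * ci * t) q))) \<longlongrightarrow> (1/2) *\<^sub>R (0 + 0)) at_top"
    by (intro tendsto_intros p q)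
  moreover have "(1/2) *\<^sub>R ((\<phi> 1 t - U (1 * ci * t) p) + (\<phi> (-1) t - U (-1 * ci * t) q)) = V t - free_V ci p q t" for t
    unfolding free_V_def by (subst V_phi) (simp add: scaleR_add_right scaleR_diff_right)
  ultimately have Vlim: "((\<lambda>t. V t - free_V ci p q t) \<longlongrightarrow> 0) at_top" by simp
  \<comment> \<open>\<open>\<phi>\<close> contains \<open>c t\<close> where the free wave has
    \<open>ci\<close>; the last term corrects for this.\<close>
  have "((\<lambda>t. (1 / (2 * \<i> * of_real ci)) *\<^sub>C ((\<phi> 1 t - U (1 * ci * t) p) - (\<phi> (-1) t - U (-1 * ci * t) q))
      - (1 / of_real ci) *\<^sub>C (of_real (c t - ci) *\<^sub>C W t)) \<longlongrightarrow> (1 / (2 * \<i> * of_real ci)) *\<^sub>C (0 - 0) - (1 / of_real ci) *\<^sub>C 0) at_top"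
    by (intro tendsto_diff tendsto_scaleC tendsto_const p q cW_diff_tendsto c)
  then have "((\<lambda>t. (1 / (2 * \<i> * of_real ci)) *\<^sub>C ((\<phi> 1 t - U (1 * ci * t) p) - (\<phi> (-1) t - U (-1 * ci * t) q))
      - (1 / of_real ci) *\<^sub>C (of_real (c t - ci) *\<^sub>C W t)) \<longlongrightarrow> 0) at_top" by simp
  moreover have "(1 / (2 * \<i> * of_real ci)) *\<^sub>C ((\<phi> 1 t - U (1 * ci * t) p) - (\<phi> (-1) t - U (-1 * ci * t) q))
      - (1 / of_real ci) *\<^sub>C (of_real (c t - ci) *\<^sub>C W t) = W t - free_W ci p q t" for t
  proof -
    have "\<phi> 1 t - \<phi> (-1) t = (2 * \<i> * of_real (c t)) *\<^sub>C W t"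
      by (simp add: \<phi>_def scaleC_add_left[symmetric] mult.assoc flip: mult_2)
    then have d: "(\<phi> 1 t - U (1 * ci * t) p) - (\<phi> (-1) t - U (-1 * ci * t) q)
        = (2 * \<i> * of_real (c t)) *\<^sub>C W t - (U (ci * t) p - U (- ci * t) q)" by (simp add: algebra_simps)
    have "(1 / (2 * \<i> * of_real ci)) * (2 * \<i> * of_real (c t)) - (1 / of_real ci) * complex_of_real (c t - ci) = 1"
      using ci by (simp add: field_simps)
    then have "((1 / (2 * \<i> * of_real ci)) * (2 * \<i> * of_real (c t)) - (1 / of_real ci) * complex_of_real (c t - ci)) *\<^sub>C W t = W t" by simp
    then show ?thesis unfolding d free_W_def scaleC_diff_right scaleC_scaleC scaleC_diff_left by (simp add: algebra_simps)
  qed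
  ultimately have Wlim: "((\<lambda>t. W t - free_W ci p q t) \<longlongrightarrow> 0) at_top" by simp
  from tendsto_add[OF tendsto_norm_zero[OF Wlim] tendsto_norm_zero[OF Vlim]] show ?thesis by auto
qed

text \<open>Forming \<open>V + i \<sigma> ci W\<close> from a free wave of speed \<open>cs\<close>
  writes the limit of \<open>\<psi> \<sigma>\<close> as that of two waves with phases
  \<open>\<plusminus> cs t - \<sigma> \<tau> t\<close>. Their slopes
  \<open>\<plusminus> cs - \<sigma> ci\<close> are non-zero if \<open>cs \<noteq> ci\<close>, and
  then both limits vanish. If \<open>cs = ci\<close>, one amplitude is zero, and the phase of a
  surviving wave has to converge.\<close>

lemma free_limit_implies:
  assumes c: "(c \<longlongrightarrow> ci) at_top" and ci: "0 < ci" and cs: "0 < cs"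
    and lim: "((\<lambda>t. norm (W t - free_W cs p q t) + norm (V t - free_V cs p q t)) \<longlongrightarrow> 0) at_top"
    and nz: "0 \<le> t0" "V t0 \<noteq> 0 \<or> W t0 \<noteq> 0"
    and inj: "\<And>x. x \<in> D \<Longrightarrow> B x = 0 \<Longrightarrow> x = 0"
  shows "cs = ci \<and> (\<exists>l. ((\<lambda>t. \<tau> t - ci * t) \<longlongrightarrow> l) at_top)"
proof -
  have Vlim: "((\<lambda>t. V t - free_V cs p q t) \<longlongrightarrow> 0) at_top" and Wlim: "((\<lambda>t. W t - free_W cs p q t) \<longlongrightarrow> 0) at_top"
    by (rule Lim_null_comparison[OF _ lim]; simp)+
  \<comment> \<open>The amplitude of each half wave in \<open>V + i \<sigma> ci W\<close>; for
    \<open>cs = ci\<close> and \<open>\<sigma> = \<plusminus> 1\<close> it is 1 or 0.\<close>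
  define a where "a \<sigma> = (1 + \<sigma> * ci / cs) / 2" for \<sigma> :: real
  have rep: "((\<lambda>t. U (cs * t + - \<sigma> * \<tau> t) (a \<sigma> *\<^sub>R p) + U (- cs * t + - \<sigma> * \<tau> t) (a (- \<sigma>) *\<^sub>R q)) \<longlongrightarrow> z) at_top"
    if z: "((\<lambda>t. \<psi> \<sigma> t) \<longlongrightarrow> z) at_top" for \<sigma> z
  proof -
    have "((\<lambda>t. (V t - free_V cs p q t) + (\<i> * of_real \<sigma>) *\<^sub>C (of_real (c t - ci) *\<^sub>C W t)
        + (\<i> * of_real \<sigma> * of_real ci) *\<^sub>C (W t - free_W cs p q t)) \<longlongrightarrow> 0 + (\<i> * of_real \<sigma>) *\<^sub>C 0 + (\<i> * of_real \<sigma> * of_real ci) *\<^sub>C 0) at_top"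
      by (intro tendsto_add tendsto_scaleC tendsto_const Vlim Wlim cW_diff_tendsto c)
    moreover have "(V t - free_V cs p q t) + (\<i> * of_real \<sigma>) *\<^sub>C (of_real (c t - ci) *\<^sub>C W t)
        + (\<i> * of_real \<sigma> * of_real ci) *\<^sub>C (W t - free_W cs p q t)
        = \<phi> \<sigma> t - (U (cs * t) (a \<sigma> *\<^sub>R p) + U (- cs * t) (a (- \<sigma>) *\<^sub>R q))" for t
    proof -
      have 1: "(\<i> * of_real \<sigma>) *\<^sub>C (of_real (c t - ci) *\<^sub>C W t) + (\<i> * of_real \<sigma> * of_real ci) *\<^sub>C W t
          = (\<i> * of_real \<sigma> * of_real (c t)) *\<^sub>C W t"
        unfolding scaleC_scaleC scaleC_add_left[symmetric] by (simp add: algebra_simps)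
      have f: "\<i> * of_real \<sigma> * of_real ci * (1 / (2 * \<i> * of_real cs)) = complex_of_real (\<sigma> * ci / (2 * cs))"
        using cs by (simp add: field_simps)
      have 2: "(\<i> * of_real \<sigma> * of_real ci) *\<^sub>C free_W cs p q t = (\<sigma> * ci / (2 * cs)) *\<^sub>R (U (cs * t) p - U (- cs * t) q)"
        unfolding free_W_def scaleC_scaleC f by (simp add: scaleR_scaleC)
      have 3: "a \<sigma> = 1 / 2 + \<sigma> * ci / (2 * cs)" "a (- \<sigma>) = 1 / 2 - \<sigma> * ci / (2 * cs)"
        by (simp_all add: a_def add_divide_distrib diff_divide_distrib)
      show ?thesis unfolding scaleC_diff_right[of _ "W t"] 2 U_simps(6) 3
        by (simp add: \<phi>_def free_V_def 1[symmetric] scaleR_add_left scaleR_diff_left scaleR_add_right scaleR_diff_right)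
    qed
    ultimately have "((\<lambda>t. \<phi> \<sigma> t - (U (cs * t) (a \<sigma> *\<^sub>R p) + U (- cs * t) (a (- \<sigma>) *\<^sub>R q))) \<longlongrightarrow> 0) at_top" by simp
    from tendsto_norm_zero[OF this]
    have "((\<lambda>t. norm (U (- \<sigma> * \<tau> t) (\<phi> \<sigma> t - (U (cs * t) (a \<sigma> *\<^sub>R p) + U (- cs * t) (a (- \<sigma>) *\<^sub>R q))))) \<longlongrightarrow> 0) at_top"
      by (simp add: U_simps(3))
    then have "((\<lambda>t. U (- \<sigma> * \<tau> t) (\<phi> \<sigma> t - (U (cs * t) (a \<sigma> *\<^sub>R p) + U (- cs * t) (a (- \<sigma>) *\<^sub>R q)))) \<longlongrightarrow> 0) at_top"
      by (rule tendsto_norm_zero_cancel)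
    from tendsto_diff[OF z this]
    have "((\<lambda>t. \<psi> \<sigma> t - U (- \<sigma> * \<tau> t) (\<phi> \<sigma> t - (U (cs * t) (a \<sigma> *\<^sub>R p) + U (- cs * t) (a (- \<sigma>) *\<^sub>R q)))) \<longlongrightarrow> z) at_top" by simp
    moreover have "\<psi> \<sigma> t - U (- \<sigma> * \<tau> t) (\<phi> \<sigma> t - (U (cs * t) (a \<sigma> *\<^sub>R p) + U (- cs * t) (a (- \<sigma>) *\<^sub>R q)))
        = U (cs * t + - \<sigma> * \<tau> t) (a \<sigma> *\<^sub>R p) + U (- cs * t + - \<sigma> * \<tau> t) (a (- \<sigma>) *\<^sub>R q)" for t
      unfolding \<psi>_def U_simps(1,4) U_add by (simp add: add.commute)
    ultimately show ?thesis by simp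
  qed
  obtain z1 where z1: "((\<lambda>t. \<psi> 1 t) \<longlongrightarrow> z1) at_top" using psi_limit[of 1] by auto
  obtain z2 where z2: "((\<lambda>t. \<psi> (-1) t) \<longlongrightarrow> z2) at_top" using psi_limit[of "-1"] by auto
  have nz12: "z1 \<noteq> 0 \<or> z2 \<noteq> 0" using N_vanishes_of_psi z1 z2 nz by blast
  have cs_ci: "cs = ci"
  proof (rule ccontr)
    assume ne: "cs \<noteq> ci"
    have "z1 = 0"
      by (rule oscillating_limit_zero[OF tau_drift[OF c] tau_drift[OF c] _ _ rep[OF z1] inj]) (use ne cs ci in auto)
    moreover have "z2 = 0"
      by (rule oscillating_limit_zero[OF tau_drift[OF c] tau_drift[OF c] _ _ rep[OF z2] inj]) (use ne cs ci in auto)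
    ultimately show False using nz12 by simp
  qed
  have a: "a 1 = 1" "a (-1) = 0" using cs by (simp_all add: a_def cs_ci)
  have cont: "continuous_on {0..} (\<lambda>t. cs * t + - \<tau> t)" "continuous_on {0..} (\<lambda>t. - cs * t + \<tau> t)"
    by (intro continuous_intros tau_continuous)+
  have "\<exists>l. ((\<lambda>t. - cs * t + \<tau> t) \<longlongrightarrow> l) at_top"
  proof (cases "z1 = 0")
    case False
    have "((\<lambda>t. U (cs * t + - \<tau> t) p) \<longlongrightarrow> z1) at_top" using rep[OF z1] by (simp add: a U_simps)
    from phase_converges[OF cont(1) this False inj] obtain l where "((\<lambda>t. cs * t + - \<tau> t) \<longlongrightarrow> l) at_top" by blast
    from tendsto_minus[OF this] show ?thesis by auto
  next
    case True
    then have "z2 \<noteq> 0" using nz12 by simp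
    moreover have "((\<lambda>t. U (- cs * t + \<tau> t) q) \<longlongrightarrow> z2) at_top" using rep[OF z2] by (simp add: a U_simps)
    ultimately show ?thesis using phase_converges[OF cont(2) _ _ inj] by blast
  qed
  then show ?thesis using cs_ci by (simp add: algebra_simps)
qed

end

section \<open>Weak solutions\<close>

text \<open>The bound makes \<open>f\<close> factor through \<open>e\<close> and be uniformly
  continuous on the image, so it extends to the closure. Keeping \<open>S\<close> and
  \<open>e\<close> general covers both a dense domain and an embedding into a completion.\<close>

lemma dense_extension:
  fixes e :: "'a::real_vector \<Rightarrow> 'b::real_normed_vector" and f :: "'a \<Rightarrow> 'c::banach"
  assumes S: "\<And>x y. x \<in> S \<Longrightarrow> y \<in> S \<Longrightarrow> x + y \<in> S" "\<And>x r. x \<in> S \<Longrightarrow> r *\<^sub>R x \<in> S"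
    and e: "\<And>x y. x \<in> S \<Longrightarrow> y \<in> S \<Longrightarrow> e (x + y) = e x + e y" "\<And>x r. x \<in> S \<Longrightarrow> e (r *\<^sub>R x) = r *\<^sub>R e x"
    and f: "\<And>x y. x \<in> S \<Longrightarrow> y \<in> S \<Longrightarrow> f (x + y) = f x + f y" "\<And>x r. x \<in> S \<Longrightarrow> f (r *\<^sub>R x) = r *\<^sub>R f x"
    and dense: "closure (e ` S) = UNIV" and le: "\<And>x. x \<in> S \<Longrightarrow> norm (f x) \<le> L * norm (e x)"
  shows "\<exists>F. bounded_linear F \<and> (\<forall>x\<in>S. F (e x) = f x) \<and> (\<forall>y. norm (F y) \<le> L * norm y)"
proof -
  have lip: "norm (f x - f y) \<le> L * norm (e x - e y)" if "x \<in> S" "y \<in> S" for x y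
  proof -
    have m: "(-1) *\<^sub>R y \<in> S" by (rule S(2)[OF that(2)])
    show ?thesis using le[OF S(1)[OF that(1) m]] e(1)[OF that(1) m] e(2)[OF that(2), of "-1"]
        f(1)[OF that(1) m] f(2)[OF that(2), of "-1"] by simp
  qed
  \<comment> \<open>The choice of the preimage is immaterial: the bound for differences forces equal
    values of \<open>f\<close> where \<open>e\<close> agrees.\<close>
  define g where "g y = f (SOME x. x \<in> S \<and> e x = y)" for y
  have g: "g (e x) = f x" if "x \<in> S" for x
  proof -
    have "\<exists>x'. x' \<in> S \<and> e x' = e x" using that by blast
    from someI_ex[OF this] have "norm (g (e x) - f x) \<le> 0" unfolding g_def
      using lip[of "SOME x'. x' \<in> S \<and> e x' = e x" x] that by simp
    then show ?thesis by simp
  qed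
  have uc: "uniformly_continuous_on (e ` S) g"
    unfolding uniformly_continuous_on_def
  proof (intro allI impI)
    fix \<epsilon> :: real assume \<epsilon>: "0 < \<epsilon>"
    define d where "d = \<epsilon> / (\<bar>L\<bar> + 1)"
    have d: "0 < d" using \<epsilon> by (simp add: d_def add_nonneg_pos)
    show "\<exists>d>0. \<forall>x\<in>e ` S. \<forall>x'\<in>e ` S. dist x' x < d \<longrightarrow> dist (g x') (g x) < \<epsilon>"
    proof (intro exI[of _ d] conjI d ballI impI)
      fix x x' assume "x \<in> e ` S" "x' \<in> e ` S" and dx: "dist x' x < d"
      then obtain s s' where s: "s \<in> S" "s' \<in> S" "x = e s" "x' = e s'" by blast
      have "dist (g x') (g x) \<le> L * dist x' x" using lip[OF s(2,1)] by (simp add: s g dist_norm)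
      also have "\<dots> \<le> (\<bar>L\<bar> + 1) * dist x' x" by (intro mult_right_mono) auto
      also have "\<dots> < (\<bar>L\<bar> + 1) * d" using dx by (intro mult_strict_left_mono) auto
      also have "\<dots> = \<epsilon>"
      proof -
        have "\<bar>L\<bar> + 1 \<noteq> 0" by linarith
        then show ?thesis by (simp add: d_def)
      qed
      finally show "dist (g x') (g x) < \<epsilon>" .
    qed
  qed
  obtain F where F: "uniformly_continuous_on (closure (e ` S)) F" "\<And>x. x \<in> e ` S \<Longrightarrow> g x = F x"
    by (rule uniformly_continuous_on_extension_on_closure[OF uc]) (rule that, assumption, blast)
  have contF: "isCont F y" for y
    using uniformly_continuous_imp_continuous[OF F(1)] unfolding dense by (simp add: continuous_on_eq_continuous_at)
  have Fe: "F (e x) = f x" if "x \<in> S" for x using F(2)[of "e x"] g[OF that] that by simp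
  have seq: "\<exists>s. (\<forall>n. s n \<in> S) \<and> (\<lambda>n. e (s n)) \<longlonglongrightarrow> y \<and> (\<lambda>n. f (s n)) \<longlonglongrightarrow> F y" for y
  proof -
    have "y \<in> closure (e ` S)" using dense by simp
    then obtain z where z: "\<forall>n. z n \<in> e ` S" "z \<longlonglongrightarrow> y" unfolding closure_sequential by blast
    then have "\<forall>n. \<exists>x. x \<in> S \<and> z n = e x" by blast
    from choice[OF this] obtain s where s: "\<forall>n. s n \<in> S \<and> z n = e (s n)" ..
    have "(\<lambda>n. F (z n)) \<longlonglongrightarrow> F y" by (rule isCont_tendsto_compose[OF contF z(2)])
    moreover have "z = (\<lambda>n. e (s n))" using s by auto
    ultimately show ?thesis using s z(2) Fe by (intro exI[of _ s]) simp
  qed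
  have add: "F (y + y') = F y + F y'" for y y'
  proof -
    obtain s where s: "\<And>n. s n \<in> S" "(\<lambda>n. e (s n)) \<longlonglongrightarrow> y" "(\<lambda>n. f (s n)) \<longlonglongrightarrow> F y" using seq by blast
    obtain s' where s': "\<And>n. s' n \<in> S" "(\<lambda>n. e (s' n)) \<longlonglongrightarrow> y'" "(\<lambda>n. f (s' n)) \<longlonglongrightarrow> F y'" using seq by blast
    have "(\<lambda>n. F (e (s n + s' n))) \<longlonglongrightarrow> F (y + y')"
      by (rule isCont_tendsto_compose[OF contF]) (use tendsto_add[OF s(2) s'(2)] e(1) s(1) s'(1) in simp)
    moreover have "(\<lambda>n. F (e (s n + s' n))) \<longlonglongrightarrow> F y + F y'"
      using tendsto_add[OF s(3) s'(3)] Fe S(1) f(1) s(1) s'(1) by simp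
    ultimately show ?thesis by (rule LIMSEQ_unique)
  qed
  have scale: "F (r *\<^sub>R y) = r *\<^sub>R F y" for r y
  proof -
    obtain s where s: "\<And>n. s n \<in> S" "(\<lambda>n. e (s n)) \<longlonglongrightarrow> y" "(\<lambda>n. f (s n)) \<longlonglongrightarrow> F y" using seq by blast
    have "(\<lambda>n. F (e (r *\<^sub>R s n))) \<longlonglongrightarrow> F (r *\<^sub>R y)"
      by (rule isCont_tendsto_compose[OF contF]) (use tendsto_scaleR[OF tendsto_const s(2)] e(2) s(1) in simp)
    moreover have "(\<lambda>n. F (e (r *\<^sub>R s n))) \<longlonglongrightarrow> r *\<^sub>R F y"
      using tendsto_scaleR[OF tendsto_const s(3)] Fe S(2) f(2) s(1) by simp
    ultimately show ?thesis by (rule LIMSEQ_unique)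
  qed
  have bound: "norm (F y) \<le> L * norm y" for y
  proof -
    obtain s where s: "\<And>n. s n \<in> S" "(\<lambda>n. e (s n)) \<longlonglongrightarrow> y" "(\<lambda>n. f (s n)) \<longlonglongrightarrow> F y" using seq by blast
    show ?thesis
      by (rule LIMSEQ_le[OF tendsto_norm[OF s(3)] tendsto_mult[OF tendsto_const tendsto_norm[OF s(2)]]])
        (use le s(1) in blast)
  qed
  have "bounded_linear F"
    by (rule bounded_linear_intro[of F L]) (auto simp: add scale bound mult.commute)
  then show ?thesis using Fe bound by blast
qed

lemma continuous_eq_on_dense:
  assumes "continuous_on UNIV F" "continuous_on UNIV G" "closure S = UNIV" "\<And>x. x \<in> S \<Longrightarrow> F x = G x"
  shows "F = (G :: 'a::topological_space \<Rightarrow> 'b::t2_space)"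
proof -
  have "closed {x. F x = G x}" by (intro closed_Collect_eq assms)
  then have "closure S \<subseteq> {x. F x = G x}" using assms(4) by (intro closure_minimal) auto
  then show ?thesis using assms(3) by auto
qed

lemma absolutely_continuous_on_subset:
  assumes "absolutely_continuous_on S f" "T \<subseteq> S"
  shows "absolutely_continuous_on T f"
  unfolding absolutely_continuous_on_def
proof (intro allI impI)
  fix e :: real assume "0 < e"
  from assms(1)[unfolded absolutely_continuous_on_def, THEN spec, THEN mp, OF this]
  obtain d where d: "0 < d \<and> (\<forall>n (x::nat \<Rightarrow> real) (y::nat \<Rightarrow> real).
        (\<forall>i<n. x i \<le> y i \<and> {x i..y i} \<subseteq> S) \<and> disjoint_family_on (\<lambda>i. {x i<..<y i}) {..<n} \<and>
        (\<Sum>i<n. y i - x i) < d \<longrightarrow> (\<Sum>i<n. norm (f (y i) - f (x i))) < e)" ..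
  show "\<exists>d>0. \<forall>n (x::nat \<Rightarrow> real) (y::nat \<Rightarrow> real).
        (\<forall>i<n. x i \<le> y i \<and> {x i..y i} \<subseteq> T) \<and> disjoint_family_on (\<lambda>i. {x i<..<y i}) {..<n} \<and>
        (\<Sum>i<n. y i - x i) < d \<longrightarrow> (\<Sum>i<n. norm (f (y i) - f (x i))) < e"
  proof (intro exI[of _ d] conjI allI impI)
    fix n and x y :: "nat \<Rightarrow> real"
    assume h: "(\<forall>i<n. x i \<le> y i \<and> {x i..y i} \<subseteq> T) \<and> disjoint_family_on (\<lambda>i. {x i<..<y i}) {..<n} \<and> (\<Sum>i<n. y i - x i) < d"
    then have "\<forall>i<n. x i \<le> y i \<and> {x i..y i} \<subseteq> S" using assms(2) by (meson order_trans)
    then show "(\<Sum>i<n. norm (f (y i) - f (x i))) < e" using d h by simp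
  qed (use d in simp)
qed

lemma integral_has_vector_derivative_atLeast:
  fixes f :: "real \<Rightarrow> 'a::banach"
  assumes f: "continuous_on {0..} f" and t: "0 \<le> t"
  shows "((\<lambda>u. integral {0..u} f) has_vector_derivative f t) (at t within {0..})"
proof -
  have "((\<lambda>u. integral {0..u} f) has_vector_derivative f t) (at t within {0..t + 1})"
    by (rule integral_has_vector_derivative) (use t continuous_on_subset[OF f] in auto)
  moreover have "at t within {0..t + 1} = at t within {0..}"
    by (rule at_within_nhd[of _ "{..<t + 1}"]) (use t in auto)
  ultimately show ?thesis by simp
qed

section \<open>The two completions and the extensions \<open>\<A>\<close> and \<open>\<B>\<close> of
  the square root\<close>

locale energy_spaces =
  fixes A :: "'h::complex_hilbert \<rightharpoonup> 'h" and \<iota> :: "'h \<Rightarrow> 'k::complex_banach" and j :: "'h \<Rightarrow> 'm::complex_banach"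
  assumes sa: "self_adjoint A" and nn: "nonneg_op A" and inj: "injective_op A"
    and hom: "homogeneous_space A \<iota>" and dual: "dual_space A j"
begin

abbreviation D where "D \<equiv> dom (op_sqrt A)"
abbreviation B where "B \<equiv> op_app (op_sqrt A)"

sublocale sa_operator D B by (rule op_sqrt(1)[OF sa nn])

lemma B_inj: "x \<in> D \<Longrightarrow> B x = 0 \<Longrightarrow> x = 0"
  by (rule op_sqrt_injective[OF sa nn inj])

lemma iota: "clinear_on D \<iota>" "x \<in> D \<Longrightarrow> norm (\<iota> x) = norm (B x)" "closure (\<iota> ` D) = UNIV"
  using hom by (auto simp: homogeneous_space_def is_completion_def)

lemmas iota_lin = clinear_onD[OF iota(1)]

lemma iota_inj: "inj_on \<iota> D"
proof (rule inj_onI)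
  fix x y assume xy: "x \<in> D" "y \<in> D" "\<iota> x = \<iota> y"
  then have "\<iota> (x - y) = 0" using iota_lin(7) by simp
  then have "B (x - y) = 0" using iota(2)[of "x - y"] xy by simp
  then show "x = y" using B_inj[of "x - y"] xy by simp
qed

lemma j_props: "j (x + y) = j x + j y" "j (a *\<^sub>C x) = a *\<^sub>C j x" "j (x - y) = j x - j y" "j (r *\<^sub>R x) = r *\<^sub>R j x"
  "norm (j x) = norm_neg_half A x" "closure (range j) = UNIV"
proof -
  have "clinear_on UNIV j" using dual by (auto simp: dual_space_def is_completion_def)
  note l = clinear_onD[OF this]
  show "j (x + y) = j x + j y" "j (a *\<^sub>C x) = a *\<^sub>C j x" "j (x - y) = j x - j y" "j (r *\<^sub>R x) = r *\<^sub>R j x"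
    using l(4,5,7,10) by auto
  show "norm (j x) = norm_neg_half A x" "closure (range j) = UNIV"
    using dual by (auto simp: dual_space_def is_completion_def)
qed

lemma norm_half_ge: "norm g \<le> norm_half A g" "norm (B g) \<le> norm_half A g"
  by (simp_all add: norm_half_def real_le_rsqrt)

lemma neg_half_bdd: "bdd_above (insert 0 {cmod (cinner f g) | g. g \<in> D \<and> norm_half A g = 1})"
proof (rule bdd_aboveI)
  fix v assume "v \<in> insert 0 {cmod (cinner f g) | g. g \<in> D \<and> norm_half A g = 1}"
  then consider "v = 0" | g where "g \<in> D" "norm_half A g = 1" "v = cmod (cinner f g)" by blast
  then show "v \<le> norm f"
  proof cases
    case 2
    have "norm f * norm g \<le> norm f * 1" using norm_half_ge(1)[of g] 2(2) by (intro mult_left_mono) auto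
    then show ?thesis using Cauchy_Schwarz_cinner[of f g] 2(3) by simp
  qed simp
qed

text \<open>Scaling \<open>g\<close> to the unit sphere of the graph norm. Pairing with
  \<open>g\<close> is thus bounded in the dual norm and extends to the dual space.\<close>

lemma cinner_le_neg_half:
  assumes g: "g \<in> D"
  shows "cmod (cinner f g) \<le> norm_half A g * norm (j f)"
proof (cases "g = 0")
  case False
  define h where "h = norm_half A g"
  have "0 < norm g" using False by simp
  then have h: "0 < h" unfolding h_def using norm_half_ge(1)[of g] by linarith
  have "norm_half A ((1/h) *\<^sub>R g) = sqrt ((1/h)\<^sup>2 * ((norm (B g))\<^sup>2 + (norm g)\<^sup>2))"
    using g by (simp add: norm_half_def power_mult_distrib distrib_left divide_simps)
  also have "\<dots> = (1/h) * norm_half A g" using h by (simp add: real_sqrt_mult norm_half_def real_sqrt_divide)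
  finally have "norm_half A ((1/h) *\<^sub>R g) = 1" using h by (simp add: h_def)
  then have "cmod (cinner f ((1/h) *\<^sub>R g)) \<le> norm (j f)"
    unfolding j_props(5) norm_neg_half_def
    by (intro cSup_upper[OF _ neg_half_bdd] insertI2 CollectI exI[of _ "(1/h) *\<^sub>R g"]) (use g in simp)
  then show ?thesis using h by (simp add: cinner_scaleR_right norm_mult norm_divide field_simps h_def)
qed (simp add: norm_half_def)

text \<open>Symmetry moves \<open>B\<close> onto a test vector of graph norm 1. Hence
  \<open>B\<close> extends to \<open>H\<close> with values in the dual space.\<close>

lemma norm_j_B:
  assumes f: "f \<in> D"
  shows "norm (j (B f)) \<le> norm f"
  unfolding j_props(5) norm_neg_half_def
proof (rule cSup_least)
  fix v assume "v \<in> insert 0 {cmod (cinner (B f) g) | g. g \<in> D \<and> norm_half A g = 1}"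
  then consider "v = 0" | g where "g \<in> D" "norm_half A g = 1" "v = cmod (cinner (B f) g)" by blast
  then show "v \<le> norm f"
  proof cases
    case 2
    have "norm f * norm (B g) \<le> norm f * 1" using norm_half_ge(2)[of g] 2(2) by (intro mult_left_mono) auto
    then show ?thesis using Cauchy_Schwarz_cinner[of f "B g"] 2(3) sym[OF f 2(1)] by simp
  qed simp
qed simp

definition \<A> where "\<A> = sqrt_homogeneous A \<iota>"
definition \<B> where "\<B> = sqrt_dual A j"

text \<open>The \<open>THE\<close> is evaluated by existence of a bounded extension and agreement of
  continuous maps on a dense set.\<close>

lemma sqrt_homogeneous_props: "bounded_linear \<A>" "f \<in> D \<Longrightarrow> \<A> (\<iota> f) = B f"
proof -
  have "\<exists>F. bounded_linear F \<and> (\<forall>x\<in>D. F (\<iota> x) = B x) \<and> (\<forall>y. norm (F y) \<le> 1 * norm y)"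
    by (rule dense_extension) (simp_all add: iota_lin iota)
  then obtain F where F: "bounded_linear F" "\<forall>x\<in>D. F (\<iota> x) = B x" by blast
  have "sqrt_homogeneous A \<iota> = F" unfolding sqrt_homogeneous_def
  proof (rule the_equality)
    show "continuous_on UNIV F \<and> (\<forall>f\<in>D. F (\<iota> f) = B f)" using F by (simp add: linear_continuous_on)
    fix G assume G: "continuous_on UNIV G \<and> (\<forall>f\<in>D. G (\<iota> f) = B f)"
    show "G = F"
    proof (rule continuous_eq_on_dense[OF _ _ iota(3)])
      fix x assume "x \<in> \<iota> ` D"
      then obtain f where "f \<in> D" "x = \<iota> f" by blast
      then show "G x = F x" using G F by simp
    qed (use G F in \<open>simp_all add: linear_continuous_on\<close>)
  qed
  then show "bounded_linear \<A>" "f \<in> D \<Longrightarrow> \<A> (\<iota> f) = B f" using F by (simp_all add: \<A>_def)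
qed

lemma sqrt_dual_props: "bounded_linear \<B>" "f \<in> D \<Longrightarrow> \<B> f = j (B f)" "norm (\<B> y) \<le> norm y"
proof -
  have "\<exists>F. bounded_linear F \<and> (\<forall>x\<in>D. F x = j (B x)) \<and> (\<forall>y. norm (F y) \<le> 1 * norm y)"
    by (rule dense_extension) (simp_all add: j_props(1,4) norm_j_B dense)
  then obtain F where F: "bounded_linear F" "\<forall>x\<in>D. F x = j (B x)" "\<forall>y. norm (F y) \<le> norm y" by auto
  have "sqrt_dual A j = F" unfolding sqrt_dual_def
  proof (rule the_equality)
    show "continuous_on UNIV F \<and> (\<forall>f\<in>D. F f = j (B f))" using F by (simp add: linear_continuous_on)
    fix G assume G: "continuous_on UNIV G \<and> (\<forall>f\<in>D. G f = j (B f))"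
    show "G = F"
    proof (rule continuous_eq_on_dense[OF _ _ dense])
      show "G f = F f" if "f \<in> D" for f using that G F by simp
    qed (use G F in \<open>simp_all add: linear_continuous_on\<close>)
  qed
  then show "bounded_linear \<B>" "f \<in> D \<Longrightarrow> \<B> f = j (B f)" "norm (\<B> y) \<le> norm y" using F by (simp_all add: \<B>_def)
qed

lemmas A_lin = linear_add[OF bounded_linear.linear[OF sqrt_homogeneous_props(1)]]
  linear_diff[OF bounded_linear.linear[OF sqrt_homogeneous_props(1)]]
lemmas A_tendsto = bounded_linear.tendsto[OF sqrt_homogeneous_props(1)]

lemma iota_sequence: "\<exists>s. (\<forall>n. s n \<in> D) \<and> (\<lambda>n. \<iota> (s n)) \<longlonglongrightarrow> y"
proof -
  have "y \<in> closure (\<iota> ` D)" using iota(3) by simp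
  then obtain z where z: "\<forall>n. z n \<in> \<iota> ` D" "z \<longlonglongrightarrow> y" unfolding closure_sequential by blast
  then have "\<forall>n. \<exists>x. x \<in> D \<and> z n = \<iota> x" by blast
  from choice[OF this] obtain s where s: "\<forall>n. s n \<in> D \<and> z n = \<iota> (s n)" ..
  then have "z = (\<lambda>n. \<iota> (s n))" by auto
  then show ?thesis using s z(2) by (intro exI[of _ s]) simp
qed

lemma A_norm: "norm (\<A> y) = norm y"
proof -
  obtain s where s: "\<And>n. s n \<in> D" "(\<lambda>n. \<iota> (s n)) \<longlonglongrightarrow> y" using iota_sequence by blast
  have "(\<lambda>n. norm (\<A> (\<iota> (s n)))) \<longlonglongrightarrow> norm (\<A> y)" by (intro tendsto_norm A_tendsto s)
  moreover have "(\<lambda>n. norm (\<A> (\<iota> (s n)))) \<longlonglongrightarrow> norm y"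
    using tendsto_norm[OF s(2)] by (simp add: sqrt_homogeneous_props(2) s(1) iota(2))
  ultimately show ?thesis by (rule LIMSEQ_unique)
qed

lemma A_scaleC: "\<A> (a *\<^sub>C y) = a *\<^sub>C \<A> y"
proof -
  obtain s where s: "\<And>n. s n \<in> D" "(\<lambda>n. \<iota> (s n)) \<longlonglongrightarrow> y" using iota_sequence by blast
  have "(\<lambda>n. \<A> (\<iota> (a *\<^sub>C s n))) \<longlonglongrightarrow> \<A> (a *\<^sub>C y)"
    by (rule A_tendsto) (use tendsto_scaleC[OF tendsto_const s(2)] s(1) iota_lin(5) in simp)
  moreover have "(\<lambda>n. \<A> (\<iota> (a *\<^sub>C s n))) \<longlonglongrightarrow> a *\<^sub>C \<A> y"
    using tendsto_scaleC[OF tendsto_const A_tendsto[OF s(2)]] by (simp add: sqrt_homogeneous_props(2) s(1))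
  ultimately show ?thesis by (rule LIMSEQ_unique)
qed

lemma A_inj: "\<A> x = \<A> y \<Longrightarrow> x = y"
  using A_norm[of "x - y"] by (simp add: A_lin(2))

text \<open>The range of an isometry is closed. A vector orthogonal to it is orthogonal to the range
  of \<open>B\<close>, so it lies in the kernel of \<open>B\<close>, which is trivial.\<close>

lemma A_surj: "range \<A> = UNIV"
proof (rule ccontr)
  assume ne: "range \<A> \<noteq> UNIV"
  have lin: "clinear_on (range \<A>) (\<lambda>x. x)" unfolding clinear_on_def
  proof (intro conjI ballI allI)
    have "\<A> 0 = 0" using A_lin(2)[of 0 0] by simp
    then show "0 \<in> range \<A>" by (intro range_eqI[of _ _ 0]) simp
  next
    fix x y assume "x \<in> range \<A>" "y \<in> range \<A>"
    then obtain x' y' where "x = \<A> x'" "y = \<A> y'" by blast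
    then show "x + y \<in> range \<A>" by (intro range_eqI[of _ _ "x' + y'"]) (simp add: A_lin(1))
  next
    fix a x assume "x \<in> range \<A>"
    then obtain x' where "x = \<A> x'" by blast
    then show "a *\<^sub>C x \<in> range \<A>" by (intro range_eqI[of _ _ "a *\<^sub>C x'"]) (simp add: A_scaleC)
  qed (rule refl)+
  have closed: "closed (range \<A>)" unfolding closed_sequential_limits
  proof safe
    fix u l assume u: "\<forall>n. u n \<in> range \<A>" "u \<longlonglongrightarrow> l"
    then have "\<forall>n. \<exists>x. u n = \<A> x" by blast
    from choice[OF this] obtain x where x: "\<forall>n. u n = \<A> (x n)" ..
    have "norm (x m - x n) = norm (u m - u n)" for m n using A_norm[of "x m - x n"] x by (simp add: A_lin(2))
    then have "Cauchy x" using LIMSEQ_imp_Cauchy[OF u(2)] unfolding Cauchy_def dist_norm by simp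
    then obtain y where y: "x \<longlonglongrightarrow> y" using convergent_eq_Cauchy by blast
    have "(\<lambda>n. \<A> (x n)) \<longlonglongrightarrow> \<A> y" by (rule A_tendsto[OF y])
    moreover have "u = (\<lambda>n. \<A> (x n))" using x by auto
    ultimately have "u \<longlonglongrightarrow> \<A> y" by simp
    then show "l \<in> range \<A>" using LIMSEQ_unique[OF u(2)] by blast
  qed
  obtain z where z: "z \<noteq> 0" "\<forall>x\<in>range \<A>. cinner x z = 0" using exists_orthogonal[OF lin closed ne] by blast
  have "z \<in> D \<and> B z = 0"
  proof (rule maximal)
    fix x assume x: "x \<in> D"
    have "B x \<in> range \<A>" by (rule range_eqI[of _ _ "\<iota> x"]) (simp add: sqrt_homogeneous_props(2)[OF x])
    then show "cinner (B x) z = cinner x 0" using bspec[OF z(2)] by simp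
  qed
  then show False using B_inj z(1) by blast
qed

text \<open>\<open>l\<close> extends the pairing with \<open>g\<close> to the dual space, and after
  \<open>\<B>\<close> it becomes the pairing with \<open>B g\<close>. It carries the equation in the
  dual space to the tested identities of \<open>sol\<close>.\<close>

lemma functional_exists:
  assumes g: "g \<in> D"
  shows "\<exists>l. bounded_linear l \<and> (\<forall>x. l (j x) = cinner x g) \<and> (\<forall>w. l (\<B> w) = cinner w (B g))"
proof -
  have "\<exists>F. bounded_linear F \<and> (\<forall>x\<in>UNIV. F (j x) = cinner x g) \<and> (\<forall>y. norm (F y) \<le> norm_half A g * norm y)"
    by (rule dense_extension) (simp_all add: j_props(1,4,6) cinner_algebra scaleR_conv_of_real cinner_le_neg_half g)
  then obtain F where F: "bounded_linear F" "\<forall>x. F (j x) = cinner x g" by auto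
  have "(\<lambda>w. F (\<B> w)) = (\<lambda>w. cinner w (B g))"
  proof (rule continuous_eq_on_dense[OF _ _ dense])
    show "continuous_on UNIV (\<lambda>w. F (\<B> w))"
      using linear_continuous_on[OF bounded_linear_compose[OF F(1) sqrt_dual_props(1)]] .
    show "continuous_on UNIV (\<lambda>w. cinner w (B g))" by (intro continuous_intros)
    show "F (\<B> w) = cinner w (B g)" if "w \<in> D" for w using that F(2) sqrt_dual_props(2) sym[OF that g] by simp
  qed
  then show ?thesis using F by (metis (no_types))
qed

text \<open>The identity for \<open>W\<close> is the fundamental theorem of calculus for the
  increment in \<open>H\<close>. The one for \<open>V\<close> applies the functional to the equation
  valid almost everywhere, and absolute continuity allows its integration.\<close>

lemma weak_solution_sol:
  assumes u: "weak_solution A \<iota> j c b u"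
  shows "sol c b (\<lambda>t. \<A> (u t)) (velocity A \<iota> u)"
proof -
  let ?V = "velocity A \<iota> u" and ?x = "increment A \<iota> u"
  have cont: "continuous_on {0..} u" and incr: "\<And>t. 0 \<le> t \<Longrightarrow> u t - u 0 \<in> \<iota> ` D"
    and der: "\<And>t. 0 \<le> t \<Longrightarrow> (?x has_vector_derivative ?V t) (at t within {0..})"
    and Vcont: "continuous_on {0..} ?V" and AC: "AC_loc (\<lambda>t. j (?V t))"
    and ae: "AE t in lebesgue. t > 0 \<longrightarrow>
        (\<exists>a. ((\<lambda>s. j (?V s)) has_vector_derivative a) (at t) \<and>
             a + (c t)\<^sup>2 *\<^sub>R sqrt_dual A j (sqrt_homogeneous A \<iota> (u t)) + b t *\<^sub>C j (?V t) = 0)"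
    using u unfolding weak_solution_def by blast+
  have x: "?x t \<in> D" "\<iota> (?x t) = u t - u 0" if "0 \<le> t" for t
    unfolding increment_def using the_inv_into_into[OF iota_inj incr[OF that] order_refl] f_the_inv_into_f[OF iota_inj incr[OF that]] by auto
  have Wdiff: "\<A> (u t) - \<A> (u s) = B (?x t - ?x s)" if "0 \<le> s" "0 \<le> t" for s t
  proof -
    have "\<iota> (?x t - ?x s) = u t - u s" using x that by (simp add: iota_lin(7))
    moreover have "?x t - ?x s \<in> D" using x that by simp
    ultimately show ?thesis using sqrt_homogeneous_props(2)[of "?x t - ?x s"] by (simp add: A_lin(2))
  qed
  define R where "R t \<longleftrightarrow> (\<exists>a. ((\<lambda>s. j (?V s)) has_vector_derivative a) (at t) \<and>
             a + (c t)\<^sup>2 *\<^sub>R \<B> (\<A> (u t)) + b t *\<^sub>C j (?V t) = 0)" for t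
  have "AE t in lebesgue. t > 0 \<longrightarrow> R t" using ae unfolding R_def \<A>_def \<B>_def .
  then obtain N where N': "{t \<in> space lebesgue. \<not> (t > 0 \<longrightarrow> R t)} \<subseteq> N" "emeasure lebesgue N = 0" "N \<in> sets lebesgue"
    by (rule AE_E)
  have N: "t \<in> N" if "0 < t" "\<not> R t" for t using N'(1) that by auto
  have negl: "negligible N" unfolding negligible_iff_null_sets by (rule null_setsI[OF N'(2,3)])
  show ?thesis unfolding sol_def
  proof (intro conjI ballI allI impI)
    show "continuous_on {0..} (\<lambda>t. \<A> (u t))" by (rule bounded_linear.continuous_on[OF sqrt_homogeneous_props(1) cont])
    show "continuous_on {0..} ?V" by (rule Vcont)
    fix g s t assume g: "g \<in> D" and s: "0 \<le> (s::real)" and t: "s \<le> t"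
    have "((\<lambda>r. cinner (?V r) (B g)) has_integral cinner (?x t) (B g) - cinner (?x s) (B g)) {s..t}"
    proof (rule fundamental_theorem_of_calculus[OF t])
      fix r assume "r \<in> {s..t}"
      then have "(?x has_vector_derivative ?V r) (at r within {s..t})"
        using s by (intro has_vector_derivative_within_subset[OF der]) auto
      then show "((\<lambda>r. cinner (?x r) (B g)) has_vector_derivative cinner (?V r) (B g)) (at r within {s..t})"
        by (rule bounded_linear.has_vector_derivative[OF bounded_linear_cinner_left])
    qed
    then show "((\<lambda>r. cinner (?V r) (B g)) has_integral cinner (\<A> (u t) - \<A> (u s)) g) {s..t}"
      using Wdiff[of s t] s t x sym[of "?x t - ?x s" g] g by (simp add: cinner_diff_left)
    obtain l where l: "bounded_linear l" "\<And>x. l (j x) = cinner x g" "\<And>w. l (\<B> w) = cinner w (B g)"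
      using functional_exists[OF g] by blast
    obtain L where L: "\<And>x. norm (l x) \<le> norm x * L" using bounded_linear.bounded[OF l(1)] by blast
    have "((\<lambda>r. - (of_real ((c r)\<^sup>2) * cinner (\<A> (u r)) (B g) + b r * cinner (?V r) g)) has_integral
        l (j (?V t)) - l (j (?V s))) {s..t}"
    proof (rule AC_fundamental_theorem[of s t "\<lambda>r. l (j (?V r))" "N \<union> {0}"])
      have "absolutely_continuous_on {0..t + 1} (\<lambda>t. j (?V t))" using AC s t by (simp add: AC_loc_def)
      then have "absolutely_continuous_on {s..t} (\<lambda>t. j (?V t))"
        by (rule absolutely_continuous_on_subset) (use s in auto)
      then show "absolutely_continuous_on {s..t} (\<lambda>r. l (j (?V r)))"
        by (rule absolutely_continuous_on_compose[where L = L])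
          (use L in \<open>simp add: linear_diff[OF bounded_linear.linear[OF l(1)], symmetric] mult.commute\<close>)
      \<comment> \<open>The equation is asserted for positive times, so 0 joins the null
        set.\<close>
      show "negligible (N \<union> {0})" using negl by simp
      fix r assume r: "r \<in> {s..t} - (N \<union> {0})"
      then have "0 < r" "r \<notin> N" using s by auto
      then obtain a where a: "((\<lambda>s. j (?V s)) has_vector_derivative a) (at r)"
        "a + (c r)\<^sup>2 *\<^sub>R \<B> (\<A> (u r)) + b r *\<^sub>C j (?V r) = 0" using N[of r] unfolding R_def by blast
      have "((\<lambda>r. l (j (?V r))) has_vector_derivative l a) (at r within {s..t})"
        by (rule bounded_linear.has_vector_derivative[OF l(1) has_vector_derivative_at_within[OF a(1)]])
      moreover have "l a = - (of_real ((c r)\<^sup>2) * cinner (\<A> (u r)) (B g) + b r * cinner (?V r) g)"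
      proof -
        have "l (a + (c r)\<^sup>2 *\<^sub>R \<B> (\<A> (u r)) + j (b r *\<^sub>C ?V r)) = 0"
          unfolding j_props(2) a(2) using linear_0[OF bounded_linear.linear[OF l(1)]] .
        then have "l a + of_real ((c r)\<^sup>2) * cinner (\<A> (u r)) (B g) + b r * cinner (?V r) g = 0"
          by (simp add: linear_add[OF bounded_linear.linear[OF l(1)]] linear_scale[OF bounded_linear.linear[OF l(1)]]
              l(2,3) cinner_scaleC_left scaleR_conv_of_real)
        moreover have "x + y + z = 0 \<Longrightarrow> x = - (y + z)" for x y z :: complex
          by (simp only: eq_neg_iff_add_eq_0 add.assoc)
        ultimately show ?thesis by blast
      qed
      ultimately show "((\<lambda>r. l (j (?V r))) has_vector_derivative
          - (of_real ((c r)\<^sup>2) * cinner (\<A> (u r)) (B g) + b r * cinner (?V r) g)) (at r within {s..t})" by simp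
    qed (rule t)
    then show "((\<lambda>r. - (of_real ((c r)\<^sup>2) * cinner (\<A> (u r)) (B g) + b r * cinner (?V r) g)) has_integral
        cinner (?V t - ?V s) g) {s..t}" by (simp add: l(2) cinner_diff_left)
  qed
qed

text \<open>As \<open>p\<close> and \<open>q\<close> are arbitrary vectors of \<open>H\<close>, the
  regularity comes from time integrals of the group, which lie in \<open>D\<close>. \<open>X\<close>
  is the increment of \<open>v\<close>; \<open>Y\<close> satisfies \<open>B Y = V - V 0\<close>, so
  \<open>j V\<close> is a constant plus \<open>\<B> Y\<close> and therefore Lipschitz in the dual
  space.\<close>

lemma free_weak_solution_exists:
  assumes k: "0 < k"
  shows "\<exists>v. free_weak_solution A \<iota> j k v \<and> (\<forall>t\<ge>0. \<A> (v t) = free_W k p q t \<and> velocity A \<iota> v t = free_V k p q t)"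
proof -
  let ?V = "free_V k p q" and ?W = "free_W k p q"
  define v where "v t = inv \<A> (?W t)" for t
  have Av: "\<A> (v t) = ?W t" for t unfolding v_def using A_surj by (simp add: f_inv_into_f)
  define P where "P t = integral {0..t} (\<lambda>r. U (k * r) p)" for t
  define Q where "Q t = integral {0..t} (\<lambda>r. U (- k * r) q)" for t
  define X where "X t = (1/2) *\<^sub>R (P t + Q t)" for t
  \<comment> \<open>The factor cancels the \<open>1 / k\<close> produced by \<open>B\<close> on the
    integrals, and the minus sign turns their opposite signs into a sum.\<close>
  define Y where "Y t = (\<i> * of_real k / 2) *\<^sub>C (P t - Q t)" for t
  have P: "P t \<in> D" "B (P t) = (- \<i> / of_real k) *\<^sub>C (U (k * t) p - p)" if "0 \<le> t" for t
    using integral_U[of k 0 t p] k that by (simp_all add: P_def)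
  have Q: "Q t \<in> D" "B (Q t) = (\<i> / of_real k) *\<^sub>C (U (- k * t) q - q)" if "0 \<le> t" for t
    using integral_U[of "- k" 0 t q] k that by (simp_all add: Q_def)
  have dP: "(P has_vector_derivative U (k * t) p) (at t within {0..})" if "0 \<le> t" for t
    unfolding P_def by (rule integral_has_vector_derivative_atLeast[OF _ that]) (intro continuous_intros)
  have dQ: "(Q has_vector_derivative U (- k * t) q) (at t within {0..})" if "0 \<le> t" for t
    unfolding Q_def by (rule integral_has_vector_derivative_atLeast[OF _ that]) (intro continuous_intros)
  have X: "X t \<in> D" "B (X t) = ?W t - ?W 0" if "0 \<le> t" for t
  proof -
    show "X t \<in> D" using P(1) Q(1) that by (simp add: X_def)
    have "B (X t) = (1/2) *\<^sub>R ((- \<i> / of_real k) *\<^sub>C (U (k * t) p - p) + (\<i> / of_real k) *\<^sub>C (U (- k * t) q - q))"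
      using P Q that by (simp add: X_def)
    also have "\<dots> = (1 / (2 * \<i> * of_real k)) *\<^sub>C ((U (k * t) p - U (- k * t) q) - (p - q))"
    proof -
      have 1: "complex_of_real (1/2) * (- \<i> / of_real k) = 1 / (2 * \<i> * of_real k)"
        "complex_of_real (1/2) * (\<i> / of_real k) = - (1 / (2 * \<i> * of_real k))" using k by (simp_all add: field_simps)
      show ?thesis unfolding scaleR_scaleC scaleC_add_right scaleC_scaleC 1
        by (simp add: scaleC_diff_right)
    qed
    also have "\<dots> = ?W t - ?W 0" by (simp add: free_W_def scaleC_diff_right)
    finally show "B (X t) = ?W t - ?W 0" .
  qed
  have dX: "(X has_vector_derivative ?V t) (at t within {0..})" if "0 \<le> t" for t
    unfolding X_def free_V_def
    by (rule bounded_linear.has_vector_derivative[OF bounded_linear_scaleR_right has_vector_derivative_add[OF dP[OF that] dQ[OF that]]])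
  have YD: "Y t \<in> D" "B (Y t) = ?V t - ?V 0" if "0 \<le> t" for t
  proof -
    show "Y t \<in> D" using P(1) Q(1) that by (simp add: Y_def)
    have "B (Y t) = (\<i> * of_real k / 2) *\<^sub>C ((- \<i> / of_real k) *\<^sub>C (U (k * t) p - p) - (\<i> / of_real k) *\<^sub>C (U (- k * t) q - q))"
      using P Q that by (simp add: Y_def)
    also have "\<dots> = (1/2) *\<^sub>R ((U (k * t) p - p) + (U (- k * t) q - q))"
    proof -
      have 1: "\<i> * of_real k / 2 * (- \<i> / of_real k) = complex_of_real (1/2)"
        "\<i> * of_real k / 2 * (\<i> / of_real k) = - complex_of_real (1/2)" using k by (simp_all add: field_simps)
      show ?thesis unfolding scaleC_diff_right[of "\<i> * of_real k / 2"] scaleC_scaleC 1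
        by (simp add: scaleR_scaleC scaleC_add_right)
    qed
    also have "\<dots> = ?V t - ?V 0" by (simp add: free_V_def scaleR_diff_right scaleR_add_right)
    finally show "B (Y t) = ?V t - ?V 0" .
  qed
  have dY: "(Y has_vector_derivative (- k\<^sup>2) *\<^sub>R ?W t) (at t within {0..})" if "0 \<le> t" for t
  proof -
    have "(Y has_vector_derivative (\<i> * of_real k / 2) *\<^sub>C (U (k * t) p - U (- k * t) q)) (at t within {0..})"
      unfolding Y_def by (rule bounded_linear.has_vector_derivative[OF bounded_linear_scaleC has_vector_derivative_diff[OF dP[OF that] dQ[OF that]]])
    moreover have e: "complex_of_real (- k\<^sup>2) * (1 / (2 * \<i> * of_real k)) = \<i> * of_real k / 2"
      using k by (simp add: field_simps power2_eq_square)
    have "(\<i> * of_real k / 2) *\<^sub>C (U (k * t) p - U (- k * t) q) = (- k\<^sup>2) *\<^sub>R ?W t"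
      unfolding free_W_def scaleR_scaleC scaleC_scaleC e ..
    ultimately show ?thesis by simp
  qed
  have iX: "\<iota> (X t) = v t - v 0" if "0 \<le> t" for t
    by (rule A_inj) (use X[OF that] in \<open>simp add: sqrt_homogeneous_props(2) A_lin(2) Av\<close>)
  have incr: "increment A \<iota> v t = X t" if "0 \<le> t" for t
    unfolding increment_def iX[OF that, symmetric] by (rule the_inv_into_f_f[OF iota_inj X(1)[OF that]])
  have dincr: "(increment A \<iota> v has_vector_derivative ?V t) (at t within {0..})" if "0 \<le> t" for t
    by (rule has_vector_derivative_transform[OF _ _ dX[OF that]]) (use that incr in auto)
  have vel: "velocity A \<iota> v t = ?V t" if "0 \<le> t" for t
    unfolding velocity_def
  proof (rule vector_derivative_within[OF _ dincr[OF that]])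
    have "at t within {t<..} \<noteq> bot" by simp
    moreover have "at t within {t<..} \<le> at t within {0..}" by (rule at_le) (use that in auto)
    ultimately show "at t within {0..} \<noteq> bot" by (metis bot.extremum_uniqueI)
  qed
  have jV: "j (velocity A \<iota> v t) = j (?V 0) + \<B> (Y t)" if "0 \<le> t" for t
    using YD[OF that] vel[OF that] by (simp add: sqrt_dual_props(2) j_props(3))
  have Wn: "norm (?W t) \<le> (norm p + norm q) / (2 * k)" for t
    using norm_triangle_ineq4[of "U (k * t) p" "U (- k * t) q"] k
    by (simp add: free_W_def norm_scaleC norm_divide norm_mult U_simps(3) divide_right_mono)
  have Ylip: "norm (Y t - Y s) \<le> k\<^sup>2 * ((norm p + norm q) / (2 * k)) * (t - s)" if "0 \<le> s" "s \<le> t" for s t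
  proof (rule has_integral_norm_bound)
    show "((\<lambda>r. (- k\<^sup>2) *\<^sub>R ?W r) has_integral Y t - Y s) {s..t}"
      by (rule fundamental_theorem_of_calculus[OF that(2)])
        (rule has_vector_derivative_within_subset[OF dY], use that in auto)
    show "norm ((- k\<^sup>2) *\<^sub>R ?W r) \<le> k\<^sup>2 * ((norm p + norm q) / (2 * k))" for r
      using mult_left_mono[OF Wn[of r], of "k\<^sup>2"] by simp
  qed (rule that)
  have jlip: "norm (j (velocity A \<iota> v x) - j (velocity A \<iota> v y)) \<le> k\<^sup>2 * ((norm p + norm q) / (2 * k)) * norm (x - y)"
    if xy: "0 \<le> x" "0 \<le> y" for x y
  proof -
    have "j (velocity A \<iota> v x) - j (velocity A \<iota> v y) = \<B> (Y x - Y y)"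
      using xy by (simp add: jV linear_diff[OF bounded_linear.linear[OF sqrt_dual_props(1)]])
    then have "norm (j (velocity A \<iota> v x) - j (velocity A \<iota> v y)) \<le> norm (Y x - Y y)" using sqrt_dual_props(3) by simp
    also have "\<dots> \<le> k\<^sup>2 * ((norm p + norm q) / (2 * k)) * norm (x - y)"
      using Ylip[of x y] Ylip[of y x] xy by (cases "x \<le> y") (auto simp: norm_minus_commute)
    finally show ?thesis .
  qed
  have Vc: "continuous_on {0..} (velocity A \<iota> v)"
    using continuous_on_free(1)[of "{0..}" k p q] by (rule continuous_on_eq) (use vel in auto)
  have "weak_solution A \<iota> j (\<lambda>t. k) (\<lambda>t. 0) v"
    unfolding weak_solution_def
  proof (intro conjI allI impI)
    show "continuous_on {0..} v"
    proof -
      have d: "dist (v x) (v y) = dist (?W x) (?W y)" for x y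
        using A_norm[of "v x - v y"] by (simp add: dist_norm A_lin(2) Av)
      show ?thesis
        using continuous_on_free(2)[of "{0..}" k p q] unfolding continuous_on_def tendsto_iff d .
    qed
    fix t :: real assume t: "0 \<le> t"
    show "v t - v 0 \<in> \<iota> ` D" using iX[OF t] X(1)[OF t] by (metis imageI)
    show "(increment A \<iota> v has_vector_derivative velocity A \<iota> v t) (at t within {0..})"
      using dincr[OF t] vel[OF t] by simp
    show "((\<lambda>s. norm_half A (increment A \<iota> v s - increment A \<iota> v t)) \<longlongrightarrow> 0) (at t within {0..})"
    proof (rule Lim_transform_eventually)
      have "(X \<longlongrightarrow> X t) (at t within {0..})"
        using has_vector_derivative_continuous[OF dX[OF t]] by (simp add: continuous_within)
      moreover have "(?W \<longlongrightarrow> ?W t) (at t within {0..})"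
        using continuous_on_free(2)[of "{0..}" k p q] t by (auto simp: continuous_on_def)
      ultimately have "((\<lambda>s. sqrt ((norm (?W s - ?W t))\<^sup>2 + (norm (X s - X t))\<^sup>2)) \<longlongrightarrow>
          sqrt ((norm (?W t - ?W t))\<^sup>2 + (norm (X t - X t))\<^sup>2)) (at t within {0..})" by (intro tendsto_intros)
      then show "((\<lambda>s. sqrt ((norm (?W s - ?W t))\<^sup>2 + (norm (X s - X t))\<^sup>2)) \<longlongrightarrow> 0) (at t within {0..})" by simp
      show "eventually (\<lambda>s. sqrt ((norm (?W s - ?W t))\<^sup>2 + (norm (X s - X t))\<^sup>2)
          = norm_half A (increment A \<iota> v s - increment A \<iota> v t)) (at t within {0..})"
        unfolding eventually_at_filter
        by (intro always_eventually allI impI) (use t X in \<open>simp add: norm_half_def incr\<close>)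
    qed
  next
    show "continuous_on {0..} (velocity A \<iota> v)" by (rule Vc)
    show "AC_loc (\<lambda>t. j (velocity A \<iota> v t))" unfolding AC_loc_def
    proof (intro conjI allI impI)
      have lip: "(k\<^sup>2 * ((norm p + norm q) / (2 * k)))-lipschitz_on {0..} (\<lambda>t. j (velocity A \<iota> v t))"
        by (rule lipschitz_onI) (use jlip k in \<open>auto simp: dist_norm\<close>)
      show "continuous_on {0..} (\<lambda>t. j (velocity A \<iota> v t))" by (rule lipschitz_on_continuous_on[OF lip])
      show "absolutely_continuous_on {0..T} (\<lambda>t. j (velocity A \<iota> v t))" for T
        by (rule absolutely_continuous_on_Lipschitz, rule jlip) simp_all
    qed
    show "AE t in lebesgue. t > 0 \<longrightarrow>
        (\<exists>a. ((\<lambda>s. j (velocity A \<iota> v s)) has_vector_derivative a) (at t) \<and>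
             a + k\<^sup>2 *\<^sub>R sqrt_dual A j (sqrt_homogeneous A \<iota> (v t)) + 0 *\<^sub>C j (velocity A \<iota> v t) = 0)"
    proof (rule AE_I2, intro impI exI conjI)
      fix t :: real assume t: "0 < t"
      have "(Y has_vector_derivative (- k\<^sup>2) *\<^sub>R ?W t) (at t)"
        using dY[of t] t by (simp add: at_within_interior[of t "{0..}"])
      note d = bounded_linear.has_vector_derivative[OF sqrt_dual_props(1) this]
      have "((\<lambda>s. j (?V 0) + \<B> (Y s)) has_vector_derivative \<B> ((- k\<^sup>2) *\<^sub>R ?W t)) (at t)"
        using has_vector_derivative_add[OF has_vector_derivative_const d, of "j (?V 0)"] by simp
      then show "((\<lambda>s. j (velocity A \<iota> v s)) has_vector_derivative \<B> ((- k\<^sup>2) *\<^sub>R ?W t)) (at t)"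
        by (rule has_vector_derivative_transform_within_open[of _ _ _ "{0<..}"]) (use t jV in auto)
      show "\<B> ((- k\<^sup>2) *\<^sub>R ?W t) + k\<^sup>2 *\<^sub>R sqrt_dual A j (sqrt_homogeneous A \<iota> (v t)) + 0 *\<^sub>C j (velocity A \<iota> v t) = 0"
        unfolding \<A>_def[symmetric] \<B>_def[symmetric] Av
          linear_scale[OF bounded_linear.linear[OF sqrt_dual_props(1)]] by simp
    qed
  qed
  then show ?thesis using Av vel unfolding free_weak_solution_def by blast
qed

end

lemma (in sa_operator) sol_diff:
  assumes "sol (\<lambda>_. k) (\<lambda>_. 0) W V" "sol (\<lambda>_. k) (\<lambda>_. 0) W' V'"
  shows "sol (\<lambda>_. k) (\<lambda>_. 0) (\<lambda>t. W t - W' t) (\<lambda>t. V t - V' t)"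
  unfolding sol_def
proof (intro conjI ballI allI impI)
  show "continuous_on {0..} (\<lambda>t. W t - W' t)" "continuous_on {0..} (\<lambda>t. V t - V' t)"
    using assms by (auto simp: sol_def intro: continuous_on_diff)
  fix g s t assume g: "g \<in> D" and s: "0 \<le> (s::real)" and t: "s \<le> t"
  have 1: "((\<lambda>r. cinner (V r) (B g)) has_integral cinner (W t - W s) g) {s..t}"
      "((\<lambda>r. - (of_real (k\<^sup>2) * cinner (W r) (B g) + 0 * cinner (V r) g)) has_integral cinner (V t - V s) g) {s..t}"
    using assms(1) g s t by (auto simp: sol_def)
  have 2: "((\<lambda>r. cinner (V' r) (B g)) has_integral cinner (W' t - W' s) g) {s..t}"
      "((\<lambda>r. - (of_real (k\<^sup>2) * cinner (W' r) (B g) + 0 * cinner (V' r) g)) has_integral cinner (V' t - V' s) g) {s..t}"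
    using assms(2) g s t by (auto simp: sol_def)
  show "((\<lambda>r. cinner (V r - V' r) (B g)) has_integral cinner (W t - W' t - (W s - W' s)) g) {s..t}"
    using has_integral_diff[OF 1(1) 2(1)] by (simp add: cinner_algebra algebra_simps)
  show "((\<lambda>r. - (of_real (k\<^sup>2) * cinner (W r - W' r) (B g) + 0 * cinner (V r - V' r) g)) has_integral
      cinner (V t - V' t - (V s - V' s)) g) {s..t}"
    using has_integral_diff[OF 1(2) 2(2)] by (simp add: cinner_algebra algebra_simps)
qed

text \<open>The difference is a free solution whose energy tends to zero.\<close>

lemma (in sa_operator) free_unique:
  assumes sol: "sol (\<lambda>_. k) (\<lambda>_. 0) W V" "sol (\<lambda>_. k) (\<lambda>_. 0) W' V'" and k: "0 < k"
    and lim: "((\<lambda>t. norm (W t - W' t) + norm (V t - V' t)) \<longlongrightarrow> 0) at_top"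
  shows "\<forall>t\<ge>0. W t = W' t"
proof -
  interpret f: wave_solution D B "\<lambda>_. k" "\<lambda>_. 0" "\<lambda>_. 0" 0 k k "\<lambda>t. W t - W' t" "\<lambda>t. V t - V' t"
    by unfold_locales (use k sol_diff[OF sol] in auto)
  have "(f.N \<longlongrightarrow> 0) at_top" using lim unfolding f.N_def by (simp add: add.commute)
  from f.N_vanishes[OF this] show ?thesis unfolding f.N_def by (simp add: add_nonneg_eq_0_iff)
qed

text \<open>Supplies the constants of the locale \<open>wave\<close>. \<open>c\<close> converges
  because \<open>\<nu>\<close> is bounded and monotone at positive times, and this identifies the
  value of \<open>Lim at_top c\<close>.\<close>

lemma coefficient_properties:
  assumes bv: "bounded_variation_on c {0<..}" and low: "(INF t\<in>{0..}. c t) > (0::real)"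
  shows "\<exists>\<nu> M \<kappa> K. (\<forall>s t. 0 < s \<longrightarrow> s \<le> t \<longrightarrow> \<bar>c t - c s\<bar> \<le> \<nu> t - \<nu> s) \<and>
      (\<forall>t. 0 \<le> \<nu> t \<and> \<nu> t \<le> M) \<and> 0 < \<kappa> \<and> (\<forall>t>0. \<kappa> \<le> c t \<and> c t \<le> K)"
    and "(c \<longlongrightarrow> Lim at_top c) at_top" and "0 < Lim at_top c"
proof -
  obtain \<nu> M where nu: "\<And>s t. 0 < s \<Longrightarrow> s \<le> t \<Longrightarrow> \<bar>c t - c s\<bar> \<le> \<nu> t - \<nu> s" "\<And>t. 0 \<le> \<nu> t \<and> \<nu> t \<le> M"
    using bounded_variation_dominating[OF bv] by blast
  have close: "\<bar>c t - c 1\<bar> \<le> M" if "0 < t" for t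
    using nu(1)[of 1 t] nu(1)[of t 1] nu(2)[of 1] nu(2)[of t] that by (cases "t \<le> 1") (auto simp: abs_minus_commute)
  define \<kappa> where "\<kappa> = (INF t\<in>{0..}. c t)"
  \<comment> \<open>The infimum is informative once the set is bounded below; \<open>c 0\<close> is
    treated apart, as the variation bound concerns positive times.\<close>
  have bdd: "bdd_below (c ` {0..})"
  proof (rule bdd_belowI2)
    fix t :: real assume "t \<in> {0..}"
    then show "min (c 0) (c 1 - M) \<le> c t" using close[of t] by (cases "t = 0") auto
  qed
  have \<kappa>: "\<kappa> \<le> c t" if "0 \<le> t" for t
    unfolding \<kappa>_def by (rule cINF_lower[OF bdd]) (use that in simp)
  have "\<exists>l. (c \<longlongrightarrow> l) at_top"
  proof (rule Cauchy_at_top_tendsto)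
    fix e :: real assume e: "0 < e"
    have bdd: "bdd_above (\<nu> ` {0<..})" using nu(2) by (meson bdd_aboveI2)
    have ne: "\<nu> ` {0<..} \<noteq> {}" by simp
    have "Sup (\<nu> ` {0<..}) - e < Sup (\<nu> ` {0<..})" using e by simp
    then obtain y where "y \<in> \<nu> ` {0<..}" "Sup (\<nu> ` {0<..}) - e < y" by (rule less_cSupE[OF _ ne])
    then obtain s where s: "0 < s" "Sup (\<nu> ` {0<..}) - e < \<nu> s" by auto
    have le: "\<bar>c q - c p\<bar> < e" if "s \<le> p" "p \<le> q" for p q
      using cSUP_upper[OF _ bdd, of q] nu(1)[of s p] nu(1)[of p q] s that by simp
    have "norm (c q - c p) < e" if "s \<le> p" "s \<le> q" for p q
      using le[of p q] le[of q p] that by (cases "p \<le> q") (auto simp: abs_minus_commute)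
    then show "\<exists>s. \<forall>p\<ge>s. \<forall>q\<ge>s. norm (c q - c p) < e" by blast
  qed
  then obtain l where l: "(c \<longlongrightarrow> l) at_top" by blast
  have Lim: "Lim at_top c = l" by (rule tendsto_Lim[OF _ l]) simp
  have "\<kappa> \<le> l"
    by (rule tendsto_lowerbound[OF l]) (use \<kappa> in \<open>auto simp: eventually_at_top_linorder\<close>)
  then have pos: "0 < Lim at_top c" using low unfolding \<kappa>_def Lim by linarith
  have "\<kappa> \<le> c t \<and> c t \<le> c 1 + M" if "0 < t" for t using close[OF that] \<kappa>[of t] that by simp
  moreover have "0 < \<kappa>" using low by (simp add: \<kappa>_def)
  ultimately show "\<exists>\<nu> M \<kappa> K. (\<forall>s t. 0 < s \<longrightarrow> s \<le> t \<longrightarrow> \<bar>c t - c s\<bar> \<le> \<nu> t - \<nu> s) \<and>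
      (\<forall>t. 0 \<le> \<nu> t \<and> \<nu> t \<le> M) \<and> 0 < \<kappa> \<and> (\<forall>t>0. \<kappa> \<le> c t \<and> c t \<le> K)"
    using nu by (intro exI[of _ \<nu>] exI[of _ M] exI[of _ \<kappa>] exI[of _ "c 1 + M"]) simp
  show "(c \<longlongrightarrow> Lim at_top c) at_top" "0 < Lim at_top c" using l Lim pos by auto
qed

theorem theorem1:
  fixes A :: "'h::complex_hilbert \<rightharpoonup> 'h"
    and \<iota> :: "'h \<Rightarrow> 'k::complex_banach"
    and j :: "'h \<Rightarrow> 'm::complex_banach"
    and c :: "real \<Rightarrow> real" and b :: "real \<Rightarrow> complex" and c_inf :: real
  assumes "separable_space (euclidean :: 'h topology)"
    and "self_adjoint A" and "nonneg_op A" and "injective_op A"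
    and "homogeneous_space A \<iota>" and "dual_space A j"
    and "bounded_variation_on c {0<..}" and "(INF t\<in>{0..}. c t) > 0"
    and "c_inf = Lim at_top c"
    and "b absolutely_integrable_on {0..}"
  shows "((\<exists>L. ((\<lambda>t. integral {0..t} (\<lambda>s. c s - c_inf)) \<longlongrightarrow> L) at_top) \<longrightarrow>
            (\<forall>u. weak_solution A \<iota> j c b u \<longrightarrow>
               (\<exists>v. free_weak_solution A \<iota> j c_inf v \<and> asymptotic A \<iota> u v \<and>
                    (\<forall>w. free_weak_solution A \<iota> j c_inf w \<and> asymptotic A \<iota> u w \<longrightarrow>
                         (\<forall>t\<ge>0. w t = v t)))))
       \<and> (\<forall>u c_star v.
            weak_solution A \<iota> j c b u \<and> (\<exists>t\<ge>0. u t \<noteq> 0) \<and> c_star > 0 \<and>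
            free_weak_solution A \<iota> j c_star v \<and> asymptotic A \<iota> u v \<longrightarrow>
              c_star = c_inf \<and>
              (\<exists>L. ((\<lambda>t. integral {0..t} (\<lambda>s. c s - c_inf)) \<longlongrightarrow> L) at_top))"
proof -
  obtain \<nu> M \<kappa> K where coeff: "(\<forall>s t. 0 < s \<longrightarrow> s \<le> t \<longrightarrow> \<bar>c t - c s\<bar> \<le> \<nu> t - \<nu> s) \<and>
      (\<forall>t. 0 \<le> \<nu> t \<and> \<nu> t \<le> M) \<and> 0 < \<kappa> \<and> (\<forall>t>0. \<kappa> \<le> c t \<and> c t \<le> K)"
    using coefficient_properties(1)[OF assms(7,8)] by (elim exE)
  note clim = coefficient_properties(2,3)[OF assms(7,8), folded assms(9)]
  interpret E: energy_spaces A \<iota> j by unfold_locales fact+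
  interpret w: wave E.D E.B c b \<nu> M K \<kappa>
    by unfold_locales (use coeff assms(10) in simp_all)
  have phase: "integral {0..t} (\<lambda>s. c s - c_inf) = w.\<tau> t - c_inf * t" if "0 \<le> t" for t
    using Henstock_Kurzweil_Integration.integral_diff[OF w.c_integrable[of 0 t] integrable_const_ivl[of c_inf 0 t]] that
    by (simp add: w.\<tau>_def mult.commute)
  have phase_lim: "((\<lambda>t. integral {0..t} (\<lambda>s. c s - c_inf)) \<longlongrightarrow> L) at_top \<longleftrightarrow> ((\<lambda>t. w.\<tau> t - c_inf * t) \<longlongrightarrow> L) at_top" for L
    by (rule tendsto_cong, rule eventually_mono[OF eventually_ge_at_top[of 0]]) (rule phase)
  have free: "E.sol (\<lambda>_. k) (\<lambda>_. 0) (\<lambda>t. E.\<A> (v t)) (velocity A \<iota> v)" if "free_weak_solution A \<iota> j k v" for k v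
    using E.weak_solution_sol that unfolding free_weak_solution_def by blast
  have asym: "asymptotic A \<iota> u v \<longleftrightarrow>
      ((\<lambda>t. norm (E.\<A> (u t) - E.\<A> (v t)) + norm (velocity A \<iota> u t - velocity A \<iota> v t)) \<longlongrightarrow> 0) at_top" for u v
    unfolding asymptotic_def E.\<A>_def[symmetric] E.A_lin(2) ..
  have asym_free: "asymptotic A \<iota> u v \<longleftrightarrow>
      ((\<lambda>t. norm (E.\<A> (u t) - E.free_W k p q t) + norm (velocity A \<iota> u t - E.free_V k p q t)) \<longlongrightarrow> 0) at_top"
    if "\<forall>t\<ge>0. E.\<A> (v t) = E.free_W k p q t \<and> velocity A \<iota> v t = E.free_V k p q t" for u v k p q
    unfolding asym
    by (rule tendsto_cong, rule eventually_mono[OF eventually_ge_at_top[of 0]]) (use that in simp)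
  show ?thesis
  proof (intro conjI impI allI)
    fix u assume ex: "\<exists>L. ((\<lambda>t. integral {0..t} (\<lambda>s. c s - c_inf)) \<longlongrightarrow> L) at_top"
      and u: "weak_solution A \<iota> j c b u"
    interpret s: wave_solution E.D E.B c b \<nu> M K \<kappa> "\<lambda>t. E.\<A> (u t)" "velocity A \<iota> u"
      by unfold_locales (rule E.weak_solution_sol[OF u])
    obtain L where "((\<lambda>t. w.\<tau> t - c_inf * t) \<longlongrightarrow> L) at_top" using ex unfolding phase_lim by blast
    from s.asymptotically_free[OF clim this] obtain p q where
      pq: "((\<lambda>t. norm (E.\<A> (u t) - E.free_W c_inf p q t) + norm (velocity A \<iota> u t - E.free_V c_inf p q t)) \<longlongrightarrow> 0) at_top"
      by blast
    obtain v where v: "free_weak_solution A \<iota> j c_inf v"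
      "\<forall>t\<ge>0. E.\<A> (v t) = E.free_W c_inf p q t \<and> velocity A \<iota> v t = E.free_V c_inf p q t"
      using E.free_weak_solution_exists[OF clim(2)] by blast
    have uv: "asymptotic A \<iota> u v" using pq unfolding asym_free[OF v(2)] .
    have "\<forall>t\<ge>0. w t = v t" if w: "free_weak_solution A \<iota> j c_inf w" "asymptotic A \<iota> u w" for w
    proof -
      \<comment> \<open>Both candidates approach \<open>u\<close>, hence each other.\<close>
      have "((\<lambda>t. norm (E.\<A> (w t) - E.\<A> (v t)) + norm (velocity A \<iota> w t - velocity A \<iota> v t)) \<longlongrightarrow> 0) at_top"
      proof (rule Lim_null_comparison[OF always_eventually])
        show "((\<lambda>t. (norm (E.\<A> (u t) - E.\<A> (w t)) + norm (velocity A \<iota> u t - velocity A \<iota> w t))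
            + (norm (E.\<A> (u t) - E.\<A> (v t)) + norm (velocity A \<iota> u t - velocity A \<iota> v t))) \<longlongrightarrow> 0) at_top"
          using tendsto_add[OF w(2)[unfolded asym] uv[unfolded asym]] by simp
        have tri: "norm (y - z) \<le> norm (x - y) + norm (x - z)" for x y z :: 'h
          using norm_triangle_ineq4[of "x - z" "x - y"] by simp
        show "\<forall>t. norm (norm (E.\<A> (w t) - E.\<A> (v t)) + norm (velocity A \<iota> w t - velocity A \<iota> v t))
            \<le> (norm (E.\<A> (u t) - E.\<A> (w t)) + norm (velocity A \<iota> u t - velocity A \<iota> w t))
            + (norm (E.\<A> (u t) - E.\<A> (v t)) + norm (velocity A \<iota> u t - velocity A \<iota> v t))"
        proof
          fix t
          show "norm (norm (E.\<A> (w t) - E.\<A> (v t)) + norm (velocity A \<iota> w t - velocity A \<iota> v t))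
            \<le> (norm (E.\<A> (u t) - E.\<A> (w t)) + norm (velocity A \<iota> u t - velocity A \<iota> w t))
            + (norm (E.\<A> (u t) - E.\<A> (v t)) + norm (velocity A \<iota> u t - velocity A \<iota> v t))"
            using tri[of "E.\<A> (w t)" "E.\<A> (v t)" "E.\<A> (u t)"] tri[of "velocity A \<iota> w t" "velocity A \<iota> v t" "velocity A \<iota> u t"]
            by simp
        qed
      qed
      from E.free_unique[OF free[OF w(1)] free[OF v(1)] clim(2) this] show ?thesis using E.A_inj by blast
    qed
    then show "\<exists>v. free_weak_solution A \<iota> j c_inf v \<and> asymptotic A \<iota> u v \<and>
        (\<forall>w. free_weak_solution A \<iota> j c_inf w \<and> asymptotic A \<iota> u w \<longrightarrow> (\<forall>t\<ge>0. w t = v t))"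
      using v(1) uv by blast
  next
    fix u c_star v
    assume h: "weak_solution A \<iota> j c b u \<and> (\<exists>t\<ge>0. u t \<noteq> 0) \<and> c_star > 0 \<and>
        free_weak_solution A \<iota> j c_star v \<and> asymptotic A \<iota> u v"
    interpret s: wave_solution E.D E.B c b \<nu> M K \<kappa> "\<lambda>t. E.\<A> (u t)" "velocity A \<iota> u"
      by unfold_locales (rule E.weak_solution_sol, use h in blast)
    obtain t0 where t0: "0 \<le> t0" "u t0 \<noteq> 0" using h by blast
    \<comment> \<open>\<open>\<A>\<close> is isometric, so a non-zero value of \<open>u\<close> is a
      non-zero state in energy space.\<close>
    have nz: "velocity A \<iota> u t0 \<noteq> 0 \<or> E.\<A> (u t0) \<noteq> 0" using E.A_norm[of "u t0"] t0(2) by auto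
    have cs: "0 < c_star" and v: "free_weak_solution A \<iota> j c_star v" and uv: "asymptotic A \<iota> u v" using h by auto
    obtain p q where pq: "\<forall>t\<ge>0. velocity A \<iota> v t = E.free_V c_star p q t \<and> E.\<A> (v t) = E.free_W c_star p q t"
      using E.free_representation[OF free[OF v] cs] by blast
    have pq': "\<forall>t\<ge>0. E.\<A> (v t) = E.free_W c_star p q t \<and> velocity A \<iota> v t = E.free_V c_star p q t" using pq by blast
    have "c_star = c_inf \<and> (\<exists>l. ((\<lambda>t. w.\<tau> t - c_inf * t) \<longlongrightarrow> l) at_top)"
      by (rule s.free_limit_implies[OF clim cs uv[unfolded asym_free[OF pq']] t0(1) nz E.B_inj])
    then show "c_star = c_inf" "\<exists>L. ((\<lambda>t. integral {0..t} (\<lambda>s. c s - c_inf)) \<longlongrightarrow> L) at_top"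
      unfolding phase_lim by auto
  qed
qed

end
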